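(* Let $\omega\in L^2(\mathbb R_+)$ be a decreasing function such that for some $\delta>0$ we have $x\omega(x)\ge\delta$ and $\omega(2x)\ge\delta\,\omega(x)$ for all $x\ge 1$. Let $(\zeta_m)_{m\in\mathbb Z}$ be a sequence of independent standard Gaussian complex variables, and let $f$ be the random function defined by $$\widehat f(n)=\zeta_n\,\omega(|n|),\qquad n\in\mathbb Z$$ (almost surely, $f\in L^2[-\pi,\pi]$). Then there exists $\varepsilon>0$ such that, almost surely, one can find $\Lambda=\Lambda(f)\subset\mathbb R$ with $D_{BM}(\Lambda)<1-\varepsilon$ and $$f\in\operatorname{span}\{e^{i\lambda t}:\lambda\in\Lambda\}.$$ Moreover, the system $\{e^{i\lambda t}:\lambda\in\Lambda\}$ is a Riesz basis in its closed linear span in $L^2[-\pi,\pi]$, and $$f(t)=\sum_{\lambda\in\Lambda}a_\lambda e^{i\lambda t}$$ with convergence in $L^2[-\pi,\pi]$, for some coefficients $(a_\lambda)_{\lambda\in\Lambda}\in\ell^2$.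
   Context: $\mathbb R_+=[0,\infty)$, and $\omega$ is real-valued on $\mathbb R_+$ (so $\omega(0)$ is finite). A standard Gaussian complex variable is a complex random variable whose real and imaginary parts are independent normal random variables with mean $0$ and variance $1/2$. $\widehat f(n)$, $n\in\mathbb Z$, are the Fourier coefficients of $f$ with respect to the orthonormal basis $\{e^{int}\}_{n\in\mathbb Z}$ of $L^2[-\pi,\pi]$ (normalized measure $dt/2\pi$), so $f(t)=\sum_n\widehat f(n)e^{int}$. $\operatorname{span}$ denotes the closed linear span in $L^2[-\pi,\pi]$. A disjoint sequence of bounded intervals $(I_n)$ on the real line is called a long sequence of intervals if $|I_n|\to\infty$ and $\sum_n\frac{|I_n|^2}{1+\operatorname{dist}^2(0,I_n)}=\infty$. For $\Lambda\subset\mathbb R$, the Beurling--Malliavin density $D_{BM}(\Lambda)$ is the supremum of those $d$ for which there exists a long sequence of intervals $(I_n)$ such that $\operatorname{card}(\Lambda\cap I_n)>d|I_n|$ for all $n$. *)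

theory Defs
  imports "HOL-Probability.Probability"
begin

text \<open>
  \<open>L\<^sup>2\<close> is treated at the level of functions: \<open>L2\<close> is the set of square-integrable functions
  (not of their classes), and equality of classes is vanishing of \<open>L2_norm\<close> of the difference.
\<close>

definition L2 :: "'a measure \<Rightarrow> ('a \<Rightarrow> 'b::{real_normed_vector, second_countable_topology}) set"
  where "L2 M = {f \<in> borel_measurable M. integrable M (\<lambda>x. (norm (f x))\<^sup>2)}"

definition L2_norm :: "'a measure \<Rightarrow> ('a \<Rightarrow> 'b::real_normed_vector) \<Rightarrow> real"
  where "L2_norm M f = sqrt (LINT x|M. (norm (f x))\<^sup>2)"

text \<open>The normalized Lebesgue measure \<open>dt / 2\<pi>\<close> on \<open>[-\<pi>, \<pi>]\<close>.\<close>

definition circ :: "real measure"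
  where "circ = density (lebesgue_on {-pi..pi}) (\<lambda>_. ennreal (1 / (2 * pi)))"

definition expo :: "real \<Rightarrow> real \<Rightarrow> complex"
  where "expo l t = exp (\<i> * complex_of_real (l * t))"

definition fourier_coeff :: "(real \<Rightarrow> complex) \<Rightarrow> int \<Rightarrow> complex"
  where "fourier_coeff f n = (LINT t|circ. f t * cnj (expo (real_of_int n) t))"

definition L2_closed_span :: "'a measure \<Rightarrow> ('i \<Rightarrow> 'a \<Rightarrow> complex) \<Rightarrow> 'i set \<Rightarrow> ('a \<Rightarrow> complex) set"
  where "L2_closed_span M e I =
    {f \<in> L2 M. \<forall>r>0. \<exists>S c. finite S \<and> S \<subseteq> I \<and> L2_norm M (\<lambda>t. f t - (\<Sum>i\<in>S. c i * e i t)) < r}"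

text \<open>
  A family is a Riesz basis in \<open>H\<close> if its closed linear span is \<open>H\<close> and the norm of a finite
  linear combination is comparable to the \<open>\<ell>\<^sup>2\<close>-norm of its coefficients.
\<close>

definition riesz_basis ::
  "'a measure \<Rightarrow> ('i \<Rightarrow> 'a \<Rightarrow> complex) \<Rightarrow> 'i set \<Rightarrow> ('a \<Rightarrow> complex) set \<Rightarrow> bool"
  where "riesz_basis M e I H \<longleftrightarrow>
    (\<forall>i\<in>I. e i \<in> L2 M) \<and> L2_closed_span M e I = H \<and>
    (\<exists>A B. 0 < A \<and> (\<forall>S c. finite S \<and> S \<subseteq> I \<longrightarrow>
       A * (\<Sum>i\<in>S. (cmod (c i))\<^sup>2) \<le> (L2_norm M (\<lambda>t. \<Sum>i\<in>S. c i * e i t))\<^sup>2 \<and>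
       (L2_norm M (\<lambda>t. \<Sum>i\<in>S. c i * e i t))\<^sup>2 \<le> B * (\<Sum>i\<in>S. (cmod (c i))\<^sup>2)))"

text \<open>Unordered convergence in \<open>L\<^sup>2\<close> along the finite subsets of the index set.\<close>

definition has_L2_sum :: "'a measure \<Rightarrow> ('i \<Rightarrow> 'a \<Rightarrow> complex) \<Rightarrow> 'i set \<Rightarrow> ('a \<Rightarrow> complex) \<Rightarrow> bool"
  where "has_L2_sum M g I f \<longleftrightarrow>
    ((\<lambda>S. L2_norm M (\<lambda>t. f t - (\<Sum>i\<in>S. g i t))) \<longlongrightarrow> 0) (finite_subsets_at_top I)"

definition standard_complex_gaussian :: "'a measure \<Rightarrow> ('a \<Rightarrow> complex) \<Rightarrow> bool"
  where "standard_complex_gaussian M Z \<longleftrightarrow>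
    Z \<in> borel_measurable M \<and>
    prob_space.indep_var M borel (\<lambda>w. Re (Z w)) borel (\<lambda>w. Im (Z w)) \<and>
    distributed M lborel (\<lambda>w. Re (Z w)) (\<lambda>x. ennreal (normal_density 0 (sqrt (1/2)) x)) \<and>
    distributed M lborel (\<lambda>w. Im (Z w)) (\<lambda>x. ennreal (normal_density 0 (sqrt (1/2)) x))"

definition long_intervals :: "(nat \<Rightarrow> real set) \<Rightarrow> bool"
  where "long_intervals I \<longleftrightarrow>
    (\<forall>n. I n \<noteq> {} \<and> is_interval (I n) \<and> bounded (I n)) \<and> disjoint_family I \<and>
    filterlim (\<lambda>n. measure lborel (I n)) at_top sequentially \<and>
    \<not> summable (\<lambda>n. (measure lborel (I n))\<^sup>2 / (1 + (infdist 0 (I n))\<^sup>2))"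

text \<open>
  The disjunct \<open>infinite\<close> is needed because \<open>card\<close> of an infinite set is \<open>0\<close>;
  the supremum may be \<open>\<infinity>\<close>.
\<close>

definition BM_density :: "real set \<Rightarrow> ereal"
  where "BM_density \<Lambda> = Sup {ereal d | d. \<exists>I. long_intervals I \<and>
    (\<forall>n. infinite (\<Lambda> \<inter> I n) \<or> real (card (\<Lambda> \<inter> I n)) > d * measure lborel (I n))}"

end

theory Submission
  imports Defs
begin

text \<open>
  An exponential \<open>e\<^sup>i\<^sup>\<lambda>\<^sup>t\<close> carries three real parameters, its complex coefficient and its frequency, while a
  Fourier coefficient of \<open>f\<close> imposes two real equations. This surplus allows a positive proportion of
  the integer frequencies to be omitted if some of the others move a little.

  The integers \<open>D k - 2, \<dots>, D k + 2\<close> form a block; \<open>D\<close> is a large even number. A block is good if the five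
  coefficients of \<open>f\<close>, divided by \<open>\<omega> (D \<bar>k\<bar>)\<close> and with alternating signs, are close to \<open>\<i>, 1, 0, 1, \<i>\<close>.
  In a good block the central frequency is omitted and the frequency \<open>D k + m\<close>, for \<open>m = 1, -1, 2, -2\<close>, is shifted
  by a small \<open>\<theta> m\<close>. Up to normalization, an exponential with amplitude \<open>\<alpha> m\<close> at this frequency
  contributes \<open>\<alpha> m * \<theta> m / (m - j + \<theta> m)\<close> to the coefficient with index \<open>D k + j\<close>. Two complex equations
  are to be solved for the four real shifts: the contributions at \<open>j = 0\<close> have to produce the missing central
  coefficient, and the moment \<open>\<Sum>m. \<alpha> m * \<theta> m\<close> has to vanish. For \<open>\<alpha> = (1, 1, \<i>, \<i>)\<close> the linearized
  equations determine the shifts. The moment condition says that the sum over the block is continuous across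
  \<open>\<plusminus>\<pi>\<close>; because of it, a block disturbs the coefficients at distance \<open>J\<close> only by \<open>O (1 / J\<^sup>2)\<close>.
  The hypotheses on \<open>\<omega>\<close> turn this decay into a bound of order \<open>1 / D\<close> for the influence of all other blocks on one
  block, relative to its own size (\<open>weak_coupling\<close>). The equations of all good blocks are then solved
  simultaneously by a contraction in the supremum norm (\<open>solution_exists\<close>). What remains of \<open>f\<close> has no
  coefficients in the good blocks and is a series of exponentials with integer frequencies outside of them
  (\<open>spectral_representation\<close>).

  All frequencies stay within \<open>1/500\<close> of distinct integers, so that they form a Riesz sequence by the
  argument of Paley and Wiener (\<open>perturbed_exponentials_riesz\<close>). A block is good with probability bounded below
  and the blocks are independent. By Hoeffding's inequality and the Borel--Cantelli lemma, almost surely all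
  but finitely many windows whose length is at least the square root of their distance to the origin contain a fixed
  proportion of good blocks (\<open>window_frequency\<close>). Disjoint intervals in shorter windows do not form a long
  sequence, and this bounds the Beurling--Malliavin density (\<open>BM_density_le\<close>).
\<close>

section \<open>Square-integrable functions\<close>

lemma L2_measurable: "f \<in> L2 M \<Longrightarrow> f \<in> borel_measurable M"
  by (simp add: L2_def)

lemma L2_integrable: "f \<in> L2 M \<Longrightarrow> integrable M (\<lambda>x. (norm (f x))\<^sup>2)"
  by (simp add: L2_def)

lemma L2_norm_nonneg: "0 \<le> L2_norm M f"
  by (simp add: L2_norm_def)

lemma L2_norm_power2: "(L2_norm M f)\<^sup>2 = (LINT x|M. (norm (f x))\<^sup>2)"
  by (simp add: L2_norm_def)

text \<open>A weighted form of the triangle inequality. Integrated and optimized over \<open>s\<close> it yields Minkowski's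
  inequality without the Cauchy--Schwarz inequality.\<close>

lemma norm_add_power2_le:
  fixes x y :: "'b::real_normed_vector" and s :: real
  assumes "s > 0"
  shows "(norm (x + y))\<^sup>2 \<le> (1 + s) * (norm x)\<^sup>2 + (1 + 1 / s) * (norm y)\<^sup>2"
proof -
  have "(norm (x + y))\<^sup>2 \<le> (norm x + norm y)\<^sup>2"
    by (simp add: norm_triangle_ineq power_mono)
  also have "\<dots> \<le> (1 + s) * (norm x)\<^sup>2 + (1 + 1 / s) * (norm y)\<^sup>2"
  proof -
    have "0 \<le> (s * norm x - norm y)\<^sup>2 / s" using assms by simp
    also have "\<dots> = s * (norm x)\<^sup>2 + (norm y)\<^sup>2 / s - 2 * norm x * norm y"
      using assms by (simp add: power2_eq_square field_simps)
    finally show ?thesis by (simp add: power2_eq_square algebra_simps)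
  qed
  finally show ?thesis .
qed

lemma L2_add:
  fixes f g :: "'a \<Rightarrow> complex"
  assumes "f \<in> L2 M" "g \<in> L2 M"
  shows "(\<lambda>x. f x + g x) \<in> L2 M"
proof -
  have [measurable]: "f \<in> borel_measurable M" "g \<in> borel_measurable M"
    using assms by (auto simp: L2_def)
  have "integrable M (\<lambda>x. 2 * (norm (f x))\<^sup>2 + 2 * (norm (g x))\<^sup>2)"
    using assms by (auto simp: L2_def)
  moreover have AE: "AE x in M. norm ((norm (f x + g x))\<^sup>2) \<le> norm (2 * (norm (f x))\<^sup>2 + 2 * (norm (g x))\<^sup>2)"
    using norm_add_power2_le[of 1 "f _" "g _"] by (intro AE_I2) simp
  ultimately have "integrable M (\<lambda>x. (norm (f x + g x))\<^sup>2)"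
    by (elim Bochner_Integration.integrable_bound) measurable
  then show ?thesis by (simp add: L2_def)
qed

lemma L2_scale:
  fixes f :: "'a \<Rightarrow> complex"
  assumes "f \<in> L2 M"
  shows "(\<lambda>x. c * f x) \<in> L2 M"
  using assms by (auto simp: L2_def norm_mult power_mult_distrib)

lemma L2_zero: "(\<lambda>x. 0 :: complex) \<in> L2 M"
  by (simp add: L2_def)

lemma L2_diff:
  fixes f g :: "'a \<Rightarrow> complex"
  assumes "f \<in> L2 M" "g \<in> L2 M"
  shows "(\<lambda>x. f x - g x) \<in> L2 M"
  using L2_add[OF assms(1) L2_scale[OF assms(2), of "-1"]] by simp

lemma L2_sum:
  fixes f :: "'i \<Rightarrow> 'a \<Rightarrow> complex"
  assumes "\<And>i. i \<in> S \<Longrightarrow> f i \<in> L2 M"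
  shows "(\<lambda>x. \<Sum>i\<in>S. f i x) \<in> L2 M"
  using assms by (induction S rule: infinite_finite_induct) (auto simp: L2_zero L2_add)

lemma L2_sum_scale:
  fixes f :: "'i \<Rightarrow> 'a \<Rightarrow> complex"
  assumes "\<And>i. i \<in> S \<Longrightarrow> f i \<in> L2 M"
  shows "(\<lambda>x. \<Sum>i\<in>S. c i * f i x) \<in> L2 M"
  using assms by (intro L2_sum L2_scale)

lemma borel_measurable_cnj [measurable]: "cnj \<in> borel_measurable borel"
  by (intro borel_measurable_continuous_onI continuous_intros)

lemma L2_inner_integrable:
  fixes f g :: "'a \<Rightarrow> complex"
  assumes "f \<in> L2 M" "g \<in> L2 M"
  shows "integrable M (\<lambda>x. f x * cnj (g x))"
proof -
  have [measurable]: "f \<in> borel_measurable M" "g \<in> borel_measurable M"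
    using assms by (auto simp: L2_def)
  have "integrable M (\<lambda>x. (norm (f x))\<^sup>2 + (norm (g x))\<^sup>2)"
    using assms by (auto simp: L2_def)
  moreover have AE: "AE x in M. norm (f x * cnj (g x)) \<le> norm ((norm (f x))\<^sup>2 + (norm (g x))\<^sup>2)"
  proof (intro AE_I2)
    fix x
    have "norm (f x) * norm (g x) \<le> (norm (f x))\<^sup>2 + (norm (g x))\<^sup>2"
      using sum_squares_bound[of "norm (f x)" "norm (g x)"]
        mult_nonneg_nonneg[OF norm_ge_zero[of "f x"] norm_ge_zero[of "g x"]] by linarith
    then show "norm (f x * cnj (g x)) \<le> norm ((norm (f x))\<^sup>2 + (norm (g x))\<^sup>2)"
      by (simp add: norm_mult)
  qed
  ultimately show ?thesis
    by (elim Bochner_Integration.integrable_bound) measurable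
qed

lemma L2_norm_minus_commute:
  fixes f g :: "'a \<Rightarrow> complex"
  shows "L2_norm M (\<lambda>x. f x - g x) = L2_norm M (\<lambda>x. g x - f x)"
  by (simp add: L2_norm_def norm_minus_commute)

text \<open>The optimal weight \<open>s\<close> is the quotient of the two norms. Both norms are enlarged by \<open>e / 2\<close> first, which
  avoids division by zero.\<close>

lemma L2_norm_triangle:
  fixes f g :: "'a \<Rightarrow> complex"
  assumes "f \<in> L2 M" "g \<in> L2 M"
  shows "L2_norm M (\<lambda>x. f x + g x) \<le> L2_norm M f + L2_norm M g"
proof -
  define a b where "a = L2_norm M f" and "b = L2_norm M g"
  have ab: "a \<ge> 0" "b \<ge> 0" by (simp_all add: a_def b_def L2_norm_nonneg)
  have weighted: "(L2_norm M (\<lambda>x. f x + g x))\<^sup>2 \<le> (1 + s) * a\<^sup>2 + (1 + 1 / s) * b\<^sup>2" if "s > 0" for s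
  proof -
    have "(LINT x|M. (norm (f x + g x))\<^sup>2)
      \<le> (LINT x|M. (1 + s) * (norm (f x))\<^sup>2 + (1 + 1 / s) * (norm (g x))\<^sup>2)"
      using L2_integrable[OF L2_add[OF assms]] assms norm_add_power2_le[OF that]
      by (intro integral_mono) (auto simp: L2_def)
    also have "\<dots> = (1 + s) * a\<^sup>2 + (1 + 1 / s) * b\<^sup>2"
      using assms by (simp add: L2_def a_def b_def L2_norm_power2)
    finally show ?thesis by (simp add: L2_norm_power2)
  qed
  have "L2_norm M (\<lambda>x. f x + g x) \<le> a + b + e" if "e > 0" for e
  proof -
    define p q where "p = a + e/2" and "q = b + e/2"
    have pq: "p > 0" "q > 0" using ab that by (auto simp: p_def q_def)
    have "(L2_norm M (\<lambda>x. f x + g x))\<^sup>2 \<le> (1 + q / p) * a\<^sup>2 + (1 + 1 / (q / p)) * b\<^sup>2"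
      using pq by (intro weighted) simp
    also have "\<dots> \<le> (1 + q / p) * p\<^sup>2 + (1 + 1 / (q / p)) * q\<^sup>2"
      using pq ab that by (intro add_mono mult_left_mono power_mono) (auto simp: p_def q_def)
    also have "\<dots> = (p + q)\<^sup>2" using pq by (simp add: power2_eq_square field_simps)
    finally show ?thesis using pq by (auto simp: p_def q_def dest: power2_le_imp_le)
  qed
  then show ?thesis unfolding a_def b_def by (rule field_le_epsilon)
qed

lemma L2_norm_sum_le:
  fixes f :: "'i \<Rightarrow> 'a \<Rightarrow> complex"
  assumes "\<And>i. i \<in> S \<Longrightarrow> f i \<in> L2 M"
  shows "L2_norm M (\<lambda>x. \<Sum>i\<in>S. f i x) \<le> (\<Sum>i\<in>S. L2_norm M (f i))"
  using assms
proof (induction S rule: infinite_finite_induct)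
  case (insert i S)
  have "L2_norm M (\<lambda>x. f i x + (\<Sum>i\<in>S. f i x)) \<le> L2_norm M (f i) + L2_norm M (\<lambda>x. \<Sum>i\<in>S. f i x)"
    using insert by (intro L2_norm_triangle L2_sum) auto
  then show ?case using insert by auto
qed (auto simp: L2_norm_def)

lemma L2_norm_triangle_diff:
  fixes f g h :: "'a \<Rightarrow> complex"
  assumes "f \<in> L2 M" "g \<in> L2 M" "h \<in> L2 M"
  shows "L2_norm M (\<lambda>x. f x - h x) \<le> L2_norm M (\<lambda>x. f x - g x) + L2_norm M (\<lambda>x. g x - h x)"
  using L2_norm_triangle[OF L2_diff[OF assms(1,2)] L2_diff[OF assms(2,3)]] by simp

lemma (in prob_space) L2_imp_integrable:
  fixes f :: "'a \<Rightarrow> complex"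
  assumes "f \<in> L2 M"
  shows "integrable M f"
  using L2_inner_integrable[OF assms, of "\<lambda>_. 1"] by (simp add: L2_def)

text \<open>The variance of \<open>\<bar>f\<bar>\<close> is nonnegative.\<close>

lemma (in prob_space) L1_le_L2_norm:
  fixes f :: "'a \<Rightarrow> complex"
  assumes "f \<in> L2 M"
  shows "(LINT x|M. norm (f x)) \<le> L2_norm M f"
proof -
  have "variance (\<lambda>x. norm (f x)) \<ge> 0" by simp
  moreover have "variance (\<lambda>x. norm (f x)) = expectation (\<lambda>x. (norm (f x))\<^sup>2) - (expectation (\<lambda>x. norm (f x)))\<^sup>2"
    using assms L2_imp_integrable[OF assms] by (intro variance_eq) (auto simp: L2_def)
  ultimately have "(LINT x|M. norm (f x))\<^sup>2 \<le> (L2_norm M f)\<^sup>2"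
    by (simp add: L2_norm_power2)
  then show ?thesis using L2_norm_nonneg power2_le_imp_le by blast
qed

text \<open>The Riesz--Fischer argument. On a probability space the increments are also summable in \<open>L\<^sup>1\<close>,
  which gives almost everywhere convergence at once; Fatou's lemma then identifies the limit in the mean.\<close>

lemma (in prob_space) L2_complete_fast:
  fixes F :: "nat \<Rightarrow> 'a \<Rightarrow> complex"
  assumes F: "\<And>n. F n \<in> L2 M"
    and fast: "\<And>n. L2_norm M (\<lambda>x. F (Suc n) x - F n x) \<le> (1/2) ^ n"
  shows "\<exists>g\<in>L2 M. \<forall>n. L2_norm M (\<lambda>x. g x - F n x) \<le> 2 * (1/2) ^ n"
proof -
  have [measurable]: "F n \<in> borel_measurable M" for n using F[of n] by (simp add: L2_def)
  define d where "d n x = F (Suc n) x - F n x" for n x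
  have dL2: "d n \<in> L2 M" for n unfolding d_def using F by (intro L2_diff)
  have [measurable]: "d n \<in> borel_measurable M" for n using dL2[of n] by (simp add: L2_def)
  have dint: "(\<integral>\<^sup>+x. ennreal (norm (d n x)) \<partial>M) \<le> ennreal ((1/2) ^ n)" for n
  proof -
    have "(\<integral>\<^sup>+x. ennreal (norm (d n x)) \<partial>M) = ennreal (LINT x|M. norm (d n x))"
      using L2_imp_integrable[OF dL2] by (intro nn_integral_eq_integral) auto
    also have "\<dots> \<le> ennreal ((1/2)^n)"
      using L1_le_L2_norm[OF dL2[of n]] fast[of n] by (intro ennreal_leI) (simp add: d_def[abs_def])
    finally show ?thesis .
  qed
  have "(\<integral>\<^sup>+x. (\<Sum>n. ennreal (norm (d n x))) \<partial>M) = (\<Sum>n. \<integral>\<^sup>+x. ennreal (norm (d n x)) \<partial>M)"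
    by (intro nn_integral_suminf) measurable
  also have "\<dots> \<le> (\<Sum>n. ennreal ((1/2) ^ n))" by (intro suminf_le dint) auto
  also have "\<dots> = ennreal (\<Sum>n. (1/2) ^ n)"
    by (intro suminf_ennreal2) (auto intro: summable_geometric)
  finally have "(\<integral>\<^sup>+x. (\<Sum>n. ennreal (norm (d n x))) \<partial>M) \<noteq> \<infinity>" by (auto simp: top_unique)
  then have "AE x in M. (\<Sum>n. ennreal (norm (d n x))) \<noteq> \<infinity>"
    by (intro nn_integral_PInf_AE) measurable
  then have conv: "AE x in M. convergent (\<lambda>n. F n x)"
  proof (rule AE_mp, intro AE_I2 impI)
    fix x assume "(\<Sum>n. ennreal (norm (d n x))) \<noteq> \<infinity>"
    then have "summable (\<lambda>n. norm (d n x))" by (intro summable_suminf_not_top) auto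
    then have "summable (\<lambda>n. d n x)" by (rule summable_norm_cancel)
    then have "(\<lambda>n. \<Sum>i<n. d i x) \<longlonglongrightarrow> (\<Sum>i. d i x)" by (rule summable_LIMSEQ)
    moreover have "(\<Sum>i<n. d i x) = F n x - F 0 x" for n
      unfolding d_def by (rule sum_lessThan_telescope)
    ultimately have "(\<lambda>n. F n x - F 0 x) \<longlonglongrightarrow> (\<Sum>i. d i x)" by simp
    then have "(\<lambda>n. F n x - F 0 x + F 0 x) \<longlonglongrightarrow> (\<Sum>i. d i x) + F 0 x" by (intro tendsto_intros)
    then show "convergent (\<lambda>n. F n x)" by (auto simp: convergent_def)
  qed
  define g where "g x = lim (\<lambda>n. F n x)" for x
  have [measurable]: "g \<in> borel_measurable M"
    unfolding g_def by (intro borel_measurable_lim_metric) measurable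
  have lim: "AE x in M. (\<lambda>n. F n x) \<longlonglongrightarrow> g x"
    using conv by (rule AE_mp) (auto simp: g_def convergent_LIMSEQ_iff)
  have close: "L2_norm M (\<lambda>x. F (n + k) x - F n x) \<le> 2 * (1/2) ^ n" for n k
  proof -
    have "L2_norm M (\<lambda>x. F (n + k) x - F n x) \<le> (\<Sum>i<k. L2_norm M (d (n + i)))"
    proof (induction k)
      case 0 then show ?case by (simp add: L2_norm_def)
    next
      case (Suc k)
      have "L2_norm M (\<lambda>x. F (n + Suc k) x - F n x)
        \<le> L2_norm M (\<lambda>x. F (n + Suc k) x - F (n + k) x) + L2_norm M (\<lambda>x. F (n + k) x - F n x)"
        by (rule L2_norm_triangle_diff) (rule F)+
      then show ?case using Suc unfolding d_def by auto
    qed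
    also have "\<dots> \<le> (\<Sum>i<k. (1/2) ^ (n + i))" using fast by (intro sum_mono) (simp add: d_def[abs_def])
    also have "\<dots> = (1/2) ^ n * (\<Sum>i<k. (1/2) ^ i)" by (simp add: power_add sum_distrib_left)
    also have "(\<Sum>i<k. (1/2) ^ i) \<le> (2::real)"
      by (simp add: geometric_sum)
    finally show ?thesis by (simp add: mult.commute)
  qed
  have gd: "(\<integral>\<^sup>+x. ennreal ((norm (g x - F n x))\<^sup>2) \<partial>M) \<le> ennreal ((2 * (1/2) ^ n)\<^sup>2)" for n
  proof -
    have "(\<integral>\<^sup>+x. ennreal ((norm (g x - F n x))\<^sup>2) \<partial>M)
       = (\<integral>\<^sup>+x. liminf (\<lambda>k. ennreal ((norm (F k x - F n x))\<^sup>2)) \<partial>M)"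
    proof (rule nn_integral_cong_AE, use lim in \<open>rule AE_mp\<close>, intro AE_I2 impI)
      fix x assume "(\<lambda>n. F n x) \<longlonglongrightarrow> g x"
      then have "(\<lambda>k. ennreal ((norm (F k x - F n x))\<^sup>2)) \<longlonglongrightarrow> ennreal ((norm (g x - F n x))\<^sup>2)"
        by (intro tendsto_ennrealI tendsto_intros)
      then show "ennreal ((norm (g x - F n x))\<^sup>2) = liminf (\<lambda>k. ennreal ((norm (F k x - F n x))\<^sup>2))"
        by (rule lim_imp_Liminf[OF trivial_limit_sequentially, symmetric])
    qed
    also have "\<dots> \<le> liminf (\<lambda>k. \<integral>\<^sup>+x. ennreal ((norm (F k x - F n x))\<^sup>2) \<partial>M)"
      by (rule nn_integral_liminf) measurable
    also have "\<dots> \<le> ennreal ((2 * (1/2) ^ n)\<^sup>2)"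
    proof (rule Liminf_le)
      show "\<forall>\<^sub>F k in sequentially. (\<integral>\<^sup>+x. ennreal ((norm (F k x - F n x))\<^sup>2) \<partial>M) \<le> ennreal ((2 * (1/2) ^ n)\<^sup>2)"
      proof (rule eventually_sequentiallyI[of n])
        fix k assume "n \<le> k"
        then obtain j where k: "k = n + j" using le_Suc_ex by blast
        have "(\<integral>\<^sup>+x. ennreal ((norm (F k x - F n x))\<^sup>2) \<partial>M) = ennreal ((L2_norm M (\<lambda>x. F k x - F n x))\<^sup>2)"
          using L2_integrable[OF L2_diff[OF F[of k] F[of n]]]
          by (simp add: L2_norm_power2 nn_integral_eq_integral)
        also have "\<dots> \<le> ennreal ((2 * (1/2) ^ n)\<^sup>2)"
          unfolding k by (intro ennreal_leI power_mono close L2_norm_nonneg)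
        finally show "(\<integral>\<^sup>+x. ennreal ((norm (F k x - F n x))\<^sup>2) \<partial>M) \<le> ennreal ((2 * (1/2) ^ n)\<^sup>2)" .
      qed
    qed simp
    finally show ?thesis .
  qed
  have gdint: "integrable M (\<lambda>x. (norm (g x - F n x))\<^sup>2)" for n
    using gd[of n] by (intro integrableI_bounded) (auto intro: le_less_trans)
  have gdL2: "(\<lambda>x. g x - F n x) \<in> L2 M" for n using gdint[of n] by (simp add: L2_def)
  have "g \<in> L2 M" using L2_add[OF gdL2[of 0] F[of 0]] by simp
  moreover have "L2_norm M (\<lambda>x. g x - F n x) \<le> 2 * (1/2) ^ n" for n
  proof -
    have "ennreal ((L2_norm M (\<lambda>x. g x - F n x))\<^sup>2) \<le> ennreal ((2 * (1/2) ^ n)\<^sup>2)"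
      using gd[of n] gdint[of n] by (simp add: L2_norm_power2 nn_integral_eq_integral)
    then have "(L2_norm M (\<lambda>x. g x - F n x))\<^sup>2 \<le> (2 * (1/2) ^ n)\<^sup>2" by (simp add: ennreal_le_iff)
    then show ?thesis by (rule power2_le_imp_le) simp
  qed
  ultimately show ?thesis by blast
qed

section \<open>Exponentials and Fourier coefficients\<close>

lemma space_circ [simp]: "space circ = {-pi..pi}"
  by (simp add: circ_def)

lemma sets_circ: "sets circ = sets (lebesgue_on {-pi..pi})"
  by (simp add: circ_def)

lemma borel_imp_measurable_circ:
  fixes f :: "real \<Rightarrow> 'b::topological_space"
  assumes "f \<in> borel_measurable borel"
  shows "f \<in> borel_measurable circ"
proof -
  have "f \<in> borel_measurable lebesgue"
    using assms by (intro measurable_completion) simp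
  then have "f \<in> borel_measurable (lebesgue_on {-pi..pi})"
    by (rule measurable_restrict_space1)
  then show ?thesis by (simp add: circ_def)
qed

lemma integral_circ:
  fixes f :: "real \<Rightarrow> 'b::{banach, second_countable_topology}"
  assumes "f \<in> borel_measurable circ"
  shows "(LINT t|circ. f t) = (1 / (2 * pi)) *\<^sub>R (LINT t|lebesgue_on {-pi..pi}. f t)"
proof -
  have "(LINT t|circ. f t) = (LINT t|lebesgue_on {-pi..pi}. (1 / (2 * pi)) *\<^sub>R f t)"
    using assms unfolding circ_def by (intro integral_density) auto
  then show ?thesis by simp
qed

interpretation circ: prob_space circ
proof
  have "emeasure circ (space circ) = (\<integral>\<^sup>+t. ennreal (1 / (2 * pi)) * indicator {-pi..pi} t \<partial>lebesgue_on {-pi..pi})"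
    unfolding space_circ unfolding circ_def by (subst emeasure_density) (auto simp: sets_restrict_space)
  also have "\<dots> = (\<integral>\<^sup>+t. ennreal (1 / (2 * pi)) \<partial>lebesgue_on {-pi..pi})"
    by (intro nn_integral_cong) auto
  also have "\<dots> = ennreal (1 / (2 * pi)) * emeasure lebesgue {-pi..pi}"
    by (simp add: emeasure_restrict_space)
  also have "\<dots> = 1" by (simp flip: ennreal_mult)
  finally show "emeasure circ (space circ) = 1" .
qed

lemma borel_measurable_expo: "expo l \<in> borel_measurable borel"
  unfolding expo_def by (intro borel_measurable_continuous_onI continuous_intros)

lemma measurable_expo [measurable]: "expo l \<in> borel_measurable circ"
  by (intro borel_imp_measurable_circ borel_measurable_expo)

lemma norm_expo [simp]: "cmod (expo l t) = 1"
  unfolding expo_def by (metis norm_exp_i_times)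

lemma expo_add: "expo (k + l) t = expo k t * expo l t"
  by (simp add: expo_def distrib_right distrib_left exp_add)

lemma cnj_expo: "cnj (expo l t) = expo (- l) t"
  by (simp add: expo_def exp_cnj)

lemma expo_zero [simp]: "expo 0 t = 1"
  by (simp add: expo_def)

lemma expo_L2: "expo l \<in> L2 circ"
  by (simp add: L2_def)

text \<open>The Fourier transform of the normalized Lebesgue measure on \<open>[-\<pi>, \<pi>]\<close>.\<close>

definition sincpi :: "real \<Rightarrow> real"
  where "sincpi x = (if x = 0 then 1 else sin (pi * x) / (pi * x))"

lemma integral_expo: "(LINT t|circ. expo l t) = complex_of_real (sincpi l)"
proof (cases "l = 0")
  case True
  moreover have "circ.prob {-pi..pi} = 1" using circ.prob_space by simp
  ultimately show ?thesis by (simp add: sincpi_def)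
next
  case False
  define F where "F t = expo l t / (\<i> * complex_of_real l)" for t
  have "(F has_vector_derivative expo l t) (at t within {-pi..pi})" for t
    unfolding F_def expo_def
    apply (rule has_vector_derivative_real_field[THEN has_vector_derivative_at_within] |
       rule derivative_eq_intros refl | simp)+
    using False by (auto intro!: derivative_eq_intros simp: has_vector_derivative_def scaleR_conv_of_real field_simps)
  then have hi: "(expo l has_integral (F pi - F (-pi))) {-pi..pi}"
    by (intro fundamental_theorem_of_calculus) auto
  have "integrable (lebesgue_on {-pi..pi}) (expo l)"
    unfolding expo_def by (intro continuous_imp_integrable_real continuous_intros)
  then have "(LINT t|lebesgue_on {-pi..pi}. expo l t) = F pi - F (-pi)"
    using hi by (subst lebesgue_integral_eq_integral) (auto intro: integral_unique)
  also have "\<dots> = 2 * \<i> * sin (complex_of_real (l * pi)) / (\<i> * complex_of_real l)"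
    using False by (simp add: F_def expo_def sin_exp_eq' divide_simps algebra_simps)
  also have "\<dots> = 2 * complex_of_real (sin (l * pi)) / complex_of_real l"
    by (simp only: sin_of_real) simp
  finally have "(LINT t|lebesgue_on {-pi..pi}. expo l t) = 2 * complex_of_real (sin (l * pi)) / complex_of_real l" .
  then show ?thesis using False
    by (subst integral_circ) (simp_all add: sincpi_def scaleR_conv_of_real mult.commute)
qed

lemma fourier_coeff_expo: "fourier_coeff (expo l) n = complex_of_real (sincpi (l - real_of_int n))"
  unfolding fourier_coeff_def cnj_expo by (simp flip: expo_add integral_expo)

lemma sincpi_int: "sincpi (real_of_int k) = (if k = 0 then 1 else 0)"
  using sin_integer_2pi by (auto simp: sincpi_def sin_int_times_real mult.commute[of pi] sin_times_pi_eq_0)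

lemma fourier_coeff_expo_int: "fourier_coeff (expo (real_of_int m)) n = (if m = n then 1 else 0)"
  using sincpi_int[of "m - n"] by (simp add: fourier_coeff_expo)

lemma fourier_integrable: "f \<in> L2 circ \<Longrightarrow> integrable circ (\<lambda>t. f t * cnj (expo l t))"
  by (intro L2_inner_integrable expo_L2)

lemma fourier_coeff_diff:
  assumes "f \<in> L2 circ" "g \<in> L2 circ"
  shows "fourier_coeff (\<lambda>t. f t - g t) n = fourier_coeff f n - fourier_coeff g n"
  unfolding fourier_coeff_def left_diff_distrib
  using assms by (intro Bochner_Integration.integral_diff fourier_integrable)

lemma fourier_coeff_sum:
  assumes "\<And>i. i \<in> S \<Longrightarrow> f i \<in> L2 circ"
  shows "fourier_coeff (\<lambda>t. \<Sum>i\<in>S. c i * f i t) n = (\<Sum>i\<in>S. c i * fourier_coeff (f i) n)"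
proof -
  have "fourier_coeff (\<lambda>t. \<Sum>i\<in>S. c i * f i t) n = (LINT t|circ. (\<Sum>i\<in>S. c i * (f i t * cnj (expo (real_of_int n) t))))"
    unfolding fourier_coeff_def by (simp add: sum_distrib_right mult.assoc)
  also have "\<dots> = (\<Sum>i\<in>S. LINT t|circ. c i * (f i t * cnj (expo (real_of_int n) t)))"
    using assms by (intro Bochner_Integration.integral_sum integrable_mult_right fourier_integrable)
  finally show ?thesis by (simp add: fourier_coeff_def)
qed

lemma fourier_coeff_le:
  assumes "f \<in> L2 circ"
  shows "cmod (fourier_coeff f n) \<le> L2_norm circ f"
proof -
  have "cmod (fourier_coeff f n) \<le> (LINT t|circ. cmod (f t * cnj (expo (real_of_int n) t)))"
    unfolding fourier_coeff_def by (rule integral_norm_bound)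
  then show ?thesis using circ.L1_le_L2_norm[OF assms] by (simp add: norm_mult)
qed

text \<open>Completing the square. With \<open>b\<close> equal to the Fourier coefficients this is Bessel's inequality, and with \<open>f = 0\<close> it
  is the orthonormality of the exponentials.\<close>

lemma L2_norm_diff_trig:
  assumes f: "f \<in> L2 circ" and "finite F"
  shows "(L2_norm circ (\<lambda>t. f t - (\<Sum>n\<in>F. b n * expo (real_of_int n) t)))\<^sup>2 =
     (L2_norm circ f)\<^sup>2 - (\<Sum>n\<in>F. (cmod (fourier_coeff f n))\<^sup>2) + (\<Sum>n\<in>F. (cmod (fourier_coeff f n - b n))\<^sup>2)"
proof -
  define S where "S t = (\<Sum>n\<in>F. b n * expo (real_of_int n) t)" for t
  have SL2: "S \<in> L2 circ" unfolding S_def using expo_L2 by (intro L2_sum_scale)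
  have inner: "(LINT t|circ. g t * cnj (S t)) = (\<Sum>n\<in>F. cnj (b n) * fourier_coeff g n)" if g: "g \<in> L2 circ" for g
  proof -
    have "(LINT t|circ. g t * cnj (S t)) = (LINT t|circ. (\<Sum>n\<in>F. cnj (b n) * (g t * cnj (expo (real_of_int n) t))))"
      by (simp add: S_def sum_distrib_left algebra_simps)
    also have "\<dots> = (\<Sum>n\<in>F. LINT t|circ. cnj (b n) * (g t * cnj (expo (real_of_int n) t)))"
      using g by (intro Bochner_Integration.integral_sum integrable_mult_right fourier_integrable)
    finally show ?thesis by (simp add: fourier_coeff_def)
  qed
  have Shat: "fourier_coeff S n = b n" if "n \<in> F" for n
    unfolding S_def using that \<open>finite F\<close>
    by (subst fourier_coeff_sum) (auto simp: expo_L2 fourier_coeff_expo_int if_distrib sum.delta cong: if_cong)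
  have norm2: "complex_of_real ((L2_norm circ g)\<^sup>2) = (LINT t|circ. g t * cnj (g t))" for g
    by (simp add: L2_norm_power2 complex_norm_square del: of_real_power flip: integral_complex_of_real)
  have fS: "integrable circ (\<lambda>t. f t * cnj (S t))" by (intro L2_inner_integrable f SL2)
  have SS: "integrable circ (\<lambda>t. S t * cnj (S t))" by (intro L2_inner_integrable SL2)
  have ff: "integrable circ (\<lambda>t. f t * cnj (f t))" by (intro L2_inner_integrable f)
  have Sf: "integrable circ (\<lambda>t. S t * cnj (f t))" by (intro L2_inner_integrable f SL2)
  have "complex_of_real ((L2_norm circ (\<lambda>t. f t - S t))\<^sup>2)
      = (LINT t|circ. (f t * cnj (f t) + S t * cnj (S t)) - (f t * cnj (S t) + S t * cnj (f t)))"
    unfolding norm2 by (simp add: algebra_simps)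
  also have "\<dots> = (LINT t|circ. f t * cnj (f t)) + (LINT t|circ. S t * cnj (S t)) -
       ((LINT t|circ. f t * cnj (S t)) + (LINT t|circ. S t * cnj (f t)))"
    using fS SS ff Sf by simp
  also have "(LINT t|circ. S t * cnj (f t)) = cnj (LINT t|circ. f t * cnj (S t))"
    using Bochner_Integration.integral_cnj[of circ "\<lambda>t. f t * cnj (S t)"] by (simp add: mult.commute)
  also have "(LINT t|circ. f t * cnj (f t)) = complex_of_real ((L2_norm circ f)\<^sup>2)" by (simp add: norm2 del: of_real_power)
  also have "(LINT t|circ. S t * cnj (S t)) = (\<Sum>n\<in>F. cnj (b n) * b n)"
    using inner[OF SL2] by (simp add: Shat)
  also have "(LINT t|circ. f t * cnj (S t)) = (\<Sum>n\<in>F. cnj (b n) * fourier_coeff f n)"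
    using inner[OF f] .
  finally have "complex_of_real ((L2_norm circ (\<lambda>t. f t - S t))\<^sup>2) =
     complex_of_real ((L2_norm circ f)\<^sup>2 - (\<Sum>n\<in>F. (cmod (fourier_coeff f n))\<^sup>2) + (\<Sum>n\<in>F. (cmod (fourier_coeff f n - b n))\<^sup>2))"
    by (simp add: complex_norm_square algebra_simps sum.distrib sum_subtractf del: of_real_power)
  then show ?thesis unfolding S_def of_real_eq_iff .
qed

lemma trig_L2_norm:
  assumes "finite F"
  shows "(L2_norm circ (\<lambda>t. \<Sum>n\<in>F. b n * expo (real_of_int n) t))\<^sup>2 = (\<Sum>n\<in>F. (cmod (b n))\<^sup>2)"
proof -
  have "(L2_norm circ (\<lambda>t. 0 - (\<Sum>n\<in>F. b n * expo (real_of_int n) t)))\<^sup>2 = (\<Sum>n\<in>F. (cmod (b n))\<^sup>2)"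
  proof -
    have "L2_norm circ (\<lambda>t. 0 :: complex) = 0" by (simp add: L2_norm_def)
    moreover have "fourier_coeff (\<lambda>t. 0) n = 0" for n by (simp add: fourier_coeff_def)
    ultimately show ?thesis using L2_norm_diff_trig[OF L2_zero assms, of b] by simp
  qed
  moreover have "L2_norm circ (\<lambda>t. 0 - (\<Sum>n\<in>F. b n * expo (real_of_int n) t)) =
      L2_norm circ (\<lambda>t. \<Sum>n\<in>F. b n * expo (real_of_int n) t)"
    unfolding L2_norm_def by simp
  ultimately show ?thesis by simp
qed

lemma Bessel_inequality:
  assumes "f \<in> L2 circ" "finite F"
  shows "(\<Sum>n\<in>F. (cmod (fourier_coeff f n))\<^sup>2) \<le> (L2_norm circ f)\<^sup>2"
proof -
  have "0 \<le> (L2_norm circ (\<lambda>t. f t - (\<Sum>n\<in>F. fourier_coeff f n * expo (real_of_int n) t)))\<^sup>2" by simp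
  then show ?thesis unfolding L2_norm_diff_trig[OF assms] by simp
qed

section \<open>Completeness of the trigonometric system\<close>

text \<open>The functions orthogonal to all exponentials with integer frequencies. They are closed under
  multiplication by such an exponential, hence by polynomials in \<open>e\<^sup>i\<^sup>t\<close> and its conjugate, hence, by the theorem of
  Stone and Weierstrass, orthogonal to all continuous periodic functions; from there the chain of lemmas reaches
  indicators of compact sets and of measurable sets.\<close>

definition fourier_null :: "(real \<Rightarrow> complex) \<Rightarrow> bool"
  where "fourier_null f \<longleftrightarrow> f \<in> L2 circ \<and> (\<forall>n. fourier_coeff f n = 0)"

lemma fourier_null_add:
  assumes "fourier_null f" "fourier_null g"
  shows "fourier_null (\<lambda>t. f t + g t)"
proof -
  have "fourier_coeff (\<lambda>t. f t + g t) n = fourier_coeff f n + fourier_coeff g n" for n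
    unfolding fourier_coeff_def distrib_right
    using assms by (intro Bochner_Integration.integral_add fourier_integrable) (auto simp: fourier_null_def)
  then show ?thesis using assms by (auto simp: fourier_null_def L2_add)
qed

lemma fourier_null_scale: "fourier_null f \<Longrightarrow> fourier_null (\<lambda>t. f t * c)"
  using L2_scale[of f circ c]
  by (auto simp: fourier_null_def fourier_coeff_def mult.commute[of _ c] mult.assoc)

lemma fourier_null_expo:
  assumes "fourier_null f"
  shows "fourier_null (\<lambda>t. f t * expo (real_of_int k) t)"
proof -
  have "(\<lambda>t. f t * expo (real_of_int k) t) \<in> L2 circ"
    using assms by (auto simp: fourier_null_def L2_def norm_mult)
  moreover have "fourier_coeff (\<lambda>t. f t * expo (real_of_int k) t) n = fourier_coeff f (n - k)" for n
    unfolding fourier_coeff_def cnj_expo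
    by (intro arg_cong[where f="integral\<^sup>L circ"] ext) (simp add: mult.assoc flip: expo_add)
  ultimately show ?thesis using assms by (auto simp: fourier_null_def)
qed

lemma fourier_null_polynomial:
  assumes "real_polynomial_function h" "fourier_null f"
  shows "fourier_null (\<lambda>t. f t * complex_of_real (h (expo 1 t)))"
  using assms
proof (induction arbitrary: f rule: real_polynomial_function.induct)
  case (linear h)
  interpret bounded_linear h by fact
  \<comment> \<open>A real linear form on the plane is a combination of the coordinate and its conjugate.\<close>
  define u where "u = (complex_of_real (h 1) - \<i> * complex_of_real (h \<i>)) / 2"
  define v where "v = (complex_of_real (h 1) + \<i> * complex_of_real (h \<i>)) / 2"
  have "complex_of_real (h z) = z * u + cnj z * v" for z
  proof -
    have "z = Re z *\<^sub>R 1 + Im z *\<^sub>R \<i>" by (simp add: complex_eq_iff)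
    then have "h z = Re z * h 1 + Im z * h \<i>" by (metis add scaleR real_scaleR_def)
    then show ?thesis by (simp add: u_def v_def complex_eq_iff field_simps)
  qed
  then have "(\<lambda>t. f t * complex_of_real (h (expo 1 t))) =
     (\<lambda>t. f t * expo (real_of_int 1) t * u + f t * expo (real_of_int (- 1)) t * v)"
    by (simp add: cnj_expo distrib_left mult.assoc)
  then show ?case
    using linear.prems by (simp only:) (intro fourier_null_add fourier_null_scale fourier_null_expo)
next
  case (const c)
  then show ?case by (intro fourier_null_scale)
next
  case (add h1 h2)
  then show ?case using fourier_null_add[OF add.IH(1)[OF add.prems] add.IH(2)[OF add.prems]]
    by (simp add: distrib_left)
next
  case (mult h1 h2)
  then show ?case using mult.IH(2)[OF mult.IH(1)[OF mult.prems]] by (simp add: mult.assoc)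
qed

lemma fourier_null_continuous:
  fixes g :: "complex \<Rightarrow> real"
  assumes f: "fourier_null f" and g: "continuous_on UNIV g"
  shows "(LINT t|circ. f t * complex_of_real (g (expo 1 t))) = 0"
proof -
  have fL2: "f \<in> L2 circ" using f by (simp add: fourier_null_def)
  have fint: "integrable circ f" by (rule circ.L2_imp_integrable[OF fL2])
  have meas: "(\<lambda>t. complex_of_real (h (expo 1 t))) \<in> borel_measurable circ" if "continuous_on UNIV h" for h :: "complex \<Rightarrow> real"
  proof -
    have "continuous_on UNIV (\<lambda>t. complex_of_real (h (expo 1 t)))"
      unfolding expo_def by (intro continuous_intros continuous_on_compose2[OF that]) auto
    then show ?thesis by (intro borel_imp_measurable_circ borel_measurable_continuous_onI)
  qed
  have "cmod (LINT t|circ. f t * complex_of_real (g (expo 1 t))) \<le> e" if "e > 0" for e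
  proof -
    define C where "C = (LINT t|circ. cmod (f t))"
    have "C \<ge> 0" by (simp add: C_def)
    define d where "d = e / (C + 1)"
    have d: "d > 0" using \<open>C \<ge> 0\<close> that by (simp add: d_def)
    obtain h where h: "real_polynomial_function h" "\<And>z. z \<in> sphere 0 1 \<Longrightarrow> \<bar>g z - h z\<bar> < d"
      using Stone_Weierstrass_real_polynomial_function[of "sphere (0::complex) 1" g d] d
        continuous_on_subset[OF g] by auto
    have fh: "fourier_null (\<lambda>t. f t * complex_of_real (h (expo 1 t)))"
      by (rule fourier_null_polynomial[OF h(1) f])
    then have "fourier_coeff (\<lambda>t. f t * complex_of_real (h (expo 1 t))) 0 = 0" by (simp add: fourier_null_def)
    then have fh0: "(LINT t|circ. f t * complex_of_real (h (expo 1 t))) = 0" by (simp add: fourier_coeff_def)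
    have fhint: "integrable circ (\<lambda>t. f t * complex_of_real (h (expo 1 t)))"
      using fh by (intro circ.L2_imp_integrable) (simp add: fourier_null_def)
    have ghmeas: "(\<lambda>t. complex_of_real (g (expo 1 t) - h (expo 1 t))) \<in> borel_measurable circ"
      by (rule meas) (intro continuous_intros g continuous_on_polymonial_function,
          use h(1) real_polynomial_function_eq in blast)
    have bnd: "cmod (f t * complex_of_real (g (expo 1 t) - h (expo 1 t))) \<le> cmod (f t) * d" for t
      using h(2)[of "expo 1 t"] by (auto simp: norm_mult intro!: mult_left_mono simp del: of_real_diff)
    have dint: "integrable circ (\<lambda>t. f t * complex_of_real (g (expo 1 t) - h (expo 1 t)))"
    proof (rule Bochner_Integration.integrable_bound)
      show "integrable circ (\<lambda>t. cmod (f t) * d)" using fint by simp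
      show "(\<lambda>t. f t * complex_of_real (g (expo 1 t) - h (expo 1 t))) \<in> borel_measurable circ"
        using ghmeas L2_measurable[OF fL2] by simp
      show "AE t in circ. cmod (f t * complex_of_real (g (expo 1 t) - h (expo 1 t))) \<le> norm (cmod (f t) * d)"
        using bnd d by (intro AE_I2) simp
    qed
    have "(LINT t|circ. f t * complex_of_real (g (expo 1 t))) =
       (LINT t|circ. f t * complex_of_real (g (expo 1 t) - h (expo 1 t)) + f t * complex_of_real (h (expo 1 t)))"
      by (simp add: algebra_simps)
    also have "\<dots> = (LINT t|circ. f t * complex_of_real (g (expo 1 t) - h (expo 1 t)))"
      using dint fhint fh0 by (subst Bochner_Integration.integral_add) auto
    also have "cmod \<dots> \<le> (LINT t|circ. cmod (f t) * d)"
      using dint fint bnd by (intro order_trans[OF integral_norm_bound] integral_mono) auto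
    also have "\<dots> = C * d" by (simp add: C_def)
    also have "\<dots> \<le> e" using \<open>C \<ge> 0\<close> that by (simp add: d_def field_simps)
    finally show ?thesis .
  qed
  then have "cmod (LINT t|circ. f t * complex_of_real (g (expo 1 t))) \<le> 0"
    by (rule field_le_epsilon) simp
  then show ?thesis by simp
qed

text \<open>The two endpoints of \<open>[-\<pi>, \<pi>]\<close> are the same point of the circle; elsewhere the parametrization
  is injective.\<close>

lemma AE_circ_inner: "AE t in circ. t \<in> {-pi<..<pi}"
proof -
  have "AE t in lebesgue_on {-pi..pi}. t \<in> {-pi<..<pi}"
  proof -
    have "{-pi, pi} \<in> null_sets lebesgue" by (auto intro: negligible_iff_null_sets[THEN iffD1])
    then have "AE t in lebesgue. t \<notin> {-pi, pi}" by (rule AE_not_in)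
    then have "AE t in lebesgue. t \<in> {-pi..pi} \<longrightarrow> t \<in> {-pi<..<pi}" by (rule AE_mp) auto
    then show ?thesis by (subst AE_restrict_space_iff) auto
  qed
  then show ?thesis unfolding circ_def by (subst AE_density) auto
qed

lemma expo_one_inj:
  assumes "t \<in> {-pi<..<pi}" "s \<in> {-pi..pi}" "expo 1 t = expo 1 s"
  shows "t = s"
proof -
  have "\<i> * complex_of_real t = \<i> * complex_of_real s"
  proof (rule exp_complex_eqI)
    show "\<bar>Im (\<i> * complex_of_real t) - Im (\<i> * complex_of_real s)\<bar> < 2 * pi"
      using assms(1,2) by auto
    show "exp (\<i> * complex_of_real t) = exp (\<i> * complex_of_real s)"
      using assms(3) by (simp only: expo_def mult_1)
  qed
  then show ?thesis by simp
qed

lemma fourier_null_compact: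
  assumes f: "fourier_null f" and K: "compact K" "K \<subseteq> {-pi..pi}"
  shows "(LINT t|circ. indicator K t *\<^sub>R f t) = 0"
proof (cases "K = {}")
  case False
  have fL2: "f \<in> L2 circ" using f by (simp add: fourier_null_def)
  have fint: "integrable circ f" by (rule circ.L2_imp_integrable[OF fL2])
  have [measurable]: "f \<in> borel_measurable circ" by (rule L2_measurable[OF fL2])
  define A where "A = expo 1 ` K"
  have "compact A" unfolding A_def expo_def by (intro compact_continuous_image continuous_intros K)
  then have A: "closed A" "A \<noteq> {}" using False by (auto simp: A_def compact_imp_closed)
  \<comment> \<open>Continuous functions of the point on the circle that decrease to the indicator of the image of the compact set.\<close>
  define h where "h n z = max 0 (1 - real n * infdist z A)" for n :: nat and z
  have h: "continuous_on UNIV (h n)" for n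
    unfolding h_def by (intro continuous_intros)
  have "(\<lambda>n. LINT t|circ. f t * complex_of_real (h n (expo 1 t))) \<longlonglongrightarrow> (LINT t|circ. indicator K t *\<^sub>R f t)"
  proof (rule integral_dominated_convergence[where w="\<lambda>t. cmod (f t)"])
    have "K \<in> sets lebesgue" using K by (simp add: compact_imp_closed lmeasurable_compact fmeasurableD)
    then have "K \<in> sets circ" using K by (simp add: sets_circ sets_restrict_space_iff)
    then show "(\<lambda>t. indicator K t *\<^sub>R f t) \<in> borel_measurable circ" by measurable
    show "(\<lambda>t. f t * complex_of_real (h n (expo 1 t))) \<in> borel_measurable circ" for n
    proof -
      have "continuous_on UNIV (\<lambda>t. complex_of_real (h n (expo 1 t)))"
        unfolding expo_def by (intro continuous_intros continuous_on_compose2[OF h]) auto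
      then have "(\<lambda>t. complex_of_real (h n (expo 1 t))) \<in> borel_measurable circ"
        by (intro borel_imp_measurable_circ borel_measurable_continuous_onI)
      then show ?thesis by measurable
    qed
    show "integrable circ (\<lambda>t. cmod (f t))" using fint by simp
    have "\<bar>h n z\<bar> \<le> 1" for n z by (simp add: h_def infdist_nonneg)
    then show "AE t in circ. cmod (f t * complex_of_real (h n (expo 1 t))) \<le> cmod (f t)" for n
      by (intro AE_I2) (simp add: norm_mult mult_left_le)
    show "AE t in circ. (\<lambda>n. f t * complex_of_real (h n (expo 1 t))) \<longlonglongrightarrow> indicator K t *\<^sub>R f t"
      using AE_circ_inner
    proof (rule AE_mp, intro AE_I2 impI)
      fix t assume t: "t \<in> {-pi<..<pi}"
      have mem: "expo 1 t \<in> A \<longleftrightarrow> t \<in> K"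
        using expo_one_inj[OF t] K(2) by (auto simp: A_def)
      show "(\<lambda>n. f t * complex_of_real (h n (expo 1 t))) \<longlonglongrightarrow> indicator K t *\<^sub>R f t"
      proof (cases "t \<in> K")
        case True
        then have "h n (expo 1 t) = 1" for n using mem by (simp add: h_def)
        then show ?thesis using True by simp
      next
        case False
        then have pos: "infdist (expo 1 t) A > 0"
          using mem A in_closed_iff_infdist_zero[OF A] infdist_nonneg[of "expo 1 t" A] by fastforce
        obtain N where N: "real N * infdist (expo 1 t) A > 1"
          using reals_Archimedean3[OF pos] by blast
        have "\<forall>\<^sub>F n in sequentially. f t * complex_of_real (h n (expo 1 t)) = 0"
        proof (rule eventually_sequentiallyI[of N])
          fix n assume "N \<le> n"
          then have "real N * infdist (expo 1 t) A \<le> real n * infdist (expo 1 t) A"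
            using pos by (intro mult_right_mono) auto
          then show "f t * complex_of_real (h n (expo 1 t)) = 0" using N by (simp add: h_def)
        qed
        then show ?thesis using False by (simp add: tendsto_eventually)
      qed
    qed
  qed
  moreover have "(LINT t|circ. f t * complex_of_real (h n (expo 1 t))) = 0" for n
    by (rule fourier_null_continuous[OF f h])
  ultimately show ?thesis by (simp add: LIMSEQ_const_iff)
qed auto

lemma fourier_null_AE:
  assumes f: "fourier_null f"
  shows "AE t in circ. f t = 0"
proof (rule circ.density_zero)
  have fL2: "f \<in> L2 circ" using f by (simp add: fourier_null_def)
  show fint: "integrable circ f" by (rule circ.L2_imp_integrable[OF fL2])
  fix A assume A: "A \<in> sets circ"
  then have A': "A \<in> sets lebesgue" "A \<subseteq> {-pi..pi}"
    by (auto simp: sets_circ sets_restrict_space_iff)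
  obtain C T where CT: "fsigma C" "T \<in> null_sets lebesgue" "C \<union> T = A" "disjnt C T"
    using lebesgue_set_almost_fsigma[OF A'(1)] by blast
  obtain F :: "nat \<Rightarrow> real set" where F: "range F \<subseteq> Collect compact" "C = \<Union>(range F)"
    using CT(1) fsigma_Union_compact by blast
  define B where "B n = (\<Union>i\<le>n. F i)" for n
  have B: "compact (B n)" "B n \<subseteq> {-pi..pi}" for n
    unfolding B_def using F CT(3) A'(2) by (auto intro!: compact_UN)
  have CB: "C = (\<Union>n. B n)" using F by (auto simp: B_def)
  have Bset: "B n \<in> sets circ" for n
    using B[of n] by (simp add: sets_circ sets_restrict_space_iff lmeasurable_compact fmeasurableD)
  have Cset: "C \<in> sets circ" unfolding CB using Bset by auto
  have "AE t in lebesgue. t \<notin> T" by (rule AE_not_in[OF CT(2)])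
  then have "AE t in lebesgue_on {-pi..pi}. t \<notin> T" by (subst AE_restrict_space_iff) auto
  then have AET: "AE t in circ. t \<notin> T" unfolding circ_def by (subst AE_density) auto
  have "(LINT t:A|circ. f t) = (LINT t:C|circ. f t)"
    unfolding set_lebesgue_integral_def
  proof (rule integral_cong_AE)
    show "(\<lambda>x. indicat_real A x *\<^sub>R f x) \<in> borel_measurable circ" using A fint by measurable
    show "(\<lambda>x. indicat_real C x *\<^sub>R f x) \<in> borel_measurable circ" using Cset fint by measurable
    show "AE x in circ. indicat_real A x *\<^sub>R f x = indicat_real C x *\<^sub>R f x"
      using AET by (rule AE_mp) (use CT(3) in \<open>auto simp: indicator_def\<close>)
  qed
  moreover have "(\<lambda>n. LINT t:B n|circ. f t) \<longlonglongrightarrow> (LINT t:(\<Union>n. B n)|circ. f t)"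
  proof (rule set_integral_cont_up)
    show "incseq B" by (auto simp: incseq_def B_def intro: order_trans)
    show "set_integrable circ (\<Union>n. B n) f" using Cset fint CB
      by (simp add: set_integrable_def integrable_mult_indicator)
  qed (rule Bset)
  moreover have "(LINT t:B n|circ. f t) = 0" for n
    unfolding set_lebesgue_integral_def by (rule fourier_null_compact[OF f B])
  ultimately show "(LINT t:A|circ. f t) = 0" by (simp add: CB LIMSEQ_const_iff)
qed

lemma fourier_null_norm: "fourier_null f \<Longrightarrow> L2_norm circ f = 0"
proof -
  assume f: "fourier_null f"
  then have "(LINT t|circ. (norm (f t))\<^sup>2) = (LINT t|circ. 0)"
    using fourier_null_AE[OF f] L2_integrable[of f circ]
    by (intro integral_cong_AE) (auto simp: fourier_null_def)
  then show ?thesis by (simp add: L2_norm_def)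
qed

section \<open>Unordered sums in the mean\<close>

lemma has_L2_sum_iff:
  "has_L2_sum M h I f \<longleftrightarrow>
     (\<forall>r>0. \<exists>S0. finite S0 \<and> S0 \<subseteq> I \<and>
        (\<forall>S. finite S \<and> S0 \<subseteq> S \<and> S \<subseteq> I \<longrightarrow> L2_norm M (\<lambda>t. f t - (\<Sum>i\<in>S. h i t)) < r))"
  unfolding has_L2_sum_def tendsto_iff eventually_finite_subsets_at_top dist_real_def
  by (simp add: L2_norm_nonneg)

lemma has_L2_sumD:
  assumes "has_L2_sum M h I f" "r > 0"
  shows "\<exists>S0. finite S0 \<and> S0 \<subseteq> I \<and>
        (\<forall>S. finite S \<longrightarrow> S0 \<subseteq> S \<longrightarrow> S \<subseteq> I \<longrightarrow> L2_norm M (\<lambda>t. f t - (\<Sum>i\<in>S. h i t)) < r)"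
  using assms unfolding has_L2_sum_iff imp_conjL by simp

lemma summable_on_small_tail:
  fixes a :: "'i \<Rightarrow> real"
  assumes a: "a summable_on I" "\<And>i. i \<in> I \<Longrightarrow> a i \<ge> 0" and r: "r > 0"
  obtains T where "finite T" "T \<subseteq> I" "\<And>S. finite S \<Longrightarrow> S \<subseteq> I - T \<Longrightarrow> sum a S < r"
proof -
  have "(a has_sum infsum a I) I" using a(1) by simp
  then have "(sum a \<longlongrightarrow> infsum a I) (finite_subsets_at_top I)" by (simp add: has_sum_def)
  then have "\<forall>\<^sub>F T in finite_subsets_at_top I. dist (sum a T) (infsum a I) < r"
    using r by (rule tendstoD)
  then obtain T where T: "finite T" "T \<subseteq> I"
      "\<forall>S. finite S \<and> T \<subseteq> S \<and> S \<subseteq> I \<longrightarrow> dist (sum a S) (infsum a I) < r"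
    unfolding eventually_finite_subsets_at_top by (elim exE conjE)
  have "sum a S < r" if S: "finite S" "S \<subseteq> I - T" for S
  proof -
    have "sum a (S \<union> T) = sum a S + sum a T" using S T by (intro sum.union_disjoint) auto
    moreover have "sum a (S \<union> T) \<le> infsum a I"
      using S T a by (intro finite_sum_le_infsum) auto
    moreover have "dist (sum a T) (infsum a I) < r" using T by blast
    ultimately show ?thesis by (simp add: dist_real_def)
  qed
  then show ?thesis using that T by blast
qed

text \<open>Coefficients in \<open>\<ell>\<^sup>2\<close> can be summed against any family with an upper Riesz bound. The partial sums
  over a chain of finite sets with geometrically small tails are a fast Cauchy sequence, and the upper bound controls
  every finite set that contains a member of the chain.\<close>

lemma (in prob_space) L2_sum_exists:
  fixes e :: "'i \<Rightarrow> 'a \<Rightarrow> complex"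
  assumes e: "\<And>i. i \<in> I \<Longrightarrow> e i \<in> L2 M"
    and upper: "\<And>S c. finite S \<Longrightarrow> S \<subseteq> I \<Longrightarrow> (L2_norm M (\<lambda>x. \<Sum>i\<in>S. c i * e i x))\<^sup>2 \<le> B * (\<Sum>i\<in>S. (cmod (c i))\<^sup>2)"
    and a: "(\<lambda>i. (cmod (a i))\<^sup>2) summable_on I"
  shows "\<exists>g\<in>L2 M. has_L2_sum M (\<lambda>i x. a i * e i x) I g"
proof -
  \<comment> \<open>The bound \<open>B\<close> may be zero or negative if the family vanishes; division requires a positive one.\<close>
  define B' where "B' = max B 1"
  have B': "B' > 0" "B \<le> B'" by (auto simp: B'_def)
  have "\<exists>T. finite T \<and> T \<subseteq> I \<and> (\<forall>S. finite S \<and> S \<subseteq> I - T \<longrightarrow> (\<Sum>i\<in>S. (cmod (a i))\<^sup>2) < (1/4)^k / B')" for k :: nat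
    by (rule summable_on_small_tail[OF a, of "(1/4)^k / B'"]) (use B' in auto)
  then obtain T where T: "\<And>k. finite (T k)" "\<And>k. T k \<subseteq> I"
     "\<And>k S. finite S \<Longrightarrow> S \<subseteq> I - T k \<Longrightarrow> (\<Sum>i\<in>S. (cmod (a i))\<^sup>2) < (1/4)^k / B'"
    by metis
  have small: "L2_norm M (\<lambda>x. \<Sum>i\<in>S. a i * e i x) \<le> (1/2)^k" if S: "finite S" "S \<subseteq> I - T k" for S k
  proof -
    have "(L2_norm M (\<lambda>x. \<Sum>i\<in>S. a i * e i x))\<^sup>2 \<le> B * (\<Sum>i\<in>S. (cmod (a i))\<^sup>2)"
      using S by (intro upper) auto
    also have "\<dots> \<le> B' * (\<Sum>i\<in>S. (cmod (a i))\<^sup>2)"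
      using B' by (intro mult_right_mono sum_nonneg) auto
    also have "\<dots> \<le> B' * ((1/4)^k / B')"
      using T(3)[OF S] B' by (intro mult_left_mono) auto
    also have "\<dots> = ((1/2)^k)\<^sup>2" using B' by (simp add: power2_eq_square flip: power_mult_distrib)
    finally show ?thesis by (rule power2_le_imp_le) simp
  qed
  define U where "U n = (\<Union>k\<le>n. T k)" for n
  have U: "finite (U n)" "U n \<subseteq> I" "T n \<subseteq> U n" "U n \<subseteq> U (Suc n)" for n
    using T(1,2) unfolding U_def atMost_Suc by auto
  define F where "F n x = (\<Sum>i\<in>U n. a i * e i x)" for n x
  have FL2: "F n \<in> L2 M" for n unfolding F_def by (intro L2_sum_scale e subsetD[OF U(2)])
  have split: "(\<Sum>i\<in>S. a i * e i x) - F n x = (\<Sum>i\<in>S - U n. a i * e i x)" if "finite S" "U n \<subseteq> S" for S n x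
    using that U(1)[of n] by (simp add: F_def sum_diff)
  have "L2_norm M (\<lambda>x. F (Suc n) x - F n x) \<le> (1/2) ^ n" for n
    unfolding F_def[of "Suc n"] split[OF U(1) U(4)] using U(1-3)[of "Suc n"] U(3)[of n] by (intro small) auto
  then have "\<exists>g\<in>L2 M. \<forall>n. L2_norm M (\<lambda>x. g x - F n x) \<le> 2 * (1/2) ^ n"
    by (intro L2_complete_fast FL2)
  then obtain g where g: "g \<in> L2 M" "\<And>n. L2_norm M (\<lambda>x. g x - F n x) \<le> 2 * (1/2) ^ n"
    by metis
  have "has_L2_sum M (\<lambda>i x. a i * e i x) I g"
    unfolding has_L2_sum_iff
  proof (intro allI impI)
    fix r :: real assume "r > 0"
    then obtain n where n: "(1/2) ^ n < r / 3" using real_arch_pow_inv[of "r/3" "1/2"] by auto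
    show "\<exists>S0. finite S0 \<and> S0 \<subseteq> I \<and> (\<forall>S. finite S \<and> S0 \<subseteq> S \<and> S \<subseteq> I \<longrightarrow>
       L2_norm M (\<lambda>x. g x - (\<Sum>i\<in>S. a i * e i x)) < r)"
    proof (intro exI[of _ "U n"] conjI allI impI)
      fix S assume S: "finite S \<and> U n \<subseteq> S \<and> S \<subseteq> I"
      have "L2_norm M (\<lambda>x. g x - (\<Sum>i\<in>S. a i * e i x)) \<le>
         L2_norm M (\<lambda>x. g x - F n x) + L2_norm M (\<lambda>x. F n x - (\<Sum>i\<in>S. a i * e i x))"
        using S e by (intro L2_norm_triangle_diff g FL2 L2_sum_scale) auto
      also have "L2_norm M (\<lambda>x. F n x - (\<Sum>i\<in>S. a i * e i x)) = L2_norm M (\<lambda>x. \<Sum>i\<in>S - U n. a i * e i x)"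
        using S split[of S n] by (subst L2_norm_minus_commute) simp
      also have "\<dots> \<le> (1/2)^n" using S U(3)[of n] by (intro small) auto
      finally show "L2_norm M (\<lambda>x. g x - (\<Sum>i\<in>S. a i * e i x)) < r" using g(2)[of n] n by linarith
    qed (use U in auto)
  qed
  then show ?thesis using g(1) by blast
qed

lemma has_L2_sum_Un:
  fixes h :: "'i \<Rightarrow> 'a \<Rightarrow> complex"
  assumes "has_L2_sum M h I f" "has_L2_sum M h J g" "I \<inter> J = {}"
    and h: "\<And>i. i \<in> I \<union> J \<Longrightarrow> h i \<in> L2 M" and fg: "f \<in> L2 M" "g \<in> L2 M"
  shows "has_L2_sum M h (I \<union> J) (\<lambda>x. f x + g x)"
  unfolding has_L2_sum_iff
proof (intro allI impI)
  fix r :: real assume "r > 0"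
  then have r2: "r / 2 > 0" by simp
  obtain S1 where S1: "finite S1" "S1 \<subseteq> I"
    "\<forall>S. finite S \<longrightarrow> S1 \<subseteq> S \<longrightarrow> S \<subseteq> I \<longrightarrow> L2_norm M (\<lambda>t. f t - (\<Sum>i\<in>S. h i t)) < r / 2"
    using has_L2_sumD[OF assms(1) r2] by (elim exE conjE)
  obtain S2 where S2: "finite S2" "S2 \<subseteq> J"
    "\<forall>S. finite S \<longrightarrow> S2 \<subseteq> S \<longrightarrow> S \<subseteq> J \<longrightarrow> L2_norm M (\<lambda>t. g t - (\<Sum>i\<in>S. h i t)) < r / 2"
    using has_L2_sumD[OF assms(2) r2] by (elim exE conjE)
  show "\<exists>S0. finite S0 \<and> S0 \<subseteq> I \<union> J \<and> (\<forall>S. finite S \<and> S0 \<subseteq> S \<and> S \<subseteq> I \<union> J \<longrightarrow>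
       L2_norm M (\<lambda>x. f x + g x - (\<Sum>i\<in>S. h i x)) < r)"
  proof (intro exI[of _ "S1 \<union> S2"] conjI allI impI)
    fix S assume S: "finite S \<and> S1 \<union> S2 \<subseteq> S \<and> S \<subseteq> I \<union> J"
    have eq: "(S \<inter> I) \<union> (S \<inter> J) = S" and dj: "(S \<inter> I) \<inter> (S \<inter> J) = {}"
      using S assms(3) by auto
    have "(\<Sum>i\<in>S. h i x) = (\<Sum>i\<in>S \<inter> I. h i x) + (\<Sum>i\<in>S \<inter> J. h i x)" for x
      using sum.union_disjoint[OF _ _ dj, of "\<lambda>i. h i x"] S unfolding eq by simp
    then have "L2_norm M (\<lambda>x. f x + g x - (\<Sum>i\<in>S. h i x)) =
       L2_norm M (\<lambda>x. (f x - (\<Sum>i\<in>S \<inter> I. h i x)) + (g x - (\<Sum>i\<in>S \<inter> J. h i x)))"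
      by (simp add: algebra_simps)
    also have "\<dots> \<le> L2_norm M (\<lambda>x. f x - (\<Sum>i\<in>S \<inter> I. h i x)) + L2_norm M (\<lambda>x. g x - (\<Sum>i\<in>S \<inter> J. h i x))"
      using S h fg by (intro L2_norm_triangle L2_diff L2_sum) auto
    also have "\<dots> < r / 2 + r / 2"
      using S S1(1,2) S2(1,2) by (intro add_strict_mono S1(3)[rule_format] S2(3)[rule_format]) auto
    finally show "L2_norm M (\<lambda>x. f x + g x - (\<Sum>i\<in>S. h i x)) < r" by simp
  qed (use S1 S2 in auto)
qed

lemma has_L2_sum_reindex:
  assumes "has_L2_sum M (\<lambda>i. h (p i)) I f" "inj_on p I"
  shows "has_L2_sum M h (p ` I) f"
  unfolding has_L2_sum_iff
proof (intro allI impI)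
  fix r :: real assume r: "r > 0"
  obtain S0 where S0: "finite S0" "S0 \<subseteq> I"
    "\<forall>S. finite S \<longrightarrow> S0 \<subseteq> S \<longrightarrow> S \<subseteq> I \<longrightarrow> L2_norm M (\<lambda>t. f t - (\<Sum>i\<in>S. h (p i) t)) < r"
    using has_L2_sumD[OF assms(1) r] by (elim exE conjE)
  show "\<exists>S0. finite S0 \<and> S0 \<subseteq> p ` I \<and> (\<forall>S. finite S \<and> S0 \<subseteq> S \<and> S \<subseteq> p ` I \<longrightarrow>
       L2_norm M (\<lambda>x. f x - (\<Sum>i\<in>S. h i x)) < r)"
  proof (intro exI[of _ "p ` S0"] conjI allI impI)
    fix S assume S: "finite S \<and> p ` S0 \<subseteq> S \<and> S \<subseteq> p ` I"
    define R where "R = {i \<in> I. p i \<in> S}"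
    have R: "S = p ` R" "R \<subseteq> I" "S0 \<subseteq> R" using S S0(2) by (auto simp: R_def)
    have inj: "inj_on p R" using R(2) assms(2) inj_on_subset by blast
    then have "finite R" using S R(1) finite_image_iff by blast
    then show "L2_norm M (\<lambda>x. f x - (\<Sum>i\<in>S. h i x)) < r"
      using S0(3)[rule_format, of R] R inj by (simp add: sum.reindex)
  qed (use S0 in auto)
qed

lemma has_L2_sum_cong_norm:
  fixes h :: "'i \<Rightarrow> 'a \<Rightarrow> complex"
  assumes "has_L2_sum M h I g" "L2_norm M (\<lambda>x. f x - g x) = 0"
    and "f \<in> L2 M" "g \<in> L2 M" "\<And>i. i \<in> I \<Longrightarrow> h i \<in> L2 M"
  shows "has_L2_sum M h I f"
  unfolding has_L2_sum_iff
proof (intro allI impI)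
  fix r :: real assume r: "r > 0"
  obtain S0 where S0: "finite S0" "S0 \<subseteq> I"
    "\<forall>S. finite S \<longrightarrow> S0 \<subseteq> S \<longrightarrow> S \<subseteq> I \<longrightarrow> L2_norm M (\<lambda>t. g t - (\<Sum>i\<in>S. h i t)) < r"
    using has_L2_sumD[OF assms(1) r] by (elim exE conjE)
  have "L2_norm M (\<lambda>t. f t - (\<Sum>i\<in>S. h i t)) < r" if "finite S" "S0 \<subseteq> S" "S \<subseteq> I" for S
  proof -
    have "L2_norm M (\<lambda>t. f t - (\<Sum>i\<in>S. h i t)) \<le> L2_norm M (\<lambda>t. f t - g t) + L2_norm M (\<lambda>t. g t - (\<Sum>i\<in>S. h i t))"
      using assms(3-5) that by (intro L2_norm_triangle_diff L2_sum) auto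
    then show ?thesis using S0(3)[rule_format, OF that] assms(2) by simp
  qed
  then show "\<exists>S0. finite S0 \<and> S0 \<subseteq> I \<and> (\<forall>S. finite S \<and> S0 \<subseteq> S \<and> S \<subseteq> I \<longrightarrow>
       L2_norm M (\<lambda>x. f x - (\<Sum>i\<in>S. h i x)) < r)" using S0(1,2) by blast
qed

text \<open>Each Fourier coefficient is a functional of norm at most one, hence it commutes with the summation.\<close>

lemma has_L2_sum_fourier:
  assumes sum: "has_L2_sum circ (\<lambda>i t. a i * e i t) I g"
    and g: "g \<in> L2 circ" and e: "\<And>i. i \<in> I \<Longrightarrow> e i \<in> L2 circ"
  shows "((\<lambda>i. a i * fourier_coeff (e i) n) has_sum fourier_coeff g n) I"
  unfolding has_sum_def tendsto_iff eventually_finite_subsets_at_top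
proof (intro allI impI)
  fix r :: real assume r: "r > 0"
  obtain S0 where S0: "finite S0" "S0 \<subseteq> I"
    "\<forall>S. finite S \<longrightarrow> S0 \<subseteq> S \<longrightarrow> S \<subseteq> I \<longrightarrow> L2_norm circ (\<lambda>t. g t - (\<Sum>i\<in>S. a i * e i t)) < r"
    using has_L2_sumD[OF sum r] by (elim exE conjE)
  have "dist (\<Sum>i\<in>S. a i * fourier_coeff (e i) n) (fourier_coeff g n) < r"
    if S: "finite S" "S0 \<subseteq> S" "S \<subseteq> I" for S
  proof -
    have SL2: "(\<lambda>t. \<Sum>i\<in>S. a i * e i t) \<in> L2 circ" using S e by (intro L2_sum_scale) auto
    have "fourier_coeff g n - (\<Sum>i\<in>S. a i * fourier_coeff (e i) n) = fourier_coeff (\<lambda>t. g t - (\<Sum>i\<in>S. a i * e i t)) n"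
      using S e by (subst fourier_coeff_diff[OF g SL2], subst fourier_coeff_sum) auto
    also have "cmod \<dots> \<le> L2_norm circ (\<lambda>t. g t - (\<Sum>i\<in>S. a i * e i t))"
      by (intro fourier_coeff_le L2_diff g SL2)
    finally show ?thesis using S0(3)[rule_format, OF S] by (simp add: dist_norm norm_minus_commute)
  qed
  then show "\<exists>X. finite X \<and> X \<subseteq> I \<and> (\<forall>Y. finite Y \<and> X \<subseteq> Y \<and> Y \<subseteq> I \<longrightarrow>
      dist (\<Sum>i\<in>Y. a i * fourier_coeff (e i) n) (fourier_coeff g n) < r)" using S0(1,2) by blast
qed

lemma trig_series_exists:
  assumes "(\<lambda>n. (cmod (a n))\<^sup>2) summable_on J"
  shows "\<exists>g\<in>L2 circ. has_L2_sum circ (\<lambda>n t. a n * expo (real_of_int n) t) J g \<and>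
     (\<forall>n. fourier_coeff g n = (if n \<in> J then a n else 0))"
proof -
  obtain g where g: "g \<in> L2 circ" "has_L2_sum circ (\<lambda>n t. a n * expo (real_of_int n) t) J g"
    using circ.L2_sum_exists[of J "\<lambda>n. expo (real_of_int n)" 1 a] assms by (auto simp: expo_L2 trig_L2_norm)
  have "fourier_coeff g n = (if n \<in> J then a n else 0)" for n
  proof -
    have "((\<lambda>i. a i * fourier_coeff (expo (real_of_int i)) n) has_sum fourier_coeff g n) J"
      by (rule has_L2_sum_fourier[OF g(2,1) expo_L2])
    moreover have "((\<lambda>i. a i * fourier_coeff (expo (real_of_int i)) n) has_sum (if n \<in> J then a n else 0)) J"
    proof (cases "n \<in> J")
      case True
      have "((\<lambda>i. a i * fourier_coeff (expo (real_of_int i)) n) has_sum (a n)) {n}"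
        by (simp add: fourier_coeff_expo_int has_sum_finiteI)
      moreover have "((\<lambda>i. a i * fourier_coeff (expo (real_of_int i)) n) has_sum (a n)) {n} \<longleftrightarrow>
          ((\<lambda>i. a i * fourier_coeff (expo (real_of_int i)) n) has_sum (a n)) J"
        by (rule has_sum_cong_neutral) (use True in \<open>auto simp: fourier_coeff_expo_int\<close>)
      ultimately show ?thesis using True by simp
    next
      case False
      then have "((\<lambda>i. a i * fourier_coeff (expo (real_of_int i)) n) has_sum 0) J"
        by (intro has_sum_0) (auto simp: fourier_coeff_expo_int)
      then show ?thesis using False by simp
    qed
    ultimately show ?thesis by (rule has_sum_unique)
  qed
  then show ?thesis using g by blast
qed

section \<open>Small perturbations of the integer frequencies\<close>

lemma fourier_coeff_summable:
  assumes "f \<in> L2 circ"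
  shows "(\<lambda>n. (cmod (fourier_coeff f n))\<^sup>2) summable_on J"
proof (rule nonneg_bdd_above_summable_on)
  show "bdd_above (sum (\<lambda>n. (cmod (fourier_coeff f n))\<^sup>2) ` {F. F \<subseteq> J \<and> finite F})"
    using Bessel_inequality[OF assms] by (auto intro!: bdd_aboveI[where M="(L2_norm circ f)\<^sup>2"])
qed simp

text \<open>The series of \<open>f\<close> converges to some \<open>g\<close> with the same coefficients, and completeness identifies
  \<open>g\<close> with \<open>f\<close>.\<close>

lemma fourier_expansion:
  assumes f: "f \<in> L2 circ" and J: "\<And>n. n \<notin> J \<Longrightarrow> fourier_coeff f n = 0"
  shows "has_L2_sum circ (\<lambda>n t. fourier_coeff f n * expo (real_of_int n) t) J f"
proof -
  obtain g where g: "g \<in> L2 circ" "has_L2_sum circ (\<lambda>n t. fourier_coeff f n * expo (real_of_int n) t) J g"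
      "\<And>n. fourier_coeff g n = (if n \<in> J then fourier_coeff f n else 0)"
    using trig_series_exists[OF fourier_coeff_summable[OF f, of J]] by metis
  have "fourier_null (\<lambda>t. f t - g t)"
    unfolding fourier_null_def using J f g(1,3) by (auto simp: L2_diff fourier_coeff_diff)
  then have "L2_norm circ (\<lambda>t. f t - g t) = 0" by (rule fourier_null_norm)
  then show ?thesis by (intro has_L2_sum_cong_norm[OF g(2) _ f g(1)] L2_scale expo_L2)
qed

lemma L2_norm_circ_mono:
  assumes "f \<in> L2 circ" "g \<in> L2 circ" "C \<ge> 0"
    and "\<And>t. t \<in> {-pi..pi} \<Longrightarrow> cmod (f t) \<le> C * cmod (g t)"
  shows "L2_norm circ f \<le> C * L2_norm circ g"
proof -
  have "(LINT t|circ. (cmod (f t))\<^sup>2) \<le> (LINT t|circ. C\<^sup>2 * (cmod (g t))\<^sup>2)"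
  proof (rule integral_mono)
    show "integrable circ (\<lambda>t. (cmod (f t))\<^sup>2)" "integrable circ (\<lambda>t. C\<^sup>2 * (cmod (g t))\<^sup>2)"
      using assms L2_integrable[of f circ] L2_integrable[of g circ] by auto
    show "(cmod (f t))\<^sup>2 \<le> C\<^sup>2 * (cmod (g t))\<^sup>2" if "t \<in> space circ" for t
      using that power_mono[OF assms(4)[of t], of 2] by (simp add: power_mult_distrib)
  qed
  then have "(L2_norm circ f)\<^sup>2 \<le> (C * L2_norm circ g)\<^sup>2"
    by (simp add: L2_norm_power2 power_mult_distrib)
  then show ?thesis by (rule power2_le_imp_le) (simp add: assms L2_norm_nonneg)
qed

text \<open>The argument of Paley and Wiener: \<open>e\<^sup>i\<^sup>\<theta>\<^sup>t - 1\<close> is expanded into its power series in \<open>\<theta> t\<close>. In the term of order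
  \<open>k\<close> the factor \<open>(\<i> t)\<^sup>k / k!\<close> is bounded by \<open>\<pi>\<^sup>k / k!\<close>, and what is left is a trigonometric sum with coefficients
  \<open>c n * \<theta> n ^ k\<close>, whose norm is at most \<open>(1/20)\<^sup>k\<close> times that of \<open>c\<close>. The terms add up to
  \<open>exp (\<pi> / 20) - 1 \<le> 1/4\<close>.\<close>

lemma perturbation_small:
  fixes \<theta> :: "int \<Rightarrow> real" and c :: "int \<Rightarrow> complex"
  assumes S: "finite S" and th: "\<And>n. n \<in> S \<Longrightarrow> \<bar>\<theta> n\<bar> \<le> 1/20"
  defines "N \<equiv> sqrt (\<Sum>n\<in>S. (cmod (c n))\<^sup>2)"
  shows "L2_norm circ (\<lambda>t. (\<Sum>n\<in>S. c n * expo (real_of_int n + \<theta> n) t) - (\<Sum>n\<in>S. c n * expo (real_of_int n) t)) \<le> N / 2"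
proof -
  define D where "D t = (\<Sum>n\<in>S. c n * expo (real_of_int n + \<theta> n) t) - (\<Sum>n\<in>S. c n * expo (real_of_int n) t)" for t
  have DL2: "D \<in> L2 circ" unfolding D_def by (intro L2_diff L2_sum_scale expo_L2)
  define X where "X k t = (\<Sum>n\<in>S. (c n * complex_of_real (\<theta> n) ^ k) * expo (real_of_int n) t)" for k t
  have XL2: "X k \<in> L2 circ" for k unfolding X_def by (intro L2_sum_scale expo_L2)
  have XN: "L2_norm circ (X k) \<le> (1/20)^k * N" for k
  proof -
    have "(L2_norm circ (X k))\<^sup>2 = (\<Sum>n\<in>S. (cmod (c n * complex_of_real (\<theta> n) ^ k))\<^sup>2)"
      unfolding X_def by (rule trig_L2_norm[OF S])
    also have "\<dots> = (\<Sum>n\<in>S. (\<bar>\<theta> n\<bar>^k)\<^sup>2 * (cmod (c n))\<^sup>2)"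
      by (simp add: norm_mult norm_power power_mult_distrib mult.commute)
    also have "\<dots> \<le> (\<Sum>n\<in>S. ((1/20)^k)\<^sup>2 * (cmod (c n))\<^sup>2)"
      using th by (intro sum_mono mult_right_mono power_mono) auto
    also have "\<dots> = ((1/20)^k * N)\<^sup>2"
      by (simp add: N_def power_mult_distrib sum_nonneg sum_distrib_left)
    finally show ?thesis by (rule power2_le_imp_le) (simp add: N_def sum_nonneg)
  qed
  define Y where "Y k t = (\<i> * complex_of_real t) ^ k / fact k * X k t" for k t
  have YX: "cmod (Y k t) \<le> (pi ^ k / fact k) * cmod (X k t)" if "t \<in> {-pi..pi}" for k t
    using that unfolding Y_def
    by (auto simp: norm_mult norm_divide norm_power intro!: mult_right_mono power_mono divide_right_mono)
  have YL2: "Y k \<in> L2 circ" for k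
  proof -
    have "(\<lambda>t. (\<i> * complex_of_real t) ^ k / fact k) \<in> borel_measurable circ"
      by (intro borel_imp_measurable_circ borel_measurable_continuous_onI continuous_intros) auto
    moreover have "X k \<in> borel_measurable circ" using XL2 by (rule L2_measurable)
    ultimately have meas: "Y k \<in> borel_measurable circ" unfolding Y_def by measurable
    have "integrable circ (\<lambda>t. (norm (Y k t))\<^sup>2)"
    proof (rule Bochner_Integration.integrable_bound)
      show "integrable circ (\<lambda>t. (pi ^ k / fact k)\<^sup>2 * (norm (X k t))\<^sup>2)"
        using L2_integrable[OF XL2] by simp
      show "(\<lambda>t. (norm (Y k t))\<^sup>2) \<in> borel_measurable circ" using meas by measurable
      have "norm ((norm (Y k t))\<^sup>2) \<le> norm ((pi ^ k / fact k)\<^sup>2 * (norm (X k t))\<^sup>2)" if "t \<in> {-pi..pi}" for t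
      proof -
        have "(cmod (Y k t))\<^sup>2 \<le> ((pi ^ k / fact k) * cmod (X k t))\<^sup>2"
          by (rule power_mono[OF YX[OF that] norm_ge_zero])
        then show ?thesis by (simp only: power_mult_distrib real_norm_def abs_mult abs_power2)
      qed
      then show "AE t in circ. norm ((norm (Y k t))\<^sup>2) \<le> norm ((pi ^ k / fact k)\<^sup>2 * (norm (X k t))\<^sup>2)"
        by (intro AE_I2) simp
    qed
    then show ?thesis using meas by (simp add: L2_def)
  qed
  have YN: "L2_norm circ (Y k) \<le> (pi/20)^k / fact k * N" for k
  proof -
    have "L2_norm circ (Y k) \<le> (pi ^ k / fact k) * L2_norm circ (X k)"
      by (intro L2_norm_circ_mono XL2 YL2 YX) auto
    also have "\<dots> \<le> (pi ^ k / fact k) * ((1/20)^k * N)" by (intro mult_left_mono XN) auto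
    also have "\<dots> = (pi/20)^k / fact k * N" by (simp add: power_divide)
    finally show ?thesis .
  qed
  have partial: "(\<Sum>k=1..K. (pi/20)^k / fact k) \<le> 1/4" for K
  proof -
    have "(\<Sum>k=1..K. (pi/20)^k / fact k) + 1 = (\<Sum>k\<le>K. (pi/20)^k / fact k)"
      by (subst sum.atLeast_Suc_atMost[of 0 K, folded atMost_atLeast0]) auto
    also have "\<dots> \<le> exp (pi/20)"
    proof -
      define x where "x = pi/20"
      have "summable (\<lambda>k. x^k / fact k)"
        using summable_exp[of x] by (simp add: divide_inverse mult.commute)
      then have "(\<Sum>k\<le>K. x^k / fact k) \<le> (\<Sum>k. x^k / fact k)"
        by (rule sum_le_suminf) (auto simp: x_def)
      also have "\<dots> = exp x" by (simp add: exp_def divide_inverse mult.commute)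
      finally show ?thesis by (simp add: x_def)
    qed
    also have "\<dots> \<le> 1 + pi/20 + (pi/20)\<^sup>2" using pi_less_4 by (intro exp_bound) auto
    also have "\<dots> \<le> 1 + 1/5 + (1/5)\<^sup>2" using pi_less_4 by (intro add_mono power_mono) auto
    finally show ?thesis by (simp add: power2_eq_square)
  qed
  have main: "L2_norm circ D \<le> N / 4 + (\<Sum>n\<in>S. cmod (c n)) * (3 / fact K)" for K
  proof -
    \<comment> \<open>The remainder tends to \<open>0\<close> uniformly in \<open>t\<close> because the sum over \<open>S\<close> is finite.\<close>
    define E where "E t = D t - (\<Sum>k=1..K. Y k t)" for t
    have EL2: "E \<in> L2 circ" unfolding E_def by (intro L2_diff DL2 L2_sum YL2)
    have "L2_norm circ D \<le> L2_norm circ (\<lambda>t. \<Sum>k=1..K. Y k t) + L2_norm circ E"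
      using L2_norm_triangle[OF L2_sum[of "{1..K}" Y circ, OF YL2] EL2] by (simp add: E_def)
    also have "L2_norm circ (\<lambda>t. \<Sum>k=1..K. Y k t) \<le> (\<Sum>k=1..K. L2_norm circ (Y k))"
      by (intro L2_norm_sum_le YL2)
    also have "\<dots> \<le> (\<Sum>k=1..K. (pi/20)^k / fact k * N)" by (intro sum_mono YN)
    also have "\<dots> \<le> 1/4 * N"
      using partial[of K] unfolding sum_distrib_right[symmetric]
      by (intro mult_right_mono) (auto simp: N_def sum_nonneg)
    also have "L2_norm circ E \<le> ((\<Sum>n\<in>S. cmod (c n)) * (3 / fact K)) * L2_norm circ (expo 0)"
    proof (intro L2_norm_circ_mono EL2 expo_L2)
      show "0 \<le> (\<Sum>n\<in>S. cmod (c n)) * (3 / fact K)" by (simp add: sum_nonneg)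
      fix t assume t: "t \<in> {-pi..pi}"
      have "E t = (\<Sum>n\<in>S. c n * expo (real_of_int n) t * (expo (\<theta> n) t - (\<Sum>k\<le>K. (\<i> * complex_of_real (\<theta> n * t)) ^ k / fact k)))"
      proof -
        have 1: "(\<Sum>k\<le>K. g k) = g 0 + (\<Sum>k=1..K. g k)" for g :: "nat \<Rightarrow> complex"
          by (subst sum.atLeast_Suc_atMost[of 0 K, folded atMost_atLeast0]) auto
        have "(\<Sum>k=1..K. Y k t) = (\<Sum>n\<in>S. \<Sum>k=1..K. c n * expo (real_of_int n) t * ((\<i> * complex_of_real (\<theta> n * t)) ^ k / fact k))"
          unfolding Y_def X_def sum_distrib_left
          by (subst sum.swap) (simp add: power_mult_distrib mult_ac)
        then show ?thesis unfolding E_def D_def expo_add 1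
          by (simp add: sum_subtractf sum_distrib_left algebra_simps sum.distrib)
      qed
      also have "cmod \<dots> \<le> (\<Sum>n\<in>S. cmod (c n) * (3 / fact K))"
      proof (rule sum_norm_le)
        fix n assume n: "n \<in> S"
        define z where "z = \<i> * complex_of_real (\<theta> n * t)"
        have "\<bar>\<theta> n\<bar> * \<bar>t\<bar> \<le> (1/20) * 4" using th[OF n] t pi_less_4 by (intro mult_mono) auto
        then have z: "cmod z \<le> 1" "\<bar>Re z\<bar> \<le> 1" by (auto simp: z_def norm_mult abs_mult)
        have "cmod (exp z - (\<Sum>k\<le>K. z ^ k / fact k)) \<le> exp \<bar>Re z\<bar> * (cmod z ^ Suc K / fact K)"
          using Taylor_exp[of z K] by simp
        also have "\<dots> \<le> 3 * (1 / fact K)"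
        proof (intro mult_mono divide_right_mono)
          show "exp \<bar>Re z\<bar> \<le> 3" using z exp_le order_trans[of "exp \<bar>Re z\<bar>" "exp 1" 3] by simp
          show "cmod z ^ Suc K \<le> 1" using z by (intro power_le_one) auto
        qed auto
        finally have "cmod (expo (\<theta> n) t - (\<Sum>k\<le>K. z ^ k / fact k)) \<le> 3 / fact K"
          by (simp add: expo_def z_def)
        then show "cmod (c n * expo (real_of_int n) t * (expo (\<theta> n) t - (\<Sum>k\<le>K. (\<i> * complex_of_real (\<theta> n * t)) ^ k / fact k))) \<le> cmod (c n) * (3 / fact K)"
          unfolding norm_mult norm_expo mult_1_right z_def[symmetric] by (intro mult_left_mono) auto
      qed
      also have "\<dots> = ((\<Sum>n\<in>S. cmod (c n)) * (3 / fact K)) * cmod (expo 0 t)"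
        unfolding norm_expo by (simp only: sum_distrib_right mult_1_right)
      finally show "cmod (E t) \<le> ((\<Sum>n\<in>S. cmod (c n)) * (3 / fact K)) * cmod (expo 0 t)" .
    qed
    also have "L2_norm circ (expo 0) = 1"
      using circ.prob_space by (simp add: L2_norm_def)
    finally show ?thesis by simp
  qed
  have "(\<lambda>K. N / 4 + (\<Sum>n\<in>S. cmod (c n)) * (3 * inverse (fact K))) \<longlonglongrightarrow> N / 4 + (\<Sum>n\<in>S. cmod (c n)) * (3 * 0)"
  proof (intro tendsto_intros)
    show "(\<lambda>K. inverse (fact K :: real)) \<longlonglongrightarrow> 0"
      using summable_LIMSEQ_zero[OF summable_exp[of "1::real"]] by simp
  qed
  then have "L2_norm circ D \<le> N / 4 + (\<Sum>n\<in>S. cmod (c n)) * (3 * 0)"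
  proof (rule LIMSEQ_le_const)
    show "\<exists>K0. \<forall>K\<ge>K0. L2_norm circ D \<le> N / 4 + (\<Sum>n\<in>S. cmod (c n)) * (3 * inverse (fact K))"
      using main by (simp only: inverse_eq_divide times_divide_eq_right mult_1_right) blast
  qed
  moreover have "N \<ge> 0" by (simp add: N_def sum_nonneg)
  ultimately show ?thesis unfolding D_def by simp
qed

lemma perturbed_exponentials_riesz:
  fixes \<theta> :: "int \<Rightarrow> real" and c :: "int \<Rightarrow> complex"
  assumes S: "finite S" and th: "\<And>n. n \<in> S \<Longrightarrow> \<bar>\<theta> n\<bar> \<le> 1/20"
  shows "1/4 * (\<Sum>n\<in>S. (cmod (c n))\<^sup>2) \<le> (L2_norm circ (\<lambda>t. \<Sum>n\<in>S. c n * expo (real_of_int n + \<theta> n) t))\<^sup>2"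
    and "(L2_norm circ (\<lambda>t. \<Sum>n\<in>S. c n * expo (real_of_int n + \<theta> n) t))\<^sup>2 \<le> 9/4 * (\<Sum>n\<in>S. (cmod (c n))\<^sup>2)"
proof -
  define N where "N = sqrt (\<Sum>n\<in>S. (cmod (c n))\<^sup>2)"
  have N: "N \<ge> 0" "N\<^sup>2 = (\<Sum>n\<in>S. (cmod (c n))\<^sup>2)" by (auto simp: N_def sum_nonneg)
  define P where "P t = (\<Sum>n\<in>S. c n * expo (real_of_int n + \<theta> n) t)" for t
  define Q where "Q t = (\<Sum>n\<in>S. c n * expo (real_of_int n) t)" for t
  have L2: "P \<in> L2 circ" "Q \<in> L2 circ" unfolding P_def Q_def by (intro L2_sum_scale expo_L2)+
  have PQ: "L2_norm circ (\<lambda>t. P t - Q t) \<le> N / 2"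
    unfolding P_def Q_def N_def by (rule perturbation_small[OF S th])
  have "(L2_norm circ Q)\<^sup>2 = N\<^sup>2" unfolding N(2) Q_def by (rule trig_L2_norm[OF S])
  then have Q: "L2_norm circ Q = N" using N(1) L2_norm_nonneg by (metis power2_eq_iff_nonneg)
  have "L2_norm circ P \<le> L2_norm circ (\<lambda>t. P t - Q t) + L2_norm circ Q"
    using L2_norm_triangle[OF L2_diff[OF L2] L2(2)] by simp
  then have up: "L2_norm circ P \<le> 3/2 * N" using PQ Q by simp
  have "L2_norm circ Q \<le> L2_norm circ (\<lambda>t. Q t - P t) + L2_norm circ P"
    using L2_norm_triangle[OF L2_diff[OF L2(2) L2(1)] L2(1)] by simp
  then have lo: "1/2 * N \<le> L2_norm circ P" using PQ Q by (subst (asm) L2_norm_minus_commute) simp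
  show "1/4 * (\<Sum>n\<in>S. (cmod (c n))\<^sup>2) \<le> (L2_norm circ (\<lambda>t. \<Sum>n\<in>S. c n * expo (real_of_int n + \<theta> n) t))\<^sup>2"
    using power_mono[OF lo, of 2] N unfolding P_def[symmetric] by (simp add: power_mult_distrib power_divide)
  show "(L2_norm circ (\<lambda>t. \<Sum>n\<in>S. c n * expo (real_of_int n + \<theta> n) t))\<^sup>2 \<le> 9/4 * (\<Sum>n\<in>S. (cmod (c n))\<^sup>2)"
    using power_mono[OF up L2_norm_nonneg, of 2] N unfolding P_def[symmetric] by (simp add: power_mult_distrib power_divide)
qed

section \<open>A fixed point principle and the leakage kernels\<close>

text \<open>Banach's fixed point theorem for families indexed by an arbitrary type, in the supremum norm. Stated with
  pointwise bounds it applies to the block equations without constructing a space of bounded families.\<close>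

lemma sup_contraction_fixpoint:
  fixes T :: "('i \<Rightarrow> 'b::banach) \<Rightarrow> 'i \<Rightarrow> 'b"
  assumes b: "b \<ge> 0"
    and maps: "\<And>x i. (\<And>i. norm (x i) \<le> b) \<Longrightarrow> norm (T x i) \<le> b"
    and contr: "\<And>x y c i. (\<And>i. norm (x i) \<le> b) \<Longrightarrow> (\<And>i. norm (y i) \<le> b) \<Longrightarrow>
       (\<And>i. norm (x i - y i) \<le> c) \<Longrightarrow> norm (T x i - T y i) \<le> c / 2"
  shows "\<exists>x. (\<forall>i. norm (x i) \<le> b) \<and> T x = x"
proof -
  define X where "X n = (T ^^ n) (\<lambda>_. 0)" for n
  have X0: "X 0 = (\<lambda>_. 0)" and XS: "X (Suc n) = T (X n)" for n by (simp_all add: X_def)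
  have Xb: "norm (X n i) \<le> b" for n i
  proof (induction n arbitrary: i)
    case (Suc n) then show ?case unfolding XS by (intro maps)
  qed (simp add: X0 b)
  have diff: "norm (X (Suc n) i - X n i) \<le> b * (1/2) ^ n" for n i
  proof (induction n arbitrary: i)
    case 0 then show ?case using Xb[of 1 i] by (simp add: X0)
  next
    case (Suc n)
    have "norm (T (X (Suc n)) i - T (X n) i) \<le> (b * (1/2) ^ n) / 2"
      by (intro contr Xb Suc)
    then show ?case by (simp add: XS)
  qed
  have "\<exists>l. (\<lambda>n. X n i) \<longlonglongrightarrow> l" for i
  proof -
    have "summable (\<lambda>n. X (Suc n) i - X n i)"
    proof (rule summable_comparison_test')
      show "summable (\<lambda>n. b * (1/2::real) ^ n)" by (intro summable_mult summable_geometric) simp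
    qed (rule diff)
    then have "(\<lambda>n. \<Sum>k<n. X (Suc k) i - X k i) \<longlonglongrightarrow> (\<Sum>n. X (Suc n) i - X n i)"
      by (rule summable_LIMSEQ)
    moreover have "(\<Sum>k<n. X (Suc k) i - X k i) = X n i" for n
      by (subst sum_lessThan_telescope) (simp add: X0)
    ultimately show ?thesis by auto
  qed
  then obtain x where x: "\<And>i. (\<lambda>n. X n i) \<longlonglongrightarrow> x i" by metis
  have xb: "norm (x i) \<le> b" for i
    using x[of i] Xb by (intro LIMSEQ_le_const2[OF tendsto_norm]) auto
  have far: "norm (X (n + k) i - X n i) \<le> 2 * b * (1/2) ^ n" for n k i
  proof -
    have "norm (X (n + k) i - X n i) \<le> b * (1/2) ^ n * (2 - 2 * (1/2) ^ k)"
    proof (induction k)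
      case (Suc k)
      have "norm (X (n + Suc k) i - X n i) \<le> norm (X (Suc (n + k)) i - X (n + k) i) + norm (X (n + k) i - X n i)"
        using norm_triangle_ineq[of "X (Suc (n + k)) i - X (n + k) i" "X (n + k) i - X n i"] by simp
      also have "\<dots> \<le> b * (1/2) ^ (n + k) + b * (1/2) ^ n * (2 - 2 * (1/2) ^ k)"
        by (intro add_mono diff Suc)
      also have "\<dots> = b * (1/2) ^ n * (2 - 2 * (1/2) ^ Suc k)" by (simp add: power_add algebra_simps)
      finally show ?case .
    qed simp
    also have "\<dots> \<le> b * (1/2) ^ n * 2" using b by (intro mult_left_mono) auto
    finally show ?thesis by simp
  qed
  have near: "norm (x i - X n i) \<le> 2 * b * (1/2) ^ n" for n i
  proof (rule LIMSEQ_le_const2)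
    show "(\<lambda>k. norm (X k i - X n i)) \<longlonglongrightarrow> norm (x i - X n i)" by (intro tendsto_intros x)
    show "\<exists>N. \<forall>k\<ge>N. norm (X k i - X n i) \<le> 2 * b * (1/2) ^ n"
      using far[of n _ i] by (metis le_Suc_ex)
  qed
  have "T x i = x i" for i
  proof -
    have "(\<lambda>n. X (Suc n) i) \<longlonglongrightarrow> T x i"
    proof (rule LIM_zero_cancel, rule Lim_null_comparison)
      have "norm (T (X n) i - T x i) \<le> (2 * b * (1/2) ^ n) / 2" for n
        by (intro contr Xb xb) (subst norm_minus_commute, rule near)
      then show "\<forall>\<^sub>F n in sequentially. norm (X (Suc n) i - T x i) \<le> b * (1/2) ^ n"
        by (simp add: XS)
      show "(\<lambda>n. b * (1/2) ^ n) \<longlonglongrightarrow> 0"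
        by (intro tendsto_mult_right_zero LIMSEQ_power_zero) simp
    qed
    moreover have "(\<lambda>n. X (Suc n) i) \<longlonglongrightarrow> x i" using x[of i] by (rule LIMSEQ_Suc)
    ultimately show ?thesis by (rule LIMSEQ_unique)
  qed
  then show ?thesis using xb by auto
qed

text \<open>All series over blocks are controlled through their finite partial sums; applied to differences of series
  the same bound yields Lipschitz estimates.\<close>

lemma infsum_norm_le:
  fixes f :: "'i \<Rightarrow> 'b::banach" and v :: "'i \<Rightarrow> real"
  assumes f: "\<And>i. i \<in> A \<Longrightarrow> norm (f i) \<le> c * v i" and c: "c \<ge> 0"
    and v: "\<And>F. finite F \<Longrightarrow> F \<subseteq> A \<Longrightarrow> sum v F \<le> \<kappa>"
  shows "f summable_on A" "norm (infsum f A) \<le> c * \<kappa>"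
proof -
  have fin: "sum (\<lambda>i. norm (f i)) F \<le> c * \<kappa>" if "finite F" "F \<subseteq> A" for F
  proof -
    have "sum (\<lambda>i. norm (f i)) F \<le> (\<Sum>i\<in>F. c * v i)" using that f by (intro sum_mono) auto
    also have "\<dots> \<le> c * \<kappa>" unfolding sum_distrib_left[symmetric] by (intro mult_left_mono v that c)
    finally show ?thesis .
  qed
  then have abs: "(\<lambda>i. norm (f i)) summable_on A"
    by (intro nonneg_bdd_above_summable_on) (auto intro!: bdd_aboveI[where M="c * \<kappa>"])
  then show "f summable_on A" by (rule abs_summable_summable)
  have "norm (infsum f A) \<le> infsum (\<lambda>i. norm (f i)) A" by (rule norm_infsum_bound[OF abs])
  also have "\<dots> \<le> c * \<kappa>" by (rule infsum_le_finite_sums[OF abs fin])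
  finally show "norm (infsum f A) \<le> c * \<kappa>" .
qed

lemma abs_mult_diff_le:
  fixes x y p q :: real
  shows "\<bar>x * p - y * q\<bar> \<le> \<bar>x - y\<bar> * \<bar>p\<bar> + \<bar>y\<bar> * \<bar>p - q\<bar>"
proof -
  have "x * p - y * q = (x - y) * p + y * (p - q)" by (simp add: algebra_simps)
  then show ?thesis by (metis abs_mult abs_triangle_ineq)
qed

lemma norm_mult_of_real_diff_le:
  fixes x y :: complex
  shows "cmod (x * complex_of_real p - y * complex_of_real q) \<le> cmod (x - y) * \<bar>p\<bar> + cmod y * \<bar>p - q\<bar>"
proof -
  have "x * complex_of_real p - y * complex_of_real q = (x - y) * complex_of_real p + y * complex_of_real (p - q)"
    by (simp add: algebra_simps)
  then show ?thesis by (metis norm_triangle_ineq norm_mult norm_of_real)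
qed

text \<open>The kernel \<open>\<theta> / (d + \<theta>)\<close> of the leakage inside a block: it is small, its Lipschitz constant is close to
  \<open>1\<close>, and it differs from its linearization \<open>\<theta> / d\<close> by a function with a small Lipschitz constant. The last
  property makes the block equations contractive after inversion of their linear part.\<close>

lemma near_kernel:
  fixes d :: int and \<theta> \<phi> :: real
  assumes d: "d \<noteq> 0" and t: "\<bar>\<theta>\<bar> \<le> 1/500" "\<bar>\<phi>\<bar> \<le> 1/500"
  shows "\<bar>\<theta> / (of_int d + \<theta>)\<bar> \<le> 21/10000"
    and "\<bar>\<theta> / (of_int d + \<theta>) - \<phi> / (of_int d + \<phi>)\<bar> \<le> 101/100 * \<bar>\<theta> - \<phi>\<bar>"
    and "\<bar>\<theta> / (of_int d + \<theta>) - \<theta> / of_int d\<bar> \<le> 1/100000"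
    and "\<bar>(\<theta> / (of_int d + \<theta>) - \<theta> / of_int d) - (\<phi> / (of_int d + \<phi>) - \<phi> / of_int d)\<bar> \<le> 1/100 * \<bar>\<theta> - \<phi>\<bar>"
proof -
  define x where "x = real_of_int d"
  have x: "\<bar>x\<bar> \<ge> 1" unfolding x_def using d by linarith
  have den: "\<bar>x + s\<bar> \<ge> 499/500 * \<bar>x\<bar>" "x + s \<noteq> 0" if "\<bar>s\<bar> \<le> 1/500" for s using x that by linarith+
  have den1: "\<bar>x + s\<bar> \<ge> 499/500" if "\<bar>s\<bar> \<le> 1/500" for s using x that by linarith
  have inv: "1 / \<bar>x + s\<bar> \<le> 500/499" if "\<bar>s\<bar> \<le> 1/500" for s
    using le_imp_inverse_le[OF den1[OF that]] by (simp add: inverse_eq_divide)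
  have invx: "\<bar>x\<bar> / \<bar>x + s\<bar> \<le> 500/499" if "\<bar>s\<bar> \<le> 1/500" for s
    using den[OF that] den1[OF that] by (simp add: pos_divide_le_eq)
  show b1: "\<bar>\<theta> / (of_int d + \<theta>)\<bar> \<le> 21/10000"
  proof -
    have "\<bar>\<theta> / (x + \<theta>)\<bar> = \<bar>\<theta>\<bar> * (1 / \<bar>x + \<theta>\<bar>)" by (simp add: abs_divide)
    also have "\<dots> \<le> 1/500 * (500/499)" using t by (intro mult_mono inv[OF t(1)]) simp_all
    finally show ?thesis by (simp add: x_def)
  qed
  have D: "\<theta> / (x + \<theta>) - \<phi> / (x + \<phi>) = (\<theta> - \<phi>) * (x / ((x + \<theta>) * (x + \<phi>)))"
    using den(2)[OF t(1)] den(2)[OF t(2)] by (simp add: field_simps)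
  show "\<bar>\<theta> / (of_int d + \<theta>) - \<phi> / (of_int d + \<phi>)\<bar> \<le> 101/100 * \<bar>\<theta> - \<phi>\<bar>"
  proof -
    have "\<bar>\<theta> / (x + \<theta>) - \<phi> / (x + \<phi>)\<bar> = \<bar>\<theta> - \<phi>\<bar> * ((\<bar>x\<bar> / \<bar>x + \<theta>\<bar>) * (1 / \<bar>x + \<phi>\<bar>))"
      unfolding D by (simp add: abs_mult)
    also have "\<dots> \<le> \<bar>\<theta> - \<phi>\<bar> * (500/499 * (500/499))"
      by (intro mult_left_mono mult_mono[OF invx[OF t(1)] inv[OF t(2)]]) simp_all
    also have "\<dots> \<le> 101/100 * \<bar>\<theta> - \<phi>\<bar>" by simp
    finally show ?thesis by (simp add: x_def)
  qed
  show "\<bar>\<theta> / (of_int d + \<theta>) - \<theta> / of_int d\<bar> \<le> 1/100000"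
  proof -
    have "\<theta> / (x + \<theta>) - \<theta> / x = - (\<theta> * \<theta>) * ((1 / x) * (1 / (x + \<theta>)))"
      using den(2)[OF t(1)] x by (simp add: field_simps)
    then have "\<bar>\<theta> / (x + \<theta>) - \<theta> / x\<bar> = (\<bar>\<theta>\<bar> * \<bar>\<theta>\<bar>) * ((1 / \<bar>x\<bar>) * (1 / \<bar>x + \<theta>\<bar>))"
      by (simp add: abs_mult)
    also have "\<dots> \<le> (1/500 * (1/500)) * (1 * (500/499))"
      using t x by (intro mult_mono inv[OF t(1)]) simp_all
    finally show ?thesis by (simp add: x_def)
  qed
  show "\<bar>(\<theta> / (of_int d + \<theta>) - \<theta> / of_int d) - (\<phi> / (of_int d + \<phi>) - \<phi> / of_int d)\<bar> \<le> 1/100 * \<bar>\<theta> - \<phi>\<bar>"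
  proof -
    have x0: "x \<noteq> 0" using x by auto
    have "(\<theta> / (x + \<theta>) - \<theta> / x) - (\<phi> / (x + \<phi>) - \<phi> / x) = (\<theta> - \<phi>) * (x / ((x + \<theta>) * (x + \<phi>)) - 1 / x)"
      using D x0 by (simp add: field_simps)
    also have "x / ((x + \<theta>) * (x + \<phi>)) - 1 / x = - (((\<theta> + \<phi>) + \<theta> * \<phi> / x) * (1 / (x + \<theta>)) * (1 / (x + \<phi>)))"
      using den(2)[OF t(1)] den(2)[OF t(2)] x0 by (simp add: divide_simps) (simp add: algebra_simps)
    finally have E: "\<bar>(\<theta> / (x + \<theta>) - \<theta> / x) - (\<phi> / (x + \<phi>) - \<phi> / x)\<bar> =
      \<bar>\<theta> - \<phi>\<bar> * (\<bar>(\<theta> + \<phi>) + \<theta> * \<phi> / x\<bar> * (1 / \<bar>x + \<theta>\<bar>) * (1 / \<bar>x + \<phi>\<bar>))"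
      by (simp add: abs_mult)
    have "\<bar>\<theta> * \<phi> / x\<bar> = \<bar>\<theta>\<bar> * \<bar>\<phi>\<bar> * (1 / \<bar>x\<bar>)" by (simp add: abs_mult)
    also have "\<dots> \<le> (1/500) * (1/500) * 1" using t x by (intro mult_mono) auto
    finally have "\<bar>(\<theta> + \<phi>) + \<theta> * \<phi> / x\<bar> \<le> 1/200" using t by linarith
    then have "\<bar>(\<theta> + \<phi>) + \<theta> * \<phi> / x\<bar> * (1 / \<bar>x + \<theta>\<bar>) * (1 / \<bar>x + \<phi>\<bar>) \<le> 1/200 * (500/499) * (500/499)"
      using t by (intro mult_mono inv[OF t(1)] inv[OF t(2)]) simp_all
    also have "\<dots> \<le> 1/100" by simp
    finally show ?thesis unfolding x_def[symmetric] E
      by (subst mult.commute) (rule mult_left_mono[OF _ abs_ge_zero])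
  qed
qed

text \<open>The kernel of the leakage between blocks. The term \<open>\<theta> / J\<close> is added because its contributions cancel when the
  moment of the block vanishes; with it the kernel decays like the inverse square of the distance, whether or not the
  moment vanishes.\<close>

lemma far_kernel:
  fixes m A J :: real and \<theta> \<phi> :: real
  assumes m: "\<bar>m\<bar> \<le> 2" and A: "A \<ge> 10" "\<bar>J\<bar> \<ge> A - 2" and t: "\<bar>\<theta>\<bar> \<le> 1/500" "\<bar>\<phi>\<bar> \<le> 1/500"
  shows "\<bar>\<theta> / (m - J + \<theta>) + \<theta> / J\<bar> \<le> 17/1000 / A\<^sup>2"
    and "\<bar>(\<theta> / (m - J + \<theta>) + \<theta> / J) - (\<phi> / (m - J + \<phi>) + \<phi> / J)\<bar> \<le> 81/10 * \<bar>\<theta> - \<phi>\<bar> / A\<^sup>2"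
proof -
  define h where "h s = (m + s) * ((1 / J) * (1 / (m - J + s)))" for s
  have J: "1 / \<bar>J\<bar> \<le> 2 / A" "J \<noteq> 0" using A by (auto simp: field_simps)
  have X: "1 / \<bar>m - J + s\<bar> \<le> 2 / A" "m - J + s \<noteq> 0" if "\<bar>s\<bar> \<le> 1/500" for s
  proof -
    have "\<bar>m - J + s\<bar> \<ge> A / 2" using A m that by linarith
    moreover have "A / 2 > 0" using A by simp
    ultimately show "1 / \<bar>m - J + s\<bar> \<le> 2 / A" "m - J + s \<noteq> 0"
      using le_imp_inverse_le[of "A / 2" "\<bar>m - J + s\<bar>"] by (auto simp: inverse_eq_divide)
  qed
  have hb: "\<bar>h s\<bar> \<le> 2002/1000 * (4 / A\<^sup>2)" if s: "\<bar>s\<bar> \<le> 1/500" for s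
  proof -
    have "\<bar>h s\<bar> = \<bar>m + s\<bar> * ((1 / \<bar>J\<bar>) * (1 / \<bar>m - J + s\<bar>))" by (simp add: h_def abs_mult)
    also have "\<dots> \<le> 2002/1000 * ((2 / A) * (2 / A))"
    proof (intro mult_mono J(1) X(1)[OF s])
      show "\<bar>m + s\<bar> \<le> 2002/1000" using m s by linarith
    qed (use A in simp_all)
    finally show ?thesis by (simp add: power2_eq_square)
  qed
  have gh: "s / (m - J + s) + s / J = s * h s" if s: "\<bar>s\<bar> \<le> 1/500" for s
    using J(2) X(2)[OF s] by (simp add: h_def divide_simps) (simp add: algebra_simps)
  have hd: "\<bar>h \<theta> - h \<phi>\<bar> \<le> \<bar>\<theta> - \<phi>\<bar> * (4 / A\<^sup>2)"
  proof -
    have "h \<theta> - h \<phi> = - ((\<theta> - \<phi>) * ((1 / (m - J + \<theta>)) * (1 / (m - J + \<phi>))))"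
    proof -
      have "h s = 1 / J + 1 / (m - J + s)" if s: "\<bar>s\<bar> \<le> 1/500" for s
        using J(2) X(2)[OF s] by (simp add: h_def divide_simps)
      then have "h \<theta> - h \<phi> = 1 / (m - J + \<theta>) - 1 / (m - J + \<phi>)" using t by simp
      also have "\<dots> = - ((\<theta> - \<phi>) * ((1 / (m - J + \<theta>)) * (1 / (m - J + \<phi>))))"
        using X(2)[OF t(1)] X(2)[OF t(2)] by (simp add: divide_simps)
      finally show ?thesis .
    qed
    then have "\<bar>h \<theta> - h \<phi>\<bar> = \<bar>\<theta> - \<phi>\<bar> * ((1 / \<bar>m - J + \<theta>\<bar>) * (1 / \<bar>m - J + \<phi>\<bar>))"
      by (simp add: abs_mult)
    also have "\<dots> \<le> \<bar>\<theta> - \<phi>\<bar> * ((2 / A) * (2 / A))"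
      using A by (intro mult_left_mono mult_mono X(1)[OF t(1)] X(1)[OF t(2)]) simp_all
    finally show ?thesis by (simp add: power2_eq_square)
  qed
  show "\<bar>\<theta> / (m - J + \<theta>) + \<theta> / J\<bar> \<le> 17/1000 / A\<^sup>2"
  proof -
    have "\<bar>\<theta>\<bar> * \<bar>h \<theta>\<bar> \<le> 1/500 * (2002/1000 * (4 / A\<^sup>2))" using t by (intro mult_mono hb[OF t(1)]) simp_all
    also have "\<dots> \<le> 17/1000 / A\<^sup>2" using A by (simp add: field_simps)
    finally show ?thesis unfolding gh[OF t(1)] abs_mult .
  qed
  show "\<bar>(\<theta> / (m - J + \<theta>) + \<theta> / J) - (\<phi> / (m - J + \<phi>) + \<phi> / J)\<bar> \<le> 81/10 * \<bar>\<theta> - \<phi>\<bar> / A\<^sup>2"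
  proof -
    have "\<bar>\<theta> * h \<theta> - \<phi> * h \<phi>\<bar> \<le> \<bar>\<theta> - \<phi>\<bar> * \<bar>h \<theta>\<bar> + \<bar>\<phi>\<bar> * \<bar>h \<theta> - h \<phi>\<bar>" by (rule abs_mult_diff_le)
    also have "\<dots> \<le> \<bar>\<theta> - \<phi>\<bar> * (2002/1000 * (4 / A\<^sup>2)) + 1/500 * (\<bar>\<theta> - \<phi>\<bar> * (4 / A\<^sup>2))"
      using t by (intro add_mono mult_mono hb[OF t(1)] hd) simp_all
    also have "\<dots> \<le> 81/10 * \<bar>\<theta> - \<phi>\<bar> / A\<^sup>2" using A by (simp add: field_simps)
    finally show ?thesis unfolding gh[OF t(1)] gh[OF t(2)] .
  qed
qed

section \<open>The system of block equations\<close>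

text \<open>The positions, relative to the centre of a block, of the frequencies that are retained.\<close>

definition offsets :: "int set" where "offsets = {1, -1, 2, -2}"

text \<open>The amplitudes of an ideal block. The amplitudes \<open>1\<close> and \<open>\<i>\<close> are independent over the reals, so that the shifts at
  \<open>\<plusminus>1\<close> serve the real parts and those at \<open>\<plusminus>2\<close> the imaginary parts of the two complex equations.\<close>

definition base_amp :: "int \<Rightarrow> complex"
  where "base_amp m = (if m = 0 then 0 else if \<bar>m\<bar> = 1 then 1 else \<i>)"

lemma offsets_props: "finite offsets" "m \<in> offsets \<Longrightarrow> m \<noteq> 0" "m \<in> offsets \<Longrightarrow> \<bar>real_of_int m\<bar> \<le> 2"
  "m \<in> offsets \<Longrightarrow> \<bar>m\<bar> \<le> 2" "card offsets = 4"
  by (auto simp: offsets_def)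

lemma sum_offsets: "(\<Sum>m\<in>offsets. f m) = f 1 + f (-1) + f 2 + (f (-2) :: 'b::comm_monoid_add)"
  by (simp add: offsets_def add.assoc)

lemma norm_base_amp: "cmod (base_amp m) \<le> 1"
  by (simp add: base_amp_def)

lemma norm_sum_offs_le:
  fixes f :: "int \<Rightarrow> complex"
  assumes "\<And>m. m \<in> offsets \<Longrightarrow> cmod (f m) \<le> c"
  shows "cmod (\<Sum>m\<in>offsets. f m) \<le> 4 * c"
  using sum_norm_le[of offsets f "\<lambda>_. c"] assms offsets_props by simp

lemma norm_sum_offs_but_one_le:
  fixes f :: "int \<Rightarrow> complex"
  assumes "\<And>m. m \<in> offsets \<Longrightarrow> m \<noteq> j \<Longrightarrow> cmod (f m) \<le> c" and j: "j \<in> offsets"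
  shows "cmod (\<Sum>m\<in>offsets - {j}. f m) \<le> 3 * c"
proof -
  have "card (offsets - {j}) = 3" using j offsets_props by (simp add: card_Diff_singleton)
  then show ?thesis using sum_norm_le[of "offsets - {j}" f "\<lambda>_. c"] assms by auto
qed

lemma has_sum_diff:
  fixes f g :: "'i \<Rightarrow> 'b::real_normed_vector"
  assumes "(f has_sum a) A" "(g has_sum b) A"
  shows "((\<lambda>x. f x - g x) has_sum (a - b)) A"
  using assms tendsto_diff unfolding has_sum_def sum_subtractf by blast

abbreviation kern :: "int \<Rightarrow> real \<Rightarrow> real"
  where "kern d t \<equiv> t / (of_int d + t)"

text \<open>The unknowns of all blocks: \<open>Inl (k, m)\<close> is the deviation of an amplitude from its ideal value and
  \<open>Inr (k, m)\<close> is ten times a shift. The factor ten balances the two kinds of unknowns, since amplitudes respond to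
  shifts with a Lipschitz constant of order one.\<close>

type_synonym state = "int \<times> int + int \<times> int \<Rightarrow> complex"

text \<open>\<open>G\<close> is the set of good blocks, \<open>w\<close> their size and \<open>e\<close> their normalized coefficients with alternating signs;
  \<open>weak\<close> bounds the influence of the other blocks on one block.\<close>

locale block_system =
  fixes G :: "int set" and D :: int and w :: "int \<Rightarrow> real" and e :: "int \<Rightarrow> int \<Rightarrow> complex"
  assumes D: "D \<ge> 10"
    and w: "\<And>k. k \<in> G \<Longrightarrow> w k > 0"
    and weak: "\<And>k F. k \<in> G \<Longrightarrow> finite F \<Longrightarrow> F \<subseteq> G - {k} \<Longrightarrow>
        (\<Sum>l\<in>F. w l / w k / (real_of_int (D * (k - l)))\<^sup>2) \<le> 1/1000"
    and e: "\<And>k j. k \<in> G \<Longrightarrow> \<bar>j\<bar> \<le> 2 \<Longrightarrow> cmod (e k j - base_amp j) \<le> 1/1000"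
begin

definition amp :: "state \<Rightarrow> int \<Rightarrow> int \<Rightarrow> complex"
  where "amp x k m = base_amp m + x (Inl (k, m))"

definition shift :: "state \<Rightarrow> int \<Rightarrow> int \<Rightarrow> real"
  where "shift x k m = Re (x (Inr (k, m))) / 10"

text \<open>The modified contribution of the block \<open>l\<close> at the offset \<open>J\<close> from its centre. It is the true contribution as soon as the
  moment of the block vanishes, which holds at a fixed point although not during the iteration.\<close>

definition far_leak :: "state \<Rightarrow> int \<Rightarrow> int \<Rightarrow> complex"
  where "far_leak x l J = (\<Sum>m\<in>offsets. amp x l m *
     complex_of_real (shift x l m / (real_of_int m - real_of_int J + shift x l m) + shift x l m / real_of_int J))"

definition coupling :: "state \<Rightarrow> int \<Rightarrow> int \<Rightarrow> complex"
  where "coupling x k j = infsum (\<lambda>l. complex_of_real (w l / w k) * far_leak x l (D * (k - l) + j)) (G - {k})"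

definition near_leak :: "state \<Rightarrow> int \<Rightarrow> int \<Rightarrow> complex"
  where "near_leak x k j = (\<Sum>m\<in>offsets - {j}. amp x k m * complex_of_real (kern (m - j) (shift x k m)))"

text \<open>The right-hand sides of the two linear equations \<open>\<Sum>m. base_amp m * \<theta> m / m = rhs_value\<close> and
  \<open>\<Sum>m. base_amp m * \<theta> m = rhs_moment\<close>: the central coefficient and the moment, after their nonlinear parts have been moved
  to the right.\<close>

definition rhs_value :: "state \<Rightarrow> int \<Rightarrow> complex"
  where "rhs_value x k = e k 0 - coupling x k 0 - (\<Sum>m\<in>offsets.
     x (Inl (k, m)) * complex_of_real (kern m (shift x k m)) +
     base_amp m * complex_of_real (kern m (shift x k m) - shift x k m / of_int m))"

definition rhs_moment :: "state \<Rightarrow> int \<Rightarrow> complex"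
  where "rhs_moment x k = - (\<Sum>m\<in>offsets. x (Inl (k, m)) * complex_of_real (shift x k m))"

text \<open>The solution of these two equations, by separating real and imaginary parts.\<close>

definition new_shift :: "state \<Rightarrow> int \<Rightarrow> int \<Rightarrow> real"
  where "new_shift x k m = (if m = 1 then (Re (rhs_moment x k) + Re (rhs_value x k)) / 2
     else if m = -1 then (Re (rhs_moment x k) - Re (rhs_value x k)) / 2
     else if m = 2 then Im (rhs_moment x k) / 2 + Im (rhs_value x k)
     else Im (rhs_moment x k) / 2 - Im (rhs_value x k))"

text \<open>One step of the iteration. Outside the good blocks all unknowns are kept at \<open>0\<close>, so that they meet the bounds
  trivially.\<close>

definition update :: "state \<Rightarrow> state"
  where "update x i = (case i of
     Inl (k, m) \<Rightarrow> if k \<in> G \<and> m \<in> offsets then e k m - base_amp m - coupling x k m - near_leak x k m else 0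
   | Inr (k, m) \<Rightarrow> if k \<in> G \<and> m \<in> offsets then complex_of_real (10 * new_shift x k m) else 0)"

text \<open>The ball in which the iteration takes place: amplitudes within \<open>1/50\<close> of their ideal values and shifts of at most
  \<open>1/500\<close>. On it the nonlinear terms are small enough for the iteration to halve distances, and the error \<open>1/1000\<close> of
  the data does not lead out of it.\<close>

definition small :: "state \<Rightarrow> bool"
  where "small x \<longleftrightarrow> (\<forall>i. cmod (x i) \<le> 1/50)"

lemma smallD:
  assumes "small x"
  shows "cmod (x i) \<le> 1/50" "cmod (amp x k m) \<le> 51/50" "\<bar>shift x k m\<bar> \<le> 1/500"
proof -
  show *: "cmod (x i) \<le> 1/50" for i using assms by (simp add: small_def)
  show "cmod (amp x k m) \<le> 51/50"
    using norm_triangle_ineq[of "base_amp m" "x (Inl (k, m))"] norm_base_amp[of m] *[of "Inl (k, m)"] by (simp add: amp_def)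
  show "\<bar>shift x k m\<bar> \<le> 1/500"
    using abs_Re_le_cmod[of "x (Inr (k, m))"] *[of "Inr (k, m)"] by (simp add: shift_def)
qed

lemma distD:
  assumes "\<And>i. cmod (x i - y i) \<le> c"
  shows "cmod (amp x k m - amp y k m) \<le> c" "\<bar>shift x k m - shift y k m\<bar> \<le> c / 10"
proof -
  show "cmod (amp x k m - amp y k m) \<le> c" using assms by (simp add: amp_def)
  have "shift x k m - shift y k m = Re (x (Inr (k, m)) - y (Inr (k, m))) / 10" by (simp add: shift_def diff_divide_distrib)
  also have "\<bar>\<dots>\<bar> \<le> cmod (x (Inr (k, m)) - y (Inr (k, m))) / 10"
    using abs_Re_le_cmod[of "x (Inr (k, m)) - y (Inr (k, m))"] by (simp only: abs_divide)
  also have "\<dots> \<le> c / 10" using assms by (intro divide_right_mono) auto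
  finally show "\<bar>shift x k m - shift y k m\<bar> \<le> c / 10" .
qed

lemma gap:
  assumes "l \<noteq> k" "\<bar>j\<bar> \<le> 2"
  shows "real_of_int \<bar>D * (k - l)\<bar> \<ge> 10" "\<bar>real_of_int (D * (k - l) + j)\<bar> \<ge> real_of_int \<bar>D * (k - l)\<bar> - 2"
proof -
  have "\<bar>D * (k - l)\<bar> \<ge> 10 * 1"
    unfolding abs_mult using D assms by (intro mult_mono) auto
  then show "real_of_int \<bar>D * (k - l)\<bar> \<ge> 10" by linarith
  have "\<bar>D * (k - l) + j\<bar> \<ge> \<bar>D * (k - l)\<bar> - 2" using assms(2) by linarith
  then show "\<bar>real_of_int (D * (k - l) + j)\<bar> \<ge> real_of_int \<bar>D * (k - l)\<bar> - 2" by linarith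
qed

lemma far_leak_bound:
  assumes "small x" "l \<noteq> k" "\<bar>j\<bar> \<le> 2"
  shows "cmod (far_leak x l (D * (k - l) + j)) \<le> 7/100 / (real_of_int (D * (k - l)))\<^sup>2"
proof -
  define A where "A = real_of_int \<bar>D * (k - l)\<bar>"
  have A: "A \<ge> 10" "\<bar>real_of_int (D * (k - l) + j)\<bar> \<ge> A - 2" "A\<^sup>2 = (real_of_int (D * (k - l)))\<^sup>2"
    using gap[OF assms(2,3)] by (simp_all add: A_def)
  have "cmod (far_leak x l (D * (k - l) + j)) \<le> 4 * (51/50 * (17/1000 / A\<^sup>2))"
    unfolding far_leak_def
  proof (rule norm_sum_offs_le)
    fix m assume m: "m \<in> offsets"
    show "cmod (amp x l m * complex_of_real (shift x l m / (real_of_int m - real_of_int (D * (k - l) + j) + shift x l m) + shift x l m / real_of_int (D * (k - l) + j))) \<le> 51/50 * (17/1000 / A\<^sup>2)"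
      unfolding norm_mult norm_of_real
      by (intro mult_mono smallD(2) assms far_kernel(1)[OF offsets_props(3)[OF m] A(1,2) smallD(3)[OF assms(1)] smallD(3)[OF assms(1)]]) auto
  qed
  also have "\<dots> \<le> 7/100 / A\<^sup>2" using A(1) by (simp add: field_simps)
  finally show ?thesis by (simp add: A(3))
qed

lemma far_leak_lipschitz:
  assumes "small x" "small y" and dist: "\<And>i. cmod (x i - y i) \<le> c" and "l \<noteq> k" "\<bar>j\<bar> \<le> 2"
  shows "cmod (far_leak x l (D * (k - l) + j) - far_leak y l (D * (k - l) + j)) \<le> (4 * c) / (real_of_int (D * (k - l)))\<^sup>2"
proof -
  define A where "A = real_of_int \<bar>D * (k - l)\<bar>"
  have A: "A \<ge> 10" "\<bar>real_of_int (D * (k - l) + j)\<bar> \<ge> A - 2" "A\<^sup>2 = (real_of_int (D * (k - l)))\<^sup>2"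
    using gap[OF assms(4,5)] by (simp_all add: A_def)
  have "c \<ge> 0" using dist norm_ge_zero order_trans by blast
  have "cmod (far_leak x l (D * (k - l) + j) - far_leak y l (D * (k - l) + j)) \<le>
     4 * (c * (17/1000 / A\<^sup>2) + 51/50 * (81/10 * (c / 10) / A\<^sup>2))"
    unfolding far_leak_def sum_subtractf[symmetric]
  proof (rule norm_sum_offs_le)
    fix m assume m: "m \<in> offsets"
    let ?g = "\<lambda>t. t / (real_of_int m - real_of_int (D * (k - l) + j) + t) + t / real_of_int (D * (k - l) + j)"
    have "cmod (amp x l m * complex_of_real (?g (shift x l m)) - amp y l m * complex_of_real (?g (shift y l m)))
      \<le> cmod (amp x l m - amp y l m) * \<bar>?g (shift x l m)\<bar> + cmod (amp y l m) * \<bar>?g (shift x l m) - ?g (shift y l m)\<bar>"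
      by (rule norm_mult_of_real_diff_le)
    also have "\<dots> \<le> c * (17/1000 / A\<^sup>2) + 51/50 * (81/10 * (c / 10) / A\<^sup>2)"
    proof (intro add_mono mult_mono)
      show "cmod (amp x l m - amp y l m) \<le> c" by (rule distD[OF dist])
      show "\<bar>?g (shift x l m)\<bar> \<le> 17/1000 / A\<^sup>2"
        by (rule far_kernel(1)[OF offsets_props(3)[OF m] A(1,2) smallD(3)[OF assms(1)] smallD(3)[OF assms(1)]])
      have "\<bar>?g (shift x l m) - ?g (shift y l m)\<bar> \<le> 81/10 * \<bar>shift x l m - shift y l m\<bar> / A\<^sup>2"
        by (rule far_kernel(2)[OF offsets_props(3)[OF m] A(1,2) smallD(3)[OF assms(1)] smallD(3)[OF assms(2)]])
      also have "\<dots> \<le> 81/10 * (c / 10) / A\<^sup>2"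
        by (intro divide_right_mono mult_left_mono distD(2)[OF dist]) auto
      finally show "\<bar>?g (shift x l m) - ?g (shift y l m)\<bar> \<le> 81/10 * (c / 10) / A\<^sup>2" .
    qed (use \<open>c \<ge> 0\<close> smallD(2)[OF assms(2)] in auto)
    finally show "cmod (amp x l m * complex_of_real (?g (shift x l m)) - amp y l m * complex_of_real (?g (shift y l m)))
       \<le> c * (17/1000 / A\<^sup>2) + 51/50 * (81/10 * (c / 10) / A\<^sup>2)" .
  qed
  also have "\<dots> \<le> (4 * c) / A\<^sup>2"
    using A(1) \<open>c \<ge> 0\<close> by (simp add: field_simps)
  finally show ?thesis by (simp add: A(3))
qed

lemma coupling_bound:
  assumes "small x" "k \<in> G" "\<bar>j\<bar> \<le> 2"
  shows "(\<lambda>l. complex_of_real (w l / w k) * far_leak x l (D * (k - l) + j)) summable_on G - {k}"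
    and "cmod (coupling x k j) \<le> 7/100000"
proof -
  have bnd: "cmod (complex_of_real (w l / w k) * far_leak x l (D * (k - l) + j)) \<le> 7/100 * (w l / w k / (real_of_int (D * (k - l)))\<^sup>2)"
    if "l \<in> G - {k}" for l
  proof -
    have "cmod (complex_of_real (w l / w k) * far_leak x l (D * (k - l) + j)) \<le> (w l / w k) * (7/100 / (real_of_int (D * (k - l)))\<^sup>2)"
      using that w[of l] w[OF assms(2)] far_leak_bound[OF assms(1) _ assms(3), of l k]
      unfolding norm_mult norm_of_real by (intro mult_mono) auto
    then show ?thesis by (simp add: mult_ac)
  qed
  show "(\<lambda>l. complex_of_real (w l / w k) * far_leak x l (D * (k - l) + j)) summable_on G - {k}"
    by (rule infsum_norm_le(1)[OF bnd _ weak[OF assms(2)]]) auto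
  have "cmod (coupling x k j) \<le> 7/100 * (1/1000)"
    unfolding coupling_def by (rule infsum_norm_le(2)[OF bnd _ weak[OF assms(2)]]) auto
  then show "cmod (coupling x k j) \<le> 7/100000" by simp
qed

lemma coupling_lipschitz:
  assumes "small x" "small y" and dist: "\<And>i. cmod (x i - y i) \<le> c" and "k \<in> G" "\<bar>j\<bar> \<le> 2"
  shows "cmod (coupling x k j - coupling y k j) \<le> c / 250"
proof -
  have "c \<ge> 0" using dist norm_ge_zero order_trans by blast
  have bnd: "cmod (complex_of_real (w l / w k) * far_leak x l (D * (k - l) + j) - complex_of_real (w l / w k) * far_leak y l (D * (k - l) + j))
    \<le> (4 * c) * (w l / w k / (real_of_int (D * (k - l)))\<^sup>2)"
    if "l \<in> G - {k}" for l
  proof -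
    have "cmod (complex_of_real (w l / w k) * far_leak x l (D * (k - l) + j) - complex_of_real (w l / w k) * far_leak y l (D * (k - l) + j))
       \<le> (w l / w k) * ((4 * c) / (real_of_int (D * (k - l)))\<^sup>2)"
      using that w[of l] w[OF assms(4)] far_leak_lipschitz[OF assms(1,2) dist _ assms(5), of l k]
      unfolding right_diff_distrib[symmetric] norm_mult norm_of_real by (intro mult_mono) auto
    then show ?thesis by (simp add: mult_ac)
  qed
  have "coupling x k j - coupling y k j = infsum (\<lambda>l. complex_of_real (w l / w k) * far_leak x l (D * (k - l) + j)
      - complex_of_real (w l / w k) * far_leak y l (D * (k - l) + j)) (G - {k})"
    unfolding coupling_def
    using has_sum_diff[OF has_sum_infsum[OF coupling_bound(1)[OF assms(1,4,5)]] has_sum_infsum[OF coupling_bound(1)[OF assms(2,4,5)]]]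
    by (rule infsumI[symmetric])
  also have "cmod \<dots> \<le> (4 * c) * (1/1000)"
    by (rule infsum_norm_le(2)[OF bnd _ weak[OF assms(4)]]) (use \<open>c \<ge> 0\<close> in auto)
  finally show ?thesis by simp
qed

lemma near_leak_bound:
  assumes "small x" "j \<in> offsets"
  shows "cmod (near_leak x k j) \<le> 7/1000"
proof -
  have "cmod (near_leak x k j) \<le> 3 * (51/50 * (21/10000))"
    unfolding near_leak_def
  proof (rule norm_sum_offs_but_one_le)
    fix m assume "m \<in> offsets" "m \<noteq> j"
    then show "cmod (amp x k m * complex_of_real (kern (m - j) (shift x k m))) \<le> 51/50 * (21/10000)"
      unfolding norm_mult norm_of_real
      by (intro mult_mono smallD(2) near_kernel(1)[where \<phi>=0] smallD(3) assms(1)) auto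
  qed fact
  then show ?thesis by simp
qed

lemma near_term_lipschitz:
  assumes "small x" "small y" and dist: "\<And>i. cmod (x i - y i) \<le> c" and "d \<noteq> 0"
  shows "cmod (amp x k m * complex_of_real (kern d (shift x k m)) -
               amp y k m * complex_of_real (kern d (shift y k m))) \<le> 106/1000 * c"
proof -
  have "c \<ge> 0" using dist norm_ge_zero order_trans by blast
  let ?g = "\<lambda>t. t / (of_int d + t)"
  have "cmod (amp x k m * complex_of_real (?g (shift x k m)) - amp y k m * complex_of_real (?g (shift y k m)))
      \<le> cmod (amp x k m - amp y k m) * \<bar>?g (shift x k m)\<bar> + cmod (amp y k m) * \<bar>?g (shift x k m) - ?g (shift y k m)\<bar>"
    by (rule norm_mult_of_real_diff_le)
  also have "\<dots> \<le> c * (21/10000) + 51/50 * (101/100 * (c / 10))"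
  proof (intro add_mono mult_mono)
    show "cmod (amp x k m - amp y k m) \<le> c" by (rule distD[OF dist])
    show "\<bar>?g (shift x k m)\<bar> \<le> 21/10000"
      by (rule near_kernel(1)[OF \<open>d \<noteq> 0\<close> smallD(3)[OF assms(1)] smallD(3)[OF assms(1)]])
    have "\<bar>?g (shift x k m) - ?g (shift y k m)\<bar> \<le> 101/100 * \<bar>shift x k m - shift y k m\<bar>"
      by (rule near_kernel(2)[OF \<open>d \<noteq> 0\<close> smallD(3)[OF assms(1)] smallD(3)[OF assms(2)]])
    also have "\<dots> \<le> 101/100 * (c / 10)" by (intro mult_left_mono distD(2)[OF dist]) auto
    finally show "\<bar>?g (shift x k m) - ?g (shift y k m)\<bar> \<le> 101/100 * (c / 10)" .
  qed (use \<open>c \<ge> 0\<close> smallD(2)[OF assms(2)] in auto)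
  also have "\<dots> \<le> 106/1000 * c" using \<open>c \<ge> 0\<close> by simp
  finally show ?thesis .
qed

lemma near_leak_lipschitz:
  assumes "small x" "small y" and dist: "\<And>i. cmod (x i - y i) \<le> c" and j: "j \<in> offsets"
  shows "cmod (near_leak x k j - near_leak y k j) \<le> 318/1000 * c"
proof -
  have "cmod (near_leak x k j - near_leak y k j) \<le> 3 * (106/1000 * c)"
    unfolding near_leak_def sum_subtractf[symmetric]
    by (rule norm_sum_offs_but_one_le[OF near_term_lipschitz[OF assms(1,2) dist] j]) auto
  then show ?thesis by simp
qed

lemma rhs_value_bound:
  assumes "small x" "k \<in> G"
  shows "cmod (rhs_value x k) \<le> 129/100000"
proof -
  define S where "S = (\<Sum>m\<in>offsets. x (Inl (k, m)) * complex_of_real (kern m (shift x k m)) +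
     base_amp m * complex_of_real (kern m (shift x k m) - shift x k m / of_int m))"
  have "cmod (\<Sum>m\<in>offsets. x (Inl (k, m)) * complex_of_real (kern m (shift x k m)) +
     base_amp m * complex_of_real (kern m (shift x k m) - shift x k m / of_int m)) \<le> 4 * (1/50 * (21/10000) + 1 * (1/100000))"
  proof (rule norm_sum_offs_le)
    fix m assume m: "m \<in> offsets"
    show "cmod (x (Inl (k, m)) * complex_of_real (kern m (shift x k m)) +
     base_amp m * complex_of_real (kern m (shift x k m) - shift x k m / of_int m)) \<le> 1/50 * (21/10000) + 1 * (1/100000)"
      by (rule order_trans[OF norm_triangle_ineq], unfold norm_mult norm_of_real,
          intro add_mono mult_mono smallD(1,3) near_kernel(1,3)[where \<phi>=0] assms(1) norm_base_amp offsets_props(2)[OF m]) auto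
  qed
  then have "cmod S \<le> 208/1000000" by (simp add: S_def)
  moreover have "cmod (e k 0) \<le> 1/1000" using e[OF assms(2), of 0] by (simp add: base_amp_def)
  moreover have "cmod (coupling x k 0) \<le> 7/100000" using assms by (intro coupling_bound) auto
  moreover have R: "rhs_value x k = e k 0 - coupling x k 0 - S" by (simp add: rhs_value_def S_def)
  ultimately show ?thesis unfolding R
    using norm_triangle_ineq4[of "e k 0 - coupling x k 0" S] norm_triangle_ineq4[of "e k 0" "coupling x k 0"] by linarith
qed

lemma rhs_value_lipschitz:
  assumes "small x" "small y" and dist: "\<And>i. cmod (x i - y i) \<le> c" and k: "k \<in> G"
  shows "cmod (rhs_value x k - rhs_value y k) \<le> 25/1000 * c"
proof -
  have "c \<ge> 0" using dist norm_ge_zero order_trans by blast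
  define H where "H x m = x (Inl (k, m)) * complex_of_real (kern m (shift x k m)) +
     base_amp m * complex_of_real (kern m (shift x k m) - shift x k m / of_int m)" for x m
  have "cmod (\<Sum>m\<in>offsets. H x m - H y m) \<le> 4 * (c * (21/10000) + 1/50 * (101/100 * (c / 10)) + 1 * (1/100 * (c / 10)))"
  proof (rule norm_sum_offs_le)
    fix m assume m: "m \<in> offsets"
    let ?g = "\<lambda>t. t / (of_int m + t)" and ?s = "\<lambda>t. t / (of_int m + t) - t / of_int m"
    note m0 = offsets_props(2)[OF m] and tx = smallD(3)[OF assms(1)] and ty = smallD(3)[OF assms(2)]
    have 1: "cmod (x (Inl (k, m)) * complex_of_real (?g (shift x k m)) - y (Inl (k, m)) * complex_of_real (?g (shift y k m)))
      \<le> c * (21/10000) + 1/50 * (101/100 * (c / 10))"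
    proof (rule order_trans[OF norm_mult_of_real_diff_le], intro add_mono mult_mono)
      show "\<bar>?g (shift x k m)\<bar> \<le> 21/10000" by (rule near_kernel(1)[OF m0 tx tx])
      have "\<bar>?g (shift x k m) - ?g (shift y k m)\<bar> \<le> 101/100 * \<bar>shift x k m - shift y k m\<bar>"
        by (rule near_kernel(2)[OF m0 tx ty])
      also have "\<dots> \<le> 101/100 * (c / 10)" by (intro mult_left_mono distD(2)[OF dist]) auto
      finally show "\<bar>?g (shift x k m) - ?g (shift y k m)\<bar> \<le> 101/100 * (c / 10)" .
    qed (use \<open>c \<ge> 0\<close> dist smallD(1)[OF assms(2)] in auto)
    have 2: "cmod (base_amp m * complex_of_real (?s (shift x k m)) - base_amp m * complex_of_real (?s (shift y k m))) \<le> 1 * (1/100 * (c / 10))"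
      unfolding right_diff_distrib[symmetric] of_real_diff[symmetric] norm_mult norm_of_real
    proof (intro mult_mono norm_base_amp)
      have "\<bar>?s (shift x k m) - ?s (shift y k m)\<bar> \<le> 1/100 * \<bar>shift x k m - shift y k m\<bar>"
        by (rule near_kernel(4)[OF m0 tx ty])
      also have "\<dots> \<le> 1/100 * (c / 10)" by (intro mult_left_mono distD(2)[OF dist]) auto
      finally show "\<bar>?s (shift x k m) - ?s (shift y k m)\<bar> \<le> 1/100 * (c / 10)" .
    qed (use \<open>c \<ge> 0\<close> in auto)
    have "H x m - H y m =
      (x (Inl (k, m)) * complex_of_real (?g (shift x k m)) - y (Inl (k, m)) * complex_of_real (?g (shift y k m))) +
      (base_amp m * complex_of_real (?s (shift x k m)) - base_amp m * complex_of_real (?s (shift y k m)))"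
      unfolding H_def by (simp only: add_diff_add)
    then show "cmod (H x m - H y m) \<le> c * (21/10000) + 1/50 * (101/100 * (c / 10)) + 1 * (1/100 * (c / 10))"
      using norm_triangle_le[OF add_mono[OF 1 2]] by simp
  qed
  then have "cmod ((\<Sum>m\<in>offsets. H x m) - (\<Sum>m\<in>offsets. H y m)) \<le> 21/1000 * c"
    using \<open>c \<ge> 0\<close> by (simp add: sum_subtractf)
  moreover have "cmod (coupling x k 0 - coupling y k 0) \<le> c / 250" by (rule coupling_lipschitz[OF assms(1,2) dist k]) auto
  moreover have "rhs_value x k - rhs_value y k = - ((coupling x k 0 - coupling y k 0) + ((\<Sum>m\<in>offsets. H x m) - (\<Sum>m\<in>offsets. H y m)))"
    unfolding rhs_value_def H_def by (simp add: algebra_simps)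
  ultimately show ?thesis
    using norm_triangle_ineq[of "coupling x k 0 - coupling y k 0" "(\<Sum>m\<in>offsets. H x m) - (\<Sum>m\<in>offsets. H y m)"]
    by (simp only: norm_minus_cancel)
qed

lemma rhs_moment_bound:
  assumes "small x"
  shows "cmod (rhs_moment x k) \<le> 16/100000"
proof -
  have "cmod (\<Sum>m\<in>offsets. x (Inl (k, m)) * complex_of_real (shift x k m)) \<le> 4 * (1/50 * (1/500))"
    by (rule norm_sum_offs_le, unfold norm_mult norm_of_real, intro mult_mono smallD assms) auto
  then show ?thesis by (simp add: rhs_moment_def)
qed

lemma rhs_moment_lipschitz:
  assumes "small x" "small y" and dist: "\<And>i. cmod (x i - y i) \<le> c"
  shows "cmod (rhs_moment x k - rhs_moment y k) \<le> 16/1000 * c"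
proof -
  have "c \<ge> 0" using dist norm_ge_zero order_trans by blast
  have "cmod (\<Sum>m\<in>offsets. x (Inl (k, m)) * complex_of_real (shift x k m) - y (Inl (k, m)) * complex_of_real (shift y k m)) \<le> 4 * (c * (1/500) + 1/50 * (c / 10))"
    by (rule norm_sum_offs_le, rule order_trans[OF norm_mult_of_real_diff_le],
        intro add_mono mult_mono smallD assms distD(2)) (use \<open>c \<ge> 0\<close> in auto)
  then show ?thesis by (simp add: rhs_moment_def sum_subtractf norm_minus_commute)
qed

lemma new_shift_combination_le:
  fixes r0 r1 :: complex
  assumes "cmod r0 \<le> p" "cmod r1 \<le> q"
  shows "\<bar>(Re r1 + Re r0) / 2\<bar> \<le> p + q" "\<bar>(Re r1 - Re r0) / 2\<bar> \<le> p + q"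
    "\<bar>Im r1 / 2 + Im r0\<bar> \<le> p + q" "\<bar>Im r1 / 2 - Im r0\<bar> \<le> p + q"
proof -
  have h: "\<bar>Re r0\<bar> \<le> p" "\<bar>Re r1\<bar> \<le> q" "\<bar>Im r0\<bar> \<le> p" "\<bar>Im r1\<bar> \<le> q"
    using abs_Re_le_cmod[of r0] abs_Re_le_cmod[of r1] abs_Im_le_cmod[of r0] abs_Im_le_cmod[of r1] assms
    by (blast intro: order_trans)+
  have half: "\<bar>b / 2 + s\<bar> \<le> p' + q'" if "\<bar>s\<bar> \<le> p'" "\<bar>b\<bar> \<le> q'" for s b p' q' :: real
  proof -
    have "\<bar>b / 2 + s\<bar> \<le> \<bar>b / 2\<bar> + \<bar>s\<bar>" by (rule abs_triangle_ineq)
    also have "\<bar>b / 2\<bar> \<le> \<bar>b\<bar>" by simp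
    finally show ?thesis using that by simp
  qed
  have "\<bar>Re r0 / 2\<bar> \<le> p" using h(1) by simp
  then show "\<bar>(Re r1 + Re r0) / 2\<bar> \<le> p + q" "\<bar>(Re r1 - Re r0) / 2\<bar> \<le> p + q"
    using half[OF _ h(2), of "Re r0 / 2" p] half[OF _ h(2), of "- Re r0 / 2" p]
    by (simp_all add: add_divide_distrib diff_divide_distrib)
  show "\<bar>Im r1 / 2 + Im r0\<bar> \<le> p + q" "\<bar>Im r1 / 2 - Im r0\<bar> \<le> p + q"
    using half[OF h(3,4)] half[of "- Im r0" p "Im r1" q] h(3,4) by simp_all
qed

lemma new_shift_bound:
  assumes "cmod (rhs_value x k) \<le> p" "cmod (rhs_moment x k) \<le> q"
  shows "\<bar>new_shift x k m\<bar> \<le> p + q"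
  unfolding new_shift_def using new_shift_combination_le[OF assms] by (simp split del: if_split split: if_split)

lemma new_shift_lipschitz:
  assumes "cmod (rhs_value x k - rhs_value y k) \<le> p" "cmod (rhs_moment x k - rhs_moment y k) \<le> q"
  shows "\<bar>new_shift x k m - new_shift y k m\<bar> \<le> p + q"
proof -
  let ?r0 = "rhs_value x k - rhs_value y k" and ?r1 = "rhs_moment x k - rhs_moment y k"
  have "new_shift x k m - new_shift y k m = (if m = 1 then (Re ?r1 + Re ?r0) / 2 else if m = -1 then (Re ?r1 - Re ?r0) / 2
     else if m = 2 then Im ?r1 / 2 + Im ?r0 else Im ?r1 / 2 - Im ?r0)"
    by (simp add: new_shift_def field_simps)
  then show ?thesis using new_shift_combination_le[OF assms] by presburger
qed

lemma update_small:
  assumes "small x"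
  shows "cmod (update x i) \<le> 1/50"
proof (cases i)
  case (Inl p)
  obtain k m where p: "p = (k, m)" by (cases p)
  show ?thesis
  proof (cases "k \<in> G \<and> m \<in> offsets")
    case True
    have "cmod (e k m - base_amp m) \<le> 1/1000" using True e offsets_props(4) by auto
    moreover have "cmod (coupling x k m) \<le> 7/100000" using True assms offsets_props(4) by (intro coupling_bound) auto
    moreover have "cmod (near_leak x k m) \<le> 7/1000" using True by (intro near_leak_bound assms) auto
    ultimately have "cmod (e k m - base_amp m - coupling x k m - near_leak x k m) \<le> 1/50"
      using norm_triangle_ineq4[of "e k m - base_amp m - coupling x k m" "near_leak x k m"]
        norm_triangle_ineq4[of "e k m - base_amp m" "coupling x k m"] by linarith
    then show ?thesis using True by (simp add: update_def Inl p)
  next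
    case False
    then show ?thesis by (auto simp: update_def Inl p)
  qed
next
  case (Inr p)
  obtain k m where p: "p = (k, m)" by (cases p)
  show ?thesis
  proof (cases "k \<in> G \<and> m \<in> offsets")
    case True
    have "\<bar>new_shift x k m\<bar> \<le> 129/100000 + 16/100000"
      using True by (intro new_shift_bound rhs_value_bound rhs_moment_bound assms) auto
    then show ?thesis using True by (simp add: update_def Inr p norm_mult)
  next
    case False
    then show ?thesis by (auto simp: update_def Inr p)
  qed
qed

lemma update_contracts:
  assumes "small x" "small y" and dist: "\<And>i. cmod (x i - y i) \<le> c"
  shows "cmod (update x i - update y i) \<le> c / 2"
proof (cases i)
  case (Inl p)
  have "c \<ge> 0" using dist norm_ge_zero order_trans by blast
  obtain k m where p: "p = (k, m)" by (cases p)
  show ?thesis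
  proof (cases "k \<in> G \<and> m \<in> offsets")
    case True
    have "cmod (coupling x k m - coupling y k m) \<le> c / 250"
      using True offsets_props(4) by (intro coupling_lipschitz[OF assms(1,2) dist]) auto
    moreover have "cmod (near_leak x k m - near_leak y k m) \<le> 318/1000 * c"
      using True by (intro near_leak_lipschitz[OF assms(1,2) dist]) auto
    moreover have "update x i - update y i = - ((coupling x k m - coupling y k m) + (near_leak x k m - near_leak y k m))"
      using True by (simp add: update_def Inl p)
    ultimately show ?thesis using \<open>c \<ge> 0\<close>
      using norm_triangle_ineq[of "coupling x k m - coupling y k m" "near_leak x k m - near_leak y k m"]
      by (simp only: norm_minus_cancel)
  next
    case False
    then show ?thesis using \<open>c \<ge> 0\<close> by (auto simp: update_def Inl p)
  qed
next
  case (Inr p)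
  have "c \<ge> 0" using dist norm_ge_zero order_trans by blast
  obtain k m where p: "p = (k, m)" by (cases p)
  show ?thesis
  proof (cases "k \<in> G \<and> m \<in> offsets")
    case True
    then have "\<bar>new_shift x k m - new_shift y k m\<bar> \<le> 25/1000 * c + 16/1000 * c"
      by (intro new_shift_lipschitz rhs_value_lipschitz[OF assms(1,2) dist] rhs_moment_lipschitz[OF assms(1,2) dist]) auto
    moreover have "update x i - update y i = complex_of_real (10 * (new_shift x k m - new_shift y k m))"
      using True by (simp add: update_def Inr p algebra_simps)
    ultimately show ?thesis using \<open>c \<ge> 0\<close> by (simp only: norm_of_real abs_mult) simp
  next
    case False
    then show ?thesis using \<open>c \<ge> 0\<close> by (auto simp: update_def Inr p)
  qed
qed

lemma fixpoint_exists: "\<exists>x. small x \<and> update x = x"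
  using sup_contraction_fixpoint[of "1/50" update] update_small update_contracts unfolding small_def by auto

text \<open>At a fixed point the moment vanishes, and in each block the amplitude, the leakage inside the block and the leakage from the
  other blocks add up to the prescribed value. At the centre there is no amplitude.\<close>

lemma fixpoint_equations:
  assumes fp: "update x = x" and k: "k \<in> G"
  shows "(\<Sum>m\<in>offsets. amp x k m * complex_of_real (shift x k m)) = 0"
    and "\<bar>j\<bar> \<le> 2 \<Longrightarrow> (if j = 0 then 0 else amp x k j) + near_leak x k j + coupling x k j = e k j"
proof -
  have th: "shift x k m = new_shift x k m" if "m \<in> offsets" for m
  proof -
    have "x (Inr (k, m)) = complex_of_real (10 * new_shift x k m)"
      using fun_cong[OF fp, of "Inr (k, m)"] k that by (simp add: update_def)
    then show ?thesis by (simp add: shift_def)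
  qed
  have th4: "shift x k 1 = new_shift x k 1" "shift x k (-1) = new_shift x k (-1)" "shift x k 2 = new_shift x k 2" "shift x k (-2) = new_shift x k (-2)"
    by (intro th, simp add: offsets_def)+
  have eq0: "(\<Sum>m\<in>offsets. base_amp m * complex_of_real (shift x k m / of_int m)) = rhs_value x k"
    unfolding sum_offsets th4 new_shift_def base_amp_def by (simp add: complex_eq_iff field_simps)
  have eq1: "(\<Sum>m\<in>offsets. base_amp m * complex_of_real (shift x k m)) = rhs_moment x k"
    unfolding sum_offsets th4 new_shift_def base_amp_def by (simp add: complex_eq_iff field_simps)
  show "(\<Sum>m\<in>offsets. amp x k m * complex_of_real (shift x k m)) = 0"
    using eq1 by (simp add: rhs_moment_def amp_def distrib_right sum.distrib)
  show "(if j = 0 then 0 else amp x k j) + near_leak x k j + coupling x k j = e k j" if j: "\<bar>j\<bar> \<le> 2"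
  proof (cases "j = 0")
    case True
    have "near_leak x k 0 = (\<Sum>m\<in>offsets. amp x k m * complex_of_real (kern m (shift x k m)))"
      by (simp add: near_leak_def offsets_def)
    also have "\<dots> = (\<Sum>m\<in>offsets. x (Inl (k, m)) * complex_of_real (kern m (shift x k m)) +
        base_amp m * complex_of_real (kern m (shift x k m) - shift x k m / of_int m))
        + (\<Sum>m\<in>offsets. base_amp m * complex_of_real (shift x k m / of_int m))"
      unfolding sum.distrib[symmetric] by (intro sum.cong refl) (simp add: amp_def distrib_right right_diff_distrib del: of_real_divide of_real_add)
    finally show ?thesis unfolding eq0 rhs_value_def using True by simp
  next
    case False
    then have "j \<in> offsets" using j by (auto simp: offsets_def)
    then have "x (Inl (k, j)) = e k j - base_amp j - coupling x k j - near_leak x k j"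
      using fun_cong[OF fp, of "Inl (k, j)"] k by (simp add: update_def)
    then show ?thesis using False by (simp add: amp_def)
  qed
qed

text \<open>The solution, written with the true leakage between blocks in place of the modified one.\<close>

lemma solution_exists:
  "\<exists>(\<alpha> :: int \<Rightarrow> int \<Rightarrow> complex) (\<theta> :: int \<Rightarrow> int \<Rightarrow> real).
    (\<forall>k m. cmod (\<alpha> k m) \<le> 51/50) \<and> (\<forall>k m. \<bar>\<theta> k m\<bar> \<le> 1/500) \<and>
    (\<forall>k\<in>G. \<forall>j. \<bar>j\<bar> \<le> 2 \<longrightarrow>
       ((\<lambda>l. complex_of_real (w l / w k) * (\<Sum>m\<in>offsets. \<alpha> l m * complex_of_real (kern (m - (D * (k - l) + j)) (\<theta> l m))))
        has_sum (e k j - (if j = 0 then 0 else \<alpha> k j) -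
           (\<Sum>m\<in>offsets - {j}. \<alpha> k m * complex_of_real (kern (m - j) (\<theta> k m))))) (G - {k}))"
proof -
  obtain x where x: "small x" "update x = x" using fixpoint_exists by blast
  show ?thesis
  proof (intro exI[of _ "amp x"] exI[of _ "shift x"] conjI allI ballI impI)
    show "cmod (amp x k m) \<le> 51/50" "\<bar>shift x k m\<bar> \<le> 1/500" for k m using smallD[OF x(1)] by auto
    fix k j assume k: "k \<in> G" and j: "\<bar>j :: int\<bar> \<le> 2"
    have "((\<lambda>l. complex_of_real (w l / w k) * far_leak x l (D * (k - l) + j)) has_sum coupling x k j) (G - {k})"
      unfolding coupling_def using coupling_bound(1)[OF x(1) k j] by (rule has_sum_infsum)
    moreover have "coupling x k j = e k j - (if j = 0 then 0 else amp x k j) - near_leak x k j"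
      using fixpoint_equations(2)[OF x(2) k j] by (simp add: algebra_simps)
    moreover have far_eq: "far_leak x l J = (\<Sum>m\<in>offsets. amp x l m * complex_of_real (kern (m - J) (shift x l m)))"
      if "l \<in> G - {k}" for l J
    proof -
      have "far_leak x l J = (\<Sum>m\<in>offsets. amp x l m * complex_of_real (kern (m - J) (shift x l m))) +
          (\<Sum>m\<in>offsets. amp x l m * complex_of_real (shift x l m)) * complex_of_real (1 / of_int J)"
        unfolding far_leak_def sum_distrib_right sum.distrib[symmetric]
        by (intro sum.cong refl) (simp add: algebra_simps)
      then show ?thesis using fixpoint_equations(1)[OF x(2)] that by simp
    qed
    ultimately have A: "((\<lambda>l. complex_of_real (w l / w k) * far_leak x l (D * (k - l) + j))
        has_sum (e k j - (if j = 0 then 0 else amp x k j) - near_leak x k j)) (G - {k})" by simp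
    show "((\<lambda>l. complex_of_real (w l / w k) * (\<Sum>m\<in>offsets. amp x l m * complex_of_real (kern (m - (D * (k - l) + j)) (shift x l m))))
        has_sum (e k j - (if j = 0 then 0 else amp x k j) -
           (\<Sum>m\<in>offsets - {j}. amp x k m * complex_of_real (kern (m - j) (shift x k m))))) (G - {k})"
      unfolding near_leak_def[symmetric] by (rule iffD1[OF has_sum_cong A]) (simp only: far_eq)
  qed
qed

end

section \<open>Representation of a function with many good blocks\<close>

text \<open>The sign \<open>(-1)\<^sup>n\<close> for an integer exponent.\<close>

definition sg :: "int \<Rightarrow> complex" where "sg n = (if even n then 1 else -1)"

lemma norm_sg [simp]: "cmod (sg n) = 1"
  by (simp add: sg_def)

lemma sg_square [simp]: "sg n * sg n = 1" "sg n * (sg n * z) = z"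
  by (simp_all add: sg_def)

lemma sincpi_lower:
  assumes "\<bar>t\<bar> \<le> 1/500"
  shows "sincpi t \<ge> 1/2"
proof (cases "t = 0")
  case False
  define y where "y = pi * t"
  have y: "y \<noteq> 0" "\<bar>y\<bar> \<le> 1"
    using False assms pi_less_4 pi_gt_zero mult_mono[of pi 4 "\<bar>t\<bar>" "1/500"] by (auto simp: y_def abs_mult)
  have "\<bar>sin y - (\<Sum>m<3. sin_coeff m * y ^ m)\<bar> \<le> inverse (fact 3) * \<bar>y\<bar> ^ 3"
    by (rule Maclaurin_sin_bound)
  moreover have "(\<Sum>m<3. sin_coeff m * y ^ m) = y"
    by (simp add: eval_nat_numeral sin_coeff_def)
  ultimately have "\<bar>sin y - y\<bar> \<le> \<bar>y\<bar> ^ 3 / 6" by (simp add: fact_numeral)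
  then have "\<bar>(sin y - y) / y\<bar> \<le> \<bar>y\<bar>\<^sup>2 / 6"
    using y(1) by (simp add: abs_divide field_simps power2_eq_square power3_eq_cube)
  also have "\<dots> \<le> 1\<^sup>2 / 6" using y(2) by (intro divide_right_mono power_mono) auto
  finally have "\<bar>sin y / y - 1\<bar> \<le> 1/6" using y(1) by (simp add: diff_divide_distrib)
  then have "sin y / y \<ge> 1/2" by linarith
  then show ?thesis using False by (simp add: sincpi_def y_def)
qed (simp add: sincpi_def)

text \<open>Because of this identity the Fourier coefficients of an exponential whose frequency differs from an integer by \<open>t\<close>
  are rational functions of \<open>t\<close>, up to signs and the common factor \<open>sincpi t\<close>; the latter is absorbed into the amplitude.\<close>

lemma sincpi_shift:
  fixes d :: int
  assumes "d \<noteq> 0" "\<bar>t\<bar> < 1"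
  shows "complex_of_real (sincpi (of_int d + t)) = sg d * complex_of_real (sincpi t * (t / (of_int d + t)))"
proof -
  have d: "of_int d + t \<noteq> 0" using assms by linarith
  have "sin (pi * (of_int d + t)) = (if even d then 1 else -1) * sin (pi * t)"
    by (simp add: distrib_left sin_add)
  then show ?thesis using d by (auto simp: sincpi_def sg_def divide_simps)
qed

text \<open>The data \<open>e\<close> come from a function \<open>f\<close>. Evenness of \<open>D\<close> makes the alternating sign depend on the offset
  in the block only.\<close>

locale spectral_blocks = block_system G D w e for G D w e +
  fixes f :: "real \<Rightarrow> complex"
  assumes evenD: "even D"
    and f: "f \<in> L2 circ"
    and e_eq: "\<And>k j. k \<in> G \<Longrightarrow> \<bar>j\<bar> \<le> 2 \<Longrightarrow> complex_of_real (w k) * e k j = sg j * fourier_coeff f (D * k + j)"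
    and w2: "(\<lambda>k. (w k)\<^sup>2) summable_on G"
begin

text \<open>The block of an integer and its offset there; for integers outside the blocks the offset exceeds \<open>2\<close>.\<close>

definition blk :: "int \<Rightarrow> int" where "blk n = (n + 2) div D"
definition pos :: "int \<Rightarrow> int" where "pos n = (n + 2) mod D - 2"

lemma blk_pos: "n = D * blk n + pos n"
  unfolding blk_def pos_def using mult_div_mod_eq[of D "n + 2"] by linarith

lemma blk_eq: "\<bar>j\<bar> \<le> 2 \<Longrightarrow> blk (D * k + j) = k" and pos_eq: "\<bar>j\<bar> \<le> 2 \<Longrightarrow> pos (D * k + j) = j"
proof -
  assume j: "\<bar>j\<bar> \<le> 2"
  have *: "D * k + j + 2 = (j + 2) + D * k" by simp
  have "0 \<le> j + 2" "j + 2 < D" using j D by linarith+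
  then show "blk (D * k + j) = k" "pos (D * k + j) = j"
    unfolding blk_def pos_def * using D by (simp_all add: div_pos_pos_trivial mod_pos_pos_trivial)
qed

text \<open>In a good block the four outer integers are moved and the centre is omitted. All integers outside the good blocks are
  kept.\<close>

definition moved :: "int set" where "moved = {n. blk n \<in> G \<and> pos n \<in> offsets}"
definition kept :: "int set" where "kept = {n. \<not> (blk n \<in> G \<and> \<bar>pos n\<bar> \<le> 2)}"

lemma moved_kept: "moved \<inter> kept = {}" "moved \<union> kept = UNIV - (\<lambda>k. D * k) ` G"
proof -
  show "moved \<inter> kept = {}" using offsets_props(4) by (auto simp: moved_def kept_def)
  show "moved \<union> kept = UNIV - (\<lambda>k. D * k) ` G"
  proof (intro set_eqI iffI)
    fix n assume "n \<in> moved \<union> kept"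
    then show "n \<in> UNIV - (\<lambda>k. D * k) ` G"
      using blk_eq[of 0] pos_eq[of 0] offsets_props(2) by (fastforce simp: moved_def kept_def)
  next
    fix n assume n: "n \<in> UNIV - (\<lambda>k. D * k) ` G"
    show "n \<in> moved \<union> kept"
    proof (rule ccontr)
      assume "n \<notin> moved \<union> kept"
      then have "blk n \<in> G" "\<bar>pos n\<bar> \<le> 2" "pos n \<notin> offsets" by (auto simp: moved_def kept_def)
      then have "pos n = 0" by (auto simp: offsets_def)
      then show False using blk_pos[of n] n \<open>blk n \<in> G\<close> by auto
    qed
  qed
qed

lemma moved_bij: "bij_betw (\<lambda>(k, m). D * k + m) (G \<times> offsets) moved"
proof (rule bij_betwI[where g="\<lambda>n. (blk n, pos n)"])
  show "(\<lambda>(k, m). D * k + m) \<in> G \<times> offsets \<rightarrow> moved"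
    using offsets_props(4) by (auto simp: moved_def blk_eq pos_eq)
  show "(\<lambda>n. (blk n, pos n)) \<in> moved \<rightarrow> G \<times> offsets" by (auto simp: moved_def)
  show "(\<lambda>n. (blk n, pos n)) ((\<lambda>(k, m). D * k + m) p) = p" if "p \<in> G \<times> offsets" for p
    using that offsets_props(4) by (auto simp: blk_eq pos_eq)
  show "(\<lambda>(k, m). D * k + m) ((\<lambda>n. (blk n, pos n)) n) = n" if "n \<in> moved" for n
    using blk_pos[of n] by simp
qed

text \<open>The sum over the good blocks. Its Fourier coefficients are series over pairs of a block and an offset; summation
  over the offsets first turns them into the left-hand sides of the block equations.\<close>

lemma block_sum_exists:
  "\<exists>(\<theta> :: int \<Rightarrow> real) (a :: int \<Rightarrow> complex) g.
    (\<forall>n. \<bar>\<theta> n\<bar> \<le> 1/500) \<and> (\<forall>n\<in>kept. \<theta> n = 0) \<and>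
    (\<lambda>n. (cmod (a n))\<^sup>2) summable_on moved \<and> g \<in> L2 circ \<and>
    has_L2_sum circ (\<lambda>n t. a n * expo (of_int n + \<theta> n) t) moved g \<and>
    (\<forall>n. n \<notin> kept \<longrightarrow> fourier_coeff g n = fourier_coeff f n)"
proof -
  obtain \<alpha> \<tau> where sol_all: "\<forall>k m. cmod (\<alpha> k m) \<le> 51/50" "\<forall>k m. \<bar>\<tau> k m\<bar> \<le> 1/500"
    "\<forall>k\<in>G. \<forall>j. \<bar>j\<bar> \<le> 2 \<longrightarrow>
       ((\<lambda>l. complex_of_real (w l / w k) * (\<Sum>m\<in>offsets. \<alpha> l m * complex_of_real (kern (m - (D * (k - l) + j)) (\<tau> l m))))
        has_sum (e k j - (if j = 0 then 0 else \<alpha> k j) -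
           (\<Sum>m\<in>offsets - {j}. \<alpha> k m * complex_of_real (kern (m - j) (\<tau> k m))))) (G - {k})"
    using solution_exists by (elim exE conjE)
  note sol = sol_all[rule_format]
  define \<theta> where "\<theta> n = (if n \<in> moved then \<tau> (blk n) (pos n) else 0)" for n
  define a where "a n = complex_of_real (w (blk n)) * (sg (pos n) * \<alpha> (blk n) (pos n) / complex_of_real (sincpi (\<tau> (blk n) (pos n))))" for n
  have th: "\<bar>\<theta> n\<bar> \<le> 1/500" for n using sol(2) by (simp add: \<theta>_def)
  have th0: "\<theta> n = 0" if "n \<in> kept" for n using that moved_kept(1) by (auto simp: \<theta>_def)
  have a_bound: "(cmod (a n))\<^sup>2 \<le> 9 * (w (blk n))\<^sup>2" for n
  proof -
    have s: "sincpi (\<tau> (blk n) (pos n)) \<ge> 1/2" by (intro sincpi_lower sol)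
    have "cmod (a n) = \<bar>w (blk n)\<bar> * (cmod (\<alpha> (blk n) (pos n)) / sincpi (\<tau> (blk n) (pos n)))"
      using s by (simp add: a_def norm_mult norm_divide)
    also have "\<dots> \<le> \<bar>w (blk n)\<bar> * ((51/50) / (1/2))"
      using s sol(1) by (intro mult_left_mono frac_le) auto
    also have "\<dots> \<le> \<bar>3 * w (blk n)\<bar>" by (simp add: abs_mult)
    finally have "(cmod (a n))\<^sup>2 \<le> \<bar>3 * w (blk n)\<bar>\<^sup>2" by (intro power_mono) auto
    then show ?thesis by (simp add: power_mult_distrib)
  qed
  have a_sum: "(\<lambda>n. (cmod (a n))\<^sup>2) summable_on moved"
  proof -
    have "(\<lambda>n. 9 * (w (blk n))\<^sup>2) summable_on moved"
    proof -
      have mv: "moved = (\<Union>m\<in>offsets. (\<lambda>k. D * k + m) ` G)"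
        unfolding bij_betw_imp_surj_on[OF moved_bij, symmetric] by (auto simp: image_iff)
      show ?thesis unfolding mv
      proof (rule summable_on_finite_union_disjoint)
        fix m assume m: "m \<in> offsets"
        have inj: "inj_on (\<lambda>k. D * k + m) G" using D by (auto simp: inj_on_def)
        have "((\<lambda>n. 9 * (w (blk n))\<^sup>2) \<circ> (\<lambda>k. D * k + m)) = (\<lambda>k. 9 * (w k)\<^sup>2)"
          using blk_eq offsets_props(4)[OF m] by (auto simp: fun_eq_iff)
        then show "(\<lambda>n. 9 * (w (blk n))\<^sup>2) summable_on (\<lambda>k. D * k + m) ` G"
          unfolding summable_on_reindex[OF inj] using w2 by (simp add: summable_on_cmult_right)
      next
        fix m m' assume m: "m \<in> offsets" "m' \<in> offsets" "m \<noteq> m'"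
        have "D * k + m \<noteq> D * k' + m'" for k k'
          using pos_eq[of m k] pos_eq[of m' k'] m offsets_props(4) by metis
        then show "(\<lambda>k. D * k + m) ` G \<inter> (\<lambda>k. D * k + m') ` G = {}" by auto
      qed (simp add: offsets_props)
    qed
    then show ?thesis
      by (rule summable_on_comparison_test) (use a_bound in auto)
  qed
  have th20: "\<bar>\<theta> n\<bar> \<le> 1/20" for n using th[of n] by simp
  have riesz: "(L2_norm circ (\<lambda>t. \<Sum>n\<in>S. c n * expo (of_int n + \<theta> n) t))\<^sup>2 \<le> 9/4 * (\<Sum>n\<in>S. (cmod (c n))\<^sup>2)"
    if "finite S" for S :: "int set" and c :: "int \<Rightarrow> complex"
    using that by (rule perturbed_exponentials_riesz(2)) (rule th20)
  have "\<exists>g\<in>L2 circ. has_L2_sum circ (\<lambda>n t. a n * expo (of_int n + \<theta> n) t) moved g"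
    by (rule circ.L2_sum_exists[OF expo_L2 riesz a_sum])
  then obtain g where g: "g \<in> L2 circ" "has_L2_sum circ (\<lambda>n t. a n * expo (of_int n + \<theta> n) t) moved g"
    by blast
  have summand: "a (D * l + m) * fourier_coeff (expo (of_int (D * l + m) + \<theta> (D * l + m))) (D * k + j) =
       complex_of_real (w l) * sg j * (if l = k \<and> m = j then \<alpha> l m else \<alpha> l m * complex_of_real (kern (m - (D * (k - l) + j)) (\<tau> l m)))"
    if l: "l \<in> G" and m: "m \<in> offsets" and j: "\<bar>j\<bar> \<le> 2" for l m k j
  proof -
    define d where "d = m - (D * (k - l) + j)"
    have mv: "D * l + m \<in> moved" "blk (D * l + m) = l" "pos (D * l + m) = m"
      using l m offsets_props(4)[OF m] by (auto simp: moved_def blk_eq pos_eq)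
    have arg: "real_of_int (D * l + m) + \<theta> (D * l + m) - real_of_int (D * k + j) = of_int d + \<tau> l m"
      using mv by (simp add: \<theta>_def d_def algebra_simps)
    have d0: "d = 0 \<longleftrightarrow> l = k \<and> m = j"
    proof
      assume "d = 0"
      then have "D * l + m = D * k + j" by (simp add: d_def algebra_simps)
      then show "l = k \<and> m = j" using mv(2,3) blk_eq[OF j, of k] pos_eq[OF j, of k] by simp
    qed (simp add: d_def)
    have s0: "complex_of_real (sincpi (\<tau> l m)) \<noteq> 0" using sincpi_lower[OF sol(2), of l m] by auto
    have aeq: "a (D * l + m) = complex_of_real (w l) * (sg m * \<alpha> l m / complex_of_real (sincpi (\<tau> l m)))"
      by (simp only: a_def mv)
    have fceq: "fourier_coeff (expo (of_int (D * l + m) + \<theta> (D * l + m))) (D * k + j) = complex_of_real (sincpi (of_int d + \<tau> l m))"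
      by (simp only: fourier_coeff_expo arg)
    show ?thesis
    proof (cases "d = 0")
      case True
      then show ?thesis using s0 d0 unfolding aeq fceq by auto
    next
      case False
      have lt1: "\<bar>\<tau> l m\<bar> < 1" using sol(2)[of l m] by simp
      have "even (m + d - j)" using evenD by (simp add: d_def)
      then have sgs: "sg m * sg d = sg j" by (auto simp: sg_def)
      have "a (D * l + m) * fourier_coeff (expo (of_int (D * l + m) + \<theta> (D * l + m))) (D * k + j) =
         complex_of_real (w l) * (sg m * sg d) * (\<alpha> l m * complex_of_real (kern d (\<tau> l m)))"
        unfolding aeq fceq sincpi_shift[OF False lt1] using s0 by simp
      moreover have "\<not> (l = k \<and> m = j)" using False d0 by blast
      ultimately show ?thesis unfolding sgs d_def[symmetric] by (simp only: if_False mult.assoc)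
    qed
  qed
  have coeff: "fourier_coeff g n = fourier_coeff f n" if "n \<notin> kept" for n
  proof -
    define k j where "k = blk n" and "j = pos n"
    have k: "k \<in> G" and j: "\<bar>j\<bar> \<le> 2" using that by (auto simp: kept_def k_def j_def)
    have n: "n = D * k + j" using blk_pos[of n] by (simp add: k_def j_def)
    define T where "T l = (\<Sum>m\<in>offsets. complex_of_real (w l) * sg j * (if l = k \<and> m = j then \<alpha> l m else \<alpha> l m * complex_of_real (kern (m - (D * (k - l) + j)) (\<tau> l m))))" for l
    have "((\<lambda>i. a i * fourier_coeff (expo (of_int i + \<theta> i)) n) has_sum fourier_coeff g n) moved"
      by (rule has_L2_sum_fourier[OF g(2,1) expo_L2])
    then have "((\<lambda>p. a (case p of (k, m) \<Rightarrow> D * k + m) * fourier_coeff (expo (of_int (case p of (k, m) \<Rightarrow> D * k + m) + \<theta> (case p of (k, m) \<Rightarrow> D * k + m))) n) has_sum fourier_coeff g n) (G \<times> offsets)"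
      using has_sum_reindex_bij_betw[OF moved_bij, of "\<lambda>i. a i * fourier_coeff (expo (of_int i + \<theta> i)) n"] by simp
    then have "(T has_sum fourier_coeff g n) G"
    proof (rule has_sum_SigmaD)
      fix l assume l: "l \<in> G"
      have "T l = (\<Sum>m\<in>offsets. a (D * l + m) * fourier_coeff (expo (of_int (D * l + m) + \<theta> (D * l + m))) n)"
        unfolding T_def n using l j by (intro sum.cong refl) (simp only: summand)
      then show "((\<lambda>m. a (case (l, m) of (k, m) \<Rightarrow> D * k + m) * fourier_coeff (expo (of_int (case (l, m) of (k, m) \<Rightarrow> D * k + m) + \<theta> (case (l, m) of (k, m) \<Rightarrow> D * k + m))) n) has_sum T l) offsets"
        by (simp add: offsets_props has_sum_finiteI)
    qed
    moreover have "(T has_sum (sg j * (complex_of_real (w k) * e k j))) G"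
    proof -
      define Y where "Y = (if j = 0 then 0 else \<alpha> k j) + (\<Sum>m\<in>offsets - {j}. \<alpha> k m * complex_of_real (kern (m - j) (\<tau> k m)))"
      have "T k = complex_of_real (w k) * sg j * Y"
      proof -
        define r where "r m = \<alpha> k m * complex_of_real (kern (m - j) (\<tau> k m))" for m
        have "T k = complex_of_real (w k) * sg j * (\<Sum>m\<in>offsets. if m = j then \<alpha> k m else r m)"
          unfolding T_def sum_distrib_left by (intro sum.cong refl) (simp add: r_def)
        moreover have "(\<Sum>m\<in>offsets. if m = j then \<alpha> k m else r m) = Y"
        proof (cases "j = 0")
          case True
          then have jo: "j \<notin> offsets" by (simp add: offsets_def)
          then have "(\<Sum>m\<in>offsets. if m = j then \<alpha> k m else r m) = (\<Sum>m\<in>offsets. r m)"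
            by (intro sum.cong refl) auto
          then show ?thesis using True jo by (simp add: Y_def r_def)
        next
          case False
          then have jo: "j \<in> offsets" using j by (auto simp: offsets_def)
          have "(\<Sum>m\<in>offsets - {j}. if m = j then \<alpha> k m else r m) = (\<Sum>m\<in>offsets - {j}. r m)"
            by (intro sum.cong refl) auto
          then show ?thesis
            using sum.remove[OF offsets_props(1) jo, of "\<lambda>m. if m = j then \<alpha> k m else r m"] False
            by (simp add: Y_def r_def)
        qed
        ultimately show ?thesis by simp
      qed
      moreover have "(T has_sum (complex_of_real (w k) * sg j * (e k j - Y))) (G - {k})"
      proof -
        have "((\<lambda>l. complex_of_real (w k) * sg j * (complex_of_real (w l / w k) * (\<Sum>m\<in>offsets. \<alpha> l m * complex_of_real (kern (m - (D * (k - l) + j)) (\<tau> l m)))))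
          has_sum (complex_of_real (w k) * sg j * (e k j - Y))) (G - {k})"
          using has_sum_cmult_right[OF sol(3)[OF k j], of "complex_of_real (w k) * sg j"] by (simp only: Y_def diff_diff_add)
        moreover have "complex_of_real (w k) * sg j * (complex_of_real (w l / w k) * (\<Sum>m\<in>offsets. \<alpha> l m * complex_of_real (kern (m - (D * (k - l) + j)) (\<tau> l m)))) = T l"
          if "l \<in> G - {k}" for l
        proof -
          have ww: "complex_of_real (w l) = complex_of_real (w k) * complex_of_real (w l / w k)"
            using w[OF k] by simp
          have "T l = complex_of_real (w l) * sg j * (\<Sum>m\<in>offsets. \<alpha> l m * complex_of_real (kern (m - (D * (k - l) + j)) (\<tau> l m)))"
            unfolding T_def sum_distrib_left by (intro sum.cong refl) (use that in simp)
          then show ?thesis unfolding ww by (simp only: mult_ac)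
        qed
        ultimately show ?thesis by (rule iffD1[OF has_sum_cong, rotated])
      qed
      ultimately have "(T has_sum (complex_of_real (w k) * sg j * Y + complex_of_real (w k) * sg j * (e k j - Y))) ({k} \<union> (G - {k}))"
        by (intro has_sum_Un_disjoint) (auto intro: has_sum_finiteI)
      moreover have "{k} \<union> (G - {k}) = G" using k by auto
      ultimately show ?thesis by (simp add: algebra_simps)
    qed
    ultimately have "fourier_coeff g n = sg j * (complex_of_real (w k) * e k j)" by (rule has_sum_unique)
    then show ?thesis unfolding e_eq[OF k j] by (simp add: n)
  qed
  show ?thesis
    by (intro exI[of _ \<theta>] exI[of _ a] exI[of _ g] conjI allI ballI impI th th0 a_sum g coeff)
qed

text \<open>The sum over the good blocks agrees with \<open>f\<close> on their coefficients, so the difference is a series over the kept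
  integers.\<close>

lemma spectral_representation:
  "\<exists>(\<theta> :: int \<Rightarrow> real) (A :: int \<Rightarrow> complex). (\<forall>n. \<bar>\<theta> n\<bar> \<le> 1/500) \<and>
    (\<lambda>n. (cmod (A n))\<^sup>2) summable_on (UNIV - (\<lambda>k. D * k) ` G) \<and>
    has_L2_sum circ (\<lambda>n t. A n * expo (of_int n + \<theta> n) t) (UNIV - (\<lambda>k. D * k) ` G) f"
proof -
  obtain \<theta> a g where g_all: "\<forall>n. \<bar>\<theta> n\<bar> \<le> 1/500" "\<forall>n\<in>kept. \<theta> n = 0"
    "(\<lambda>n. (cmod (a n))\<^sup>2) summable_on moved" "g \<in> L2 circ"
    "has_L2_sum circ (\<lambda>n t. a n * expo (of_int n + \<theta> n) t) moved g"
    "\<forall>n. n \<notin> kept \<longrightarrow> fourier_coeff g n = fourier_coeff f n"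
    using block_sum_exists by (elim exE conjE)
  note g = g_all[rule_format]
  define h where "h t = f t - g t" for t
  have h: "h \<in> L2 circ" unfolding h_def by (intro L2_diff f g)
  have "fourier_coeff h n = 0" if "n \<notin> kept" for n
    unfolding h_def using f g(4) g(6)[OF that] by (simp add: fourier_coeff_diff)
  then have hs: "has_L2_sum circ (\<lambda>n t. fourier_coeff h n * expo (of_int n) t) kept h"
    by (intro fourier_expansion h) auto
  define A where "A n = (if n \<in> moved then a n else fourier_coeff h n)" for n
  have 1: "has_L2_sum circ (\<lambda>n t. A n * expo (of_int n + \<theta> n) t) moved g"
    using g(5) unfolding has_L2_sum_iff by (simp add: A_def subset_iff cong: sum.cong conj_cong)
  have "A n * expo (of_int n + \<theta> n) t = fourier_coeff h n * expo (of_int n) t" if "n \<in> kept" for n t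
    using that moved_kept(1) g(2) by (auto simp: A_def)
  then have "(\<Sum>n\<in>S. A n * expo (of_int n + \<theta> n) t) = (\<Sum>n\<in>S. fourier_coeff h n * expo (of_int n) t)" if "S \<subseteq> kept" for S t
    using that by (intro sum.cong) auto
  then have 2: "has_L2_sum circ (\<lambda>n t. A n * expo (of_int n + \<theta> n) t) kept h"
    using hs unfolding has_L2_sum_iff by simp
  have "has_L2_sum circ (\<lambda>n t. A n * expo (of_int n + \<theta> n) t) (moved \<union> kept) (\<lambda>t. g t + h t)"
    by (intro has_L2_sum_Un[OF 1 2 moved_kept(1)] L2_scale expo_L2 g h)
  then have "has_L2_sum circ (\<lambda>n t. A n * expo (of_int n + \<theta> n) t) (UNIV - (\<lambda>k. D * k) ` G) f"
    by (simp add: h_def moved_kept(2))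
  moreover have "(\<lambda>n. (cmod (A n))\<^sup>2) summable_on (moved \<union> kept)"
  proof (intro summable_on_Un_disjoint moved_kept(1))
    show "(\<lambda>n. (cmod (A n))\<^sup>2) summable_on moved"
      using g(3) by (rule summable_on_cong[THEN iffD2, rotated]) (simp add: A_def)
    show "(\<lambda>n. (cmod (A n))\<^sup>2) summable_on kept"
      using fourier_coeff_summable[OF h] by (rule summable_on_cong[THEN iffD2, rotated]) (use moved_kept(1) in \<open>auto simp: A_def\<close>)
  qed
  ultimately show ?thesis using g(1) unfolding moved_kept(2) by blast
qed

end

text \<open>Rounding recovers the integer from a perturbed frequency. This turns statements about families indexed by integers into
  statements about the set of frequencies.\<close>

lemma perturbed_frequencies_conclusion:
  fixes \<theta> :: "int \<Rightarrow> real" and A :: "int \<Rightarrow> complex"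
  assumes th: "\<And>n. \<bar>\<theta> n\<bar> \<le> 1/500"
    and A: "(\<lambda>n. (cmod (A n))\<^sup>2) summable_on I"
    and f: "f \<in> L2 circ" "has_L2_sum circ (\<lambda>n t. A n * expo (of_int n + \<theta> n) t) I f"
  defines "\<Lambda> \<equiv> (\<lambda>n. of_int n + \<theta> n) ` I"
  shows "f \<in> L2_closed_span circ expo \<Lambda>"
    and "riesz_basis circ expo \<Lambda> (L2_closed_span circ expo \<Lambda>)"
    and "\<exists>a :: real \<Rightarrow> complex. (\<lambda>l. (cmod (a l))\<^sup>2) summable_on \<Lambda> \<and> has_L2_sum circ (\<lambda>l t. a l * expo l t) \<Lambda> f"
proof -
  define p where "p n = of_int n + \<theta> n" for n :: int
  have rnd: "round (p n) = n" for n
    unfolding p_def by (rule round_unique') (use th[of n] in simp)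
  have inj: "inj_on p S" for S by (rule inj_onI) (metis rnd)
  define a where "a l = A (round l)" for l :: real
  have sum1: "has_L2_sum circ (\<lambda>l t. a l * expo l t) \<Lambda> f"
    unfolding \<Lambda>_def p_def[symmetric]
    by (rule has_L2_sum_reindex[OF _ inj]) (use f(2) in \<open>simp add: a_def rnd p_def[symmetric]\<close>)
  moreover have "(\<lambda>l. (cmod (a l))\<^sup>2) summable_on \<Lambda>"
    unfolding \<Lambda>_def p_def[symmetric] summable_on_reindex[OF inj] using A by (simp add: o_def a_def rnd)
  ultimately show "\<exists>a :: real \<Rightarrow> complex. (\<lambda>l. (cmod (a l))\<^sup>2) summable_on \<Lambda> \<and> has_L2_sum circ (\<lambda>l t. a l * expo l t) \<Lambda> f"
    by blast
  show "f \<in> L2_closed_span circ expo \<Lambda>"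
    unfolding L2_closed_span_def
  proof (intro CollectI conjI f allI impI)
    fix r :: real assume "r > 0"
    then obtain S0 where S0: "finite S0" "S0 \<subseteq> \<Lambda>"
      "\<forall>S. finite S \<longrightarrow> S0 \<subseteq> S \<longrightarrow> S \<subseteq> \<Lambda> \<longrightarrow> L2_norm circ (\<lambda>t. f t - (\<Sum>l\<in>S. a l * expo l t)) < r"
      using has_L2_sumD[OF sum1, of r] by (elim meta_impE exE conjE)
    show "\<exists>S c. finite S \<and> S \<subseteq> \<Lambda> \<and> L2_norm circ (\<lambda>t. f t - (\<Sum>i\<in>S. c i * expo i t)) < r"
      by (intro exI[of _ S0] exI[of _ a] conjI S0(1,2) S0(3)[rule_format]) simp
  qed
  have riesz: "1/4 * (\<Sum>l\<in>S. (cmod (c l))\<^sup>2) \<le> (L2_norm circ (\<lambda>t. \<Sum>l\<in>S. c l * expo l t))\<^sup>2 \<and>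
     (L2_norm circ (\<lambda>t. \<Sum>l\<in>S. c l * expo l t))\<^sup>2 \<le> 9/4 * (\<Sum>l\<in>S. (cmod (c l))\<^sup>2)"
    if S: "finite S" "S \<subseteq> \<Lambda>" for S c
  proof -
    define R where "R = {n \<in> I. p n \<in> S}"
    have R: "R \<subseteq> I" "S = p ` R" using S(2) by (auto simp: R_def \<Lambda>_def p_def)
    have finR: "finite R" using S(1) R(2) inj finite_image_iff by blast
    have th': "\<bar>\<theta> n\<bar> \<le> 1/20" for n using th[of n] by simp
    note bounds = perturbed_exponentials_riesz[where \<theta>=\<theta>, OF finR th', of "\<lambda>n. c (p n)"]
    show ?thesis
      unfolding R(2) sum.reindex[OF inj] o_def
      using bounds unfolding p_def by blast
  qed
  show "riesz_basis circ expo \<Lambda> (L2_closed_span circ expo \<Lambda>)"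
    unfolding riesz_basis_def
    by (intro conjI ballI expo_L2 refl exI[of _ "1/4"] exI[of _ "9/4"] allI impI) (use riesz in auto)
qed

section \<open>Density of thinned and perturbed integers\<close>

lemma sum_int_le_suminf:
  fixes h :: "nat \<Rightarrow> real"
  assumes h: "summable h" "\<And>n. h n \<ge> 0" and F: "finite F"
  shows "(\<Sum>z\<in>F. h (nat \<bar>z :: int\<bar>)) \<le> 2 * suminf h"
proof -
  have part: "(\<Sum>z\<in>P. h (nat \<bar>z\<bar>)) \<le> suminf h" if P: "P \<subseteq> F" "inj_on (\<lambda>z. nat \<bar>z\<bar>) P" for P
  proof -
    have "(\<Sum>z\<in>P. h (nat \<bar>z\<bar>)) = sum h ((\<lambda>z. nat \<bar>z\<bar>) ` P)"
      using P(2) by (simp add: sum.reindex)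
    also have "\<dots> \<le> suminf h"
      using finite_subset[OF P(1) F] h by (intro sum_le_suminf) auto
    finally show ?thesis .
  qed
  have "(\<Sum>z\<in>F. h (nat \<bar>z\<bar>)) = (\<Sum>z\<in>F \<inter> {0..}. h (nat \<bar>z\<bar>)) + (\<Sum>z\<in>F - {0..}. h (nat \<bar>z\<bar>))"
    using sum.Int_Diff[OF F] .
  also have "\<dots> \<le> suminf h + suminf h"
    by (intro add_mono part) (auto simp: inj_on_def)
  finally show ?thesis by simp
qed

text \<open>Whether the endpoints belong to the interval does not matter for its length.\<close>

lemma bounded_interval_ends:
  fixes I :: "real set"
  assumes I: "I \<noteq> {}" "is_interval I" "bounded I"
  defines "a \<equiv> Inf I" and "b \<equiv> Sup I"
  shows "I \<subseteq> {a..b}" "{a<..<b} \<subseteq> I" "measure lborel I = b - a" "a \<le> b"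
proof -
  have bdd: "bdd_below I" "bdd_above I" using I(3) by (auto simp: bounded_imp_bdd_below bounded_imp_bdd_above)
  show sub: "I \<subseteq> {a..b}" using bdd by (auto simp: a_def b_def cInf_lower cSup_upper)
  then show ab: "a \<le> b" using I(1) by force
  show inner: "{a<..<b} \<subseteq> I"
  proof
    fix x assume x: "x \<in> {a<..<b}"
    obtain y where y: "y \<in> I" "y < x" using x cInf_less_iff[OF I(1) bdd(1)] by (auto simp: a_def)
    obtain z where z: "z \<in> I" "x < z" using x less_cSup_iff[OF I(1) bdd(2)] by (auto simp: b_def)
    show "x \<in> I" using I(2) y z unfolding is_interval_1 by (meson less_imp_le)
  qed
  have meas: "I \<in> sets lborel" using I(2) by (simp add: real_interval_borel_measurable)
  have "measure lborel {a<..<b} \<le> measure lborel I"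
    using inner meas sub ab by (intro measure_mono_fmeasurable fmeasurableI)
      (auto intro: le_less_trans[OF emeasure_mono[OF sub]])
  moreover have "measure lborel I \<le> measure lborel {a..b}"
    using sub meas ab by (intro measure_mono_fmeasurable fmeasurableI) auto
  ultimately show "measure lborel I = b - a" using ab by simp
qed

text \<open>An interval of length \<open>L\<close> has at most \<open>L + 3\<close> integers within distance \<open>1\<close>. The centres of the good blocks in the
  interval are missing among them.\<close>

lemma card_frequencies_le:
  fixes \<theta> :: "int \<Rightarrow> real" and G :: "int set" and D :: int and a b :: real
  assumes D: "D \<ge> 2" and th: "\<And>n. \<bar>\<theta> n\<bar> \<le> 1" and ab: "a \<le> b" and I: "I \<subseteq> {a..b}"
  defines "\<Lambda> \<equiv> (\<lambda>n. of_int n + \<theta> n) ` (UNIV - (\<lambda>k. D * k) ` G)"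
  defines "s \<equiv> \<lceil>a / of_int D\<rceil>" and "K \<equiv> nat \<lfloor>(b - a) / of_int D\<rfloor>"
  shows "finite (\<Lambda> \<inter> I)"
    and "real (card (\<Lambda> \<inter> I)) \<le> (b - a) + 3 - real (card (G \<inter> {s..<s + int K}))"
proof -
  define Z where "Z = {\<lceil>a - 1\<rceil>..\<lfloor>b + 1\<rfloor>}"
  define R where "R = (\<lambda>k. D * k) ` (G \<inter> {s..<s + int K})"
  have memZ: "n \<in> Z" if "a - 1 \<le> of_int n" "of_int n \<le> b + 1" for n
    unfolding Z_def atLeastAtMost_iff ceiling_le_iff le_floor_iff using that by blast
  have RZ: "R \<subseteq> Z"
  proof
    fix n assume "n \<in> R"
    then obtain k where kR: "n = D * k" "k \<in> G \<inter> {s..<s + int K}" unfolding R_def by blast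
    then have k: "n = D * k" "k \<in> G" "s \<le> k" "k < s + int K" by auto
    have D0: "real_of_int D > 0" using D by simp
    have "a / of_int D \<le> of_int k" using k(3) by (simp add: s_def ceiling_le_iff)
    then have 1: "a \<le> of_int n" using D0 k(1) by (simp add: field_simps)
    have "int K = \<lfloor>(b - a) / of_int D\<rfloor>" using ab D0 by (simp add: K_def)
    then have "k + 1 \<le> s + \<lfloor>(b - a) / of_int D\<rfloor>" using k(4) by simp
    then have "real_of_int k + 1 \<le> real_of_int s + (b - a) / of_int D"
      using of_int_floor_le[of "(b - a) / real_of_int D"] by linarith
    moreover have "real_of_int s \<le> a / of_int D + 1" unfolding s_def by linarith
    ultimately have "real_of_int k \<le> a / of_int D + (b - a) / of_int D" by linarith
    also have "\<dots> = b / of_int D" by (simp add: add_divide_distrib[symmetric])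
    finally have 2: "of_int n \<le> b" using D0 k(1) by (simp add: field_simps)
    show "n \<in> Z" using 1 2 by (intro memZ) auto
  qed
  have sub: "\<Lambda> \<inter> I \<subseteq> (\<lambda>n. of_int n + \<theta> n) ` (Z - R)"
  proof
    fix x assume "x \<in> \<Lambda> \<inter> I"
    then obtain n where n: "x = of_int n + \<theta> n" "n \<notin> (\<lambda>k. D * k) ` G" "x \<in> {a..b}" using I by (auto simp: \<Lambda>_def)
    have "a - 1 \<le> of_int n" "of_int n \<le> b + 1" using n(1,3) th[of n] by auto
    then have "n \<in> Z" by (rule memZ)
    then show "x \<in> (\<lambda>n. of_int n + \<theta> n) ` (Z - R)" using n by (auto simp: R_def)
  qed
  have fin: "finite (Z - R)" by (simp add: Z_def)
  show "finite (\<Lambda> \<inter> I)" using sub fin finite_surj by blast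
  have "card (\<Lambda> \<inter> I) \<le> card (Z - R)" using surj_card_le[OF fin sub] .
  also have "\<dots> = card Z - card R" using RZ by (intro card_Diff_subset) (auto simp: Z_def intro: finite_subset)
  finally have "real (card (\<Lambda> \<inter> I)) \<le> real (card Z) - real (card R)"
    using card_mono[OF _ RZ] by (simp add: Z_def)
  moreover have "card R = card (G \<inter> {s..<s + int K})"
    unfolding R_def using D by (intro card_image) (auto simp: inj_on_def)
  moreover have "real (card Z) \<le> (b - a) + 3"
  proof -
    have "card Z = nat (\<lfloor>b + 1\<rfloor> - \<lceil>a - 1\<rceil> + 1)" by (simp add: Z_def)
    moreover have "real_of_int \<lfloor>b + 1\<rfloor> \<le> b + 1" "real_of_int \<lceil>a - 1\<rceil> \<ge> a - 1" by linarith+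
    ultimately show ?thesis using ab by linarith
  qed
  ultimately show "real (card (\<Lambda> \<inter> I)) \<le> (b - a) + 3 - real (card (G \<inter> {s..<s + int K}))" by simp
qed

text \<open>An interval whose length is at most of the order of the square root of its distance \<open>r\<close> to the origin. Its term in the series
  that defines long sequences is at most of order \<open>L * r powr (-3/2)\<close>, and there are about \<open>L\<close> integers in the interval.
  Spreading the term over these integers makes the series of disjoint intervals of this kind a part of a convergent one.\<close>

lemma short_interval_contribution:
  fixes I :: "real set" and D :: int
  assumes D: "D \<ge> 2" and I: "I \<noteq> {}" "is_interval I" "bounded I"
  defines "a \<equiv> Inf I" and "b \<equiv> Sup I"
  defines "s \<equiv> \<lceil>a / of_int D\<rceil>" and "K \<equiv> nat \<lfloor>(b - a) / of_int D\<rfloor>"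
  assumes K: "K \<ge> 4" and s: "real_of_int \<bar>s\<bar> > real K ^ 2"
  shows "finite {z. real_of_int z \<in> I}"
    and "(measure lborel I)\<^sup>2 / (1 + (infdist 0 I)\<^sup>2) \<le>
      (\<Sum>z | real_of_int z \<in> I. 4 * of_int D * (1 + 2 * of_int D) powr (3/2) * real (nat \<bar>z\<bar>) powr (-3/2))"
proof -
  note ends = bounded_interval_ends[OF I, folded a_def b_def]
  define L where "L = b - a"
  define r where "r = infdist 0 I"
  define C where "C = 1 + 2 * real_of_int D"
  have D0: "real_of_int D \<ge> 2" using D by simp
  have L0: "L \<ge> 0" using ends(4) by (simp add: L_def)
  have intK: "int K = \<lfloor>L / of_int D\<rfloor>" using L0 D0 by (simp add: K_def L_def)
  have KL: "real K \<le> L / of_int D" "L / of_int D < real K + 1"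
  proof -
    have "real K = of_int \<lfloor>L / of_int D\<rfloor>" using intK by (metis of_int_of_nat_eq)
    then show "real K \<le> L / of_int D" "L / of_int D < real K + 1" by linarith+
  qed
  have K4: "real K \<ge> 4" using K by simp
  have L_le: "L \<le> 2 * of_int D * real K"
  proof -
    have "L < of_int D * (real K + 1)" using KL(2) D0 by (simp add: field_simps)
    also have "\<dots> \<le> of_int D * (2 * real K)" using K4 D0 by (intro mult_left_mono) auto
    finally show ?thesis by simp
  qed
  have L8: "L \<ge> 8"
  proof -
    have "2 * 4 \<le> of_int D * real K" using K4 D0 by (intro mult_mono) auto
    also have "\<dots> \<le> L" using KL(1) D0 by (simp add: field_simps)
    finally show ?thesis by simp
  qed
  have near: "\<bar>x\<bar> \<le> r + L" if x: "x \<in> {a..b}" for x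
  proof -
    have "\<bar>x\<bar> - L \<le> infdist 0 I"
      unfolding infdist_notempty[OF I(1)]
    proof (rule cINF_greatest[OF I(1)])
      fix y assume "y \<in> I"
      then have "y \<in> {a..b}" using ends(1) by blast
      then have "\<bar>x - y\<bar> \<le> L" using x by (auto simp: L_def)
      then show "\<bar>x\<bar> - L \<le> dist 0 y" by (simp add: dist_real_def)
    qed
    then show ?thesis by (simp add: r_def)
  qed
  have rK: "real K ^ 2 \<le> r"
  proof -
    have "\<bar>real_of_int s\<bar> \<le> \<bar>a\<bar> / of_int D + 1"
    proof -
      have "a / of_int D \<le> of_int s" "of_int s < a / of_int D + 1" unfolding s_def by linarith+
      then have "\<bar>real_of_int s\<bar> \<le> \<bar>a / of_int D\<bar> + 1" by linarith
      then show ?thesis using D0 by (simp add: abs_divide)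
    qed
    also have "\<dots> \<le> (r + L) / of_int D + 1"
      using near[of a] ends(4) D0 by (intro add_right_mono divide_right_mono) auto
    finally have "real K ^ 2 < r / of_int D + (real K + 2)"
      using s KL(2) by (simp add: add_divide_distrib)
    moreover have "r / of_int D \<le> r / 2"
      using D0 infdist_nonneg[of 0 I] by (intro divide_left_mono) (auto simp: r_def)
    moreover have "4 * real K \<le> real K ^ 2" using K4 by (simp add: power2_eq_square)
    ultimately show ?thesis using K4 by linarith
  qed
  have r16: "r \<ge> 16" using rK power_mono[OF K4, of 2] by simp
  have Kr: "real K \<le> r powr (1/2)"
  proof -
    have "real K = sqrt (real K ^ 2)" by simp
    also have "\<dots> \<le> sqrt r" using rK by (rule real_sqrt_le_mono)
    finally show ?thesis using r16 by (simp add: powr_half_sqrt)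
  qed
  have point: "2 * L / (1 + r\<^sup>2) \<le> 4 * of_int D * C powr (3/2) * real (nat \<bar>z\<bar>) powr (-3/2)" if z: "real_of_int z \<in> I" for z
  proof -
    define x where "x = \<bar>real_of_int z\<bar>"
    have xr: "r \<le> x" using infdist_le[OF z, of 0] by (simp add: r_def x_def dist_real_def)
    have "real K \<le> real K ^ 2" using K4 by (simp add: power2_eq_square)
    then have "L \<le> 2 * of_int D * r" using L_le rK D0
      by (meson mult_left_mono order_trans mult_nonneg_nonneg zero_le_numeral order.trans)
    then have "x \<le> C * r" using near[of "real_of_int z"] z ends(1) by (auto simp: x_def C_def algebra_simps)
    then have xC: "x / C \<le> r" using D0 by (simp add: C_def field_simps)
    have x0: "x > 0" "C > 0" using xr r16 D0 by (auto simp: C_def)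
    have "2 * L / (1 + r\<^sup>2) \<le> 4 * of_int D * real K / r\<^sup>2"
      using L_le r16 D0 L0 by (intro frac_le) auto
    also have "\<dots> \<le> 4 * of_int D * r powr (1/2) / r powr 2"
      using Kr D0 r16 by (simp add: powr_numeral divide_right_mono mult_left_mono)
    also have "\<dots> = 4 * of_int D * r powr (-3/2)"
      unfolding times_divide_eq_right[symmetric] powr_diff[symmetric] by simp
    also have "\<dots> \<le> 4 * of_int D * (x / C) powr (-3/2)"
      using xC x0 D0 by (intro mult_left_mono powr_mono2') auto
    also have "(x / C) powr (-3/2) = C powr (3/2) * x powr (-3/2)"
      using x0 by (simp add: powr_divide powr_minus field_simps)
    also have "x = real (nat \<bar>z\<bar>)" by (simp add: x_def)
    finally show ?thesis by (simp add: mult.assoc)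
  qed
  define Z where "Z = {z. real_of_int z \<in> I}"
  have "Z \<subseteq> {\<lceil>a\<rceil>..\<lfloor>b\<rfloor>}" using ends(1) by (auto simp: Z_def ceiling_le_iff le_floor_iff)
  then show fin: "finite {z. real_of_int z \<in> I}" using finite_subset by (auto simp: Z_def)
  have card: "L \<le> 2 * real (card Z)"
  proof -
    have "{\<lfloor>a\<rfloor> + 1..\<lceil>b\<rceil> - 1} \<subseteq> Z"
    proof
      fix z assume "z \<in> {\<lfloor>a\<rfloor> + 1..\<lceil>b\<rceil> - 1}"
      then have "a < of_int z" "of_int z < b" by (auto simp: floor_less_iff less_ceiling_iff) linarith+
      then show "z \<in> Z" using ends(2) by (auto simp: Z_def)
    qed
    then have "card {\<lfloor>a\<rfloor> + 1..\<lceil>b\<rceil> - 1} \<le> card Z" using fin by (intro card_mono) (auto simp: Z_def)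
    then have "nat (\<lceil>b\<rceil> - \<lfloor>a\<rfloor> - 1) \<le> card Z" by simp
    moreover have "real_of_int \<lceil>b\<rceil> \<ge> b" "real_of_int \<lfloor>a\<rfloor> \<le> a" by linarith+
    ultimately have "L - 1 \<le> real (card Z)" by (simp add: L_def) linarith
    then show ?thesis using L8 by linarith
  qed
  have "(measure lborel I)\<^sup>2 / (1 + (infdist 0 I)\<^sup>2) = L * (L / (1 + r\<^sup>2))"
    unfolding ends(3) by (simp add: L_def r_def power2_eq_square)
  also have "\<dots> \<le> 2 * real (card Z) * (L / (1 + r\<^sup>2))"
    using card L0 by (intro mult_right_mono) auto
  also have "\<dots> = (\<Sum>z\<in>Z. 2 * L / (1 + r\<^sup>2))" by simp
  also have "\<dots> \<le> (\<Sum>z\<in>Z. 4 * of_int D * C powr (3/2) * real (nat \<bar>z\<bar>) powr (-3/2))"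
    by (intro sum_mono point) (simp add: Z_def)
  finally show "(measure lborel I)\<^sup>2 / (1 + (infdist 0 I)\<^sup>2) \<le>
      (\<Sum>z | real_of_int z \<in> I. 4 * of_int D * (1 + 2 * of_int D) powr (3/2) * real (nat \<bar>z\<bar>) powr (-3/2))"
    by (simp add: Z_def C_def)
qed

text \<open>Positive frequency in all windows except those that are short compared with their distance to the origin. A random
  set has arbitrarily long gaps, so that some windows have to be excepted; intervals shorter than the square root of
  their distance contribute a convergent series to the condition on long sequences.\<close>

abbreviation frequent :: "real \<Rightarrow> int set \<Rightarrow> bool"
  where "frequent p G \<equiv> \<exists>K0. \<forall>K\<ge>K0. \<forall>s. real_of_int \<bar>s\<bar> \<le> real K ^ 2 \<longrightarrow>
     p * real K \<le> real (card (G \<inter> {s..<s + int K}))"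

text \<open>In windows of length at least the square root of their distance to the origin the missing centres reduce the number of
  frequencies below \<open>1 - p / (2 * D)\<close> per unit length. A sequence of longer and longer intervals with more frequencies
  consists eventually of intervals in shorter windows, and those do not form a long sequence.\<close>

lemma BM_density_le:
  fixes \<theta> :: "int \<Rightarrow> real" and G :: "int set" and D :: int and p :: real
  assumes D: "D \<ge> 2" and th: "\<And>n. \<bar>\<theta> n\<bar> \<le> 1" and p: "0 < p" "p \<le> 1"
    and freq: "frequent p G"
  shows "BM_density ((\<lambda>n. of_int n + \<theta> n) ` (UNIV - (\<lambda>k. D * k) ` G)) \<le> ereal (1 - p / (2 * of_int D))"
  unfolding BM_density_def
proof (rule Sup_least, clarify)
  obtain K0 where win_all: "\<forall>K\<ge>K0. \<forall>s. real_of_int \<bar>s\<bar> \<le> real K ^ 2 \<longrightarrow> p * real K \<le> real (card (G \<inter> {s..<s + int K}))"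
    using freq by (elim exE)
  note win = win_all[rule_format]
  define \<Lambda> where "\<Lambda> = (\<lambda>n. of_int n + \<theta> n) ` (UNIV - (\<lambda>k. D * k) ` G)"
  fix d :: real and I
  assume I: "long_intervals I"
    and many: "\<forall>n. infinite ((\<lambda>n. of_int n + \<theta> n) ` (UNIV - (\<lambda>k. D * k) ` G) \<inter> I n) \<or>
      d * measure lborel (I n) < real (card ((\<lambda>n. of_int n + \<theta> n) ` (UNIV - (\<lambda>k. D * k) ` G) \<inter> I n))"
  show "ereal d \<le> ereal (1 - p / (2 * of_int D))"
  proof (rule ccontr)
    assume "\<not> ereal d \<le> ereal (1 - p / (2 * of_int D))"
    then have d: "d > 1 - p / (2 * of_int D)" by simp
    have D0: "real_of_int D \<ge> 2" using D by simp
    have II: "I n \<noteq> {}" "is_interval (I n)" "bounded (I n)" for n using I by (auto simp: long_intervals_def)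
    have disj: "disjoint_family I" using I by (simp add: long_intervals_def)
    define a b where "a n = Inf (I n)" and "b n = Sup (I n)" for n
    define s where "s n = \<lceil>a n / of_int D\<rceil>" for n
    define K where "K n = nat \<lfloor>(b n - a n) / of_int D\<rfloor>" for n
    note ends = bounded_interval_ends[OF II, folded a_def b_def]
    \<comment> \<open>The first bound absorbs the additive constants in the count, the second one makes the window longer than \<open>K0 + 4\<close>.\<close>
    define L0 where "L0 = max (8 * of_int D / p) (of_int D * (real K0 + 4))"
    have "\<forall>\<^sub>F n in sequentially. measure lborel (I n) \<ge> L0"
      using I by (simp add: long_intervals_def filterlim_at_top)
    then obtain N where N: "\<And>n. n \<ge> N \<Longrightarrow> b n - a n \<ge> L0"
      unfolding eventually_sequentially ends(3) by blast
    have far: "K n \<ge> 4 \<and> real_of_int \<bar>s n\<bar> > real (K n) ^ 2" if n: "n \<ge> N" for n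
    proof -
      have L: "b n - a n \<ge> 8 * of_int D / p" "b n - a n \<ge> of_int D * (real K0 + 4)"
        using N[OF n] by (auto simp: L0_def)
      have "real K0 + 4 \<le> (b n - a n) / of_int D" using L(2) D0 by (simp add: field_simps)
      then have "int (K0 + 4) \<le> \<lfloor>(b n - a n) / of_int D\<rfloor>" by (simp add: le_floor_iff)
      then have KK: "K n \<ge> K0 + 4" by (simp add: K_def le_nat_iff)
      have "\<not> real_of_int \<bar>s n\<bar> \<le> real (K n) ^ 2"
      proof
        assume "real_of_int \<bar>s n\<bar> \<le> real (K n) ^ 2"
        then have good: "p * real (K n) \<le> real (card (G \<inter> {s n..<s n + int (K n)}))"
          using KK by (intro win) auto
        note cf = card_frequencies_le[where G=G and \<theta>=\<theta>, OF D th ends(4)[of n] ends(1)[of n], folded s_def K_def \<Lambda>_def]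
        have "finite (\<Lambda> \<inter> I n)" by (rule cf(1))
        then have "d * (b n - a n) < real (card (\<Lambda> \<inter> I n))"
          using many unfolding \<Lambda>_def[symmetric] ends(3) by blast
        also have "\<dots> \<le> (b n - a n) + 3 - p * real (K n)" using cf(2) good by linarith
        also have "\<dots> \<le> (b n - a n) + 3 - p * ((b n - a n) / of_int D - 1)"
        proof -
          have "(b n - a n) / of_int D - 1 \<le> real_of_int \<lfloor>(b n - a n) / of_int D\<rfloor>" by linarith
          also have "\<dots> \<le> real (K n)" by (simp add: K_def)
          finally show ?thesis using p by (simp add: mult_left_mono)
        qed
        also have "\<dots> \<le> (1 - p / (2 * of_int D)) * (b n - a n)"
        proof -
          have four: "4 \<le> p / (2 * of_int D) * (b n - a n)"
            using L(1) p D0 by (simp add: field_simps)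
          have e1: "p * ((b n - a n) / of_int D - 1) = 2 * (p / (2 * of_int D) * (b n - a n)) - p"
            using D0 by (simp add: field_simps)
          have e2: "(1 - p / (2 * of_int D)) * (b n - a n) = (b n - a n) - p / (2 * of_int D) * (b n - a n)"
            by (simp only: left_diff_distrib mult_1)
          have "X + 3 - (2 * Y - p) \<le> X - Y" if "4 \<le> Y" for X Y :: real using that p by linarith
          then show ?thesis unfolding e1 e2 using four by blast
        qed
        also have "\<dots> \<le> d * (b n - a n)" using d ends(4)[of n] by (intro mult_right_mono) auto
        finally show False by simp
      qed
      then show ?thesis using KK by auto
    qed
    define h where "h m = real m powr (-3/2)" for m :: nat
    have h: "summable h" "\<And>m. h m \<ge> 0" unfolding h_def by (simp_all add: summable_real_powr_iff)
    define C where "C = 4 * real_of_int D * (1 + 2 * of_int D) powr (3/2)"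
    have C: "C \<ge> 0" using D0 by (simp add: C_def)
    define f where "f n = (measure lborel (I n))\<^sup>2 / (1 + (infdist 0 (I n))\<^sup>2)" for n
    define Z where "Z n = {z. real_of_int z \<in> I n}" for n
    have fZ: "finite (Z n)" "f n \<le> (\<Sum>z\<in>Z n. C * h (nat \<bar>z\<bar>))" if n: "n \<ge> N" for n
      using short_interval_contribution[OF D II, of n, folded a_def b_def, folded s_def K_def] far[OF n]
      by (auto simp: Z_def f_def C_def h_def)
    have "summable (\<lambda>n. f (n + N))"
    proof (rule summableI_nonneg_bounded)
      show "0 \<le> f (n + N)" for n by (simp add: f_def)
      fix m
      have "(\<Sum>n<m. f (n + N)) \<le> (\<Sum>n<m. \<Sum>z\<in>Z (n + N). C * h (nat \<bar>z\<bar>))"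
        by (intro sum_mono fZ) simp
      also have "\<dots> = (\<Sum>z\<in>(\<Union>n<m. Z (n + N)). C * h (nat \<bar>z\<bar>))"
      proof (rule sum.UNION_disjoint[symmetric])
        show "\<forall>i\<in>{..<m}. \<forall>j\<in>{..<m}. i \<noteq> j \<longrightarrow> Z (i + N) \<inter> Z (j + N) = {}"
        proof (intro ballI impI)
          fix i j :: nat assume "i \<noteq> j"
          then have "I (i + N) \<inter> I (j + N) = {}" using disjoint_family_onD[OF disj, of "i + N" "j + N"] by simp
          then show "Z (i + N) \<inter> Z (j + N) = {}" by (auto simp: Z_def)
        qed
      qed (use fZ(1) in auto)
      also have "\<dots> = C * (\<Sum>z\<in>(\<Union>n<m. Z (n + N)). h (nat \<bar>z\<bar>))" by (simp add: sum_distrib_left)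
      also have "\<dots> \<le> C * (2 * suminf h)"
        using fZ(1) C by (intro mult_left_mono sum_int_le_suminf h) auto
      finally show "(\<Sum>n<m. f (n + N)) \<le> C * (2 * suminf h)" .
    qed
    then have "summable f" by (simp add: summable_iff_shift)
    then show False using I by (simp add: long_intervals_def f_def[abs_def])
  qed
qed

section \<open>The weight\<close>

locale admissible_weight =
  fixes \<omega> :: "real \<Rightarrow> real" and \<delta> :: real
  assumes mono: "antimono_on {0..} \<omega>"
    and \<delta>: "\<delta> > 0"
    and lower: "\<And>x. x \<ge> 1 \<Longrightarrow> x * \<omega> x \<ge> \<delta>"
    and doubling: "\<And>x. x \<ge> 1 \<Longrightarrow> \<omega> (2 * x) \<ge> \<delta> * \<omega> x"
begin

lemma decreasing: "0 \<le> x \<Longrightarrow> x \<le> y \<Longrightarrow> \<omega> y \<le> \<omega> x"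
  using mono by (auto simp: monotone_on_def)

lemma positive:
  assumes "x \<ge> 0"
  shows "\<omega> x > 0"
proof -
  have "max 1 x * \<omega> (max 1 x) > 0" using lower[of "max 1 x"] \<delta> by linarith
  then have "\<omega> (max 1 x) > 0" by (simp add: zero_less_mult_iff)
  then show ?thesis using decreasing[OF assms, of "max 1 x"] by simp
qed

lemma comparable:
  assumes "r \<ge> 2" "r / 2 \<le> x" "x \<le> 2 * r"
  shows "\<delta> * \<omega> r \<le> \<omega> x" "\<omega> x \<le> \<omega> r / \<delta>"
proof -
  show "\<delta> * \<omega> r \<le> \<omega> x"
    using doubling[of r] decreasing[of x "2 * r"] assms by simp
  have "\<omega> x \<le> \<omega> (r / 2)" using assms by (intro decreasing) auto
  also have "\<dots> \<le> \<omega> r / \<delta>" using doubling[of "r / 2"] assms \<delta> by (simp add: field_simps)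
  finally show "\<omega> x \<le> \<omega> r / \<delta>" .
qed

text \<open>For blocks with \<open>2 * \<bar>l\<bar> \<ge> \<bar>k\<bar>\<close> the weight is at most a constant times that of the block \<open>k\<close>, by the
  doubling condition, and the inverse squares of the distances sum to \<open>O (1 / D\<^sup>2)\<close>. The other blocks number at most
  \<open>2 * \<bar>k\<bar>\<close>, their distance to the block \<open>k\<close> is of order \<open>D * \<bar>k\<bar>\<close> and their weight is at most \<open>\<omega> 0\<close>, which
  exceeds the weight of the block \<open>k\<close> at most by a factor of order \<open>D * \<bar>k\<bar>\<close>; together they contribute \<open>O (1 / D)\<close>.\<close>

lemma weak_coupling:
  "\<exists>D0. \<forall>D\<ge>D0. \<forall>k F. k \<noteq> 0 \<longrightarrow> finite F \<longrightarrow> F \<subseteq> UNIV - {0, k} \<longrightarrow>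
     (\<Sum>l\<in>F. \<omega> (of_int \<bar>D * l\<bar>) / \<omega> (of_int \<bar>D * k\<bar>) / (of_int (D * (k - l)))\<^sup>2) \<le> 1/1000"
proof -
  define h where "h n = 1 / (real n)\<^sup>2" for n :: nat
  have h: "summable h" "\<And>n. h n \<ge> 0"
    using inverse_power_summable[of 2, where ?'a=real] by (simp_all add: h_def[abs_def] inverse_eq_divide power_one_over)
  define S where "S = 2 * suminf h"
  have S0: "S \<ge> 0" unfolding S_def using h by (simp add: suminf_nonneg)
  have w0: "\<omega> 0 > 0" by (simp add: positive)
  define D0 where "D0 = max 2 \<lceil>1000 * ((S + 8 * \<omega> 0) / \<delta>)\<rceil>"
  have "(\<Sum>l\<in>F. \<omega> (of_int \<bar>D * l\<bar>) / \<omega> (of_int \<bar>D * k\<bar>) / (of_int (D * (k - l)))\<^sup>2) \<le> 1/1000"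
    if D: "D \<ge> D0" and k: "k \<noteq> 0" and F: "finite F" "F \<subseteq> UNIV - {0, k}" for D k :: int and F
  proof -
    have D2: "D \<ge> 2" and D1000: "real_of_int D \<ge> 1000 * ((S + 8 * \<omega> 0) / \<delta>)"
      using D by (auto simp: D0_def ceiling_le_iff)
    define d where "d = real_of_int D"
    define r where "r = real_of_int \<bar>k\<bar>"
    have d2: "d \<ge> 2" and r1: "r \<ge> 1" using D2 k by (auto simp: d_def r_def)
    have wk: "\<omega> (d * r) > 0" using d2 r1 by (intro positive) auto
    have abs: "real_of_int \<bar>D * l\<bar> = d * \<bar>real_of_int l\<bar>" for l using D2 by (simp add: d_def abs_mult)
    define g where "g l = 1 / \<delta> * (1 / d\<^sup>2) * h (nat \<bar>k - l\<bar>) + (if 2 * \<bar>l\<bar> < \<bar>k\<bar> then 4 * \<omega> 0 / (\<delta> * d * r) else 0)" for l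
    have hkl: "h (nat \<bar>k - l\<bar>) = 1 / (of_int (k - l))\<^sup>2" for l
      by (simp add: h_def)
    have term_le: "\<omega> (of_int \<bar>D * l\<bar>) / \<omega> (of_int \<bar>D * k\<bar>) / (of_int (D * (k - l)))\<^sup>2 \<le> g l"
      if l: "l \<in> F" for l
    proof (cases "2 * \<bar>l\<bar> < \<bar>k\<bar>")
      case False
      define x where "x = \<bar>real_of_int l\<bar>"
      have x: "r / 2 \<le> x" using False unfolding x_def r_def by linarith
      have "\<omega> (d * x) \<le> \<omega> (d * r) / \<delta>"
      proof (cases "d * x \<le> 2 * (d * r)")
        case True
        have "d * r / 2 \<le> d * x" using x d2 by simp
        moreover have "2 * 1 \<le> d * r" using d2 r1 by (intro mult_mono) auto
        ultimately show ?thesis using True by (intro comparable) auto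
      next
        case False
        have "\<omega> (d * x) \<le> \<omega> (2 * (d * r))" using False d2 r1 by (intro decreasing) auto
        moreover have "\<omega> (2 * (d * r)) \<le> \<omega> (d * r) / \<delta>"
          using mult_mono[of 2 d 1 r] d2 r1 by (intro comparable) auto
        ultimately show ?thesis by simp
      qed
      then have "\<omega> (d * x) / \<omega> (d * r) \<le> 1 / \<delta>" using wk \<delta> by (simp add: field_simps)
      then have "\<omega> (d * x) / \<omega> (d * r) / (of_int (D * (k - l)))\<^sup>2 \<le> 1 / \<delta> / (of_int (D * (k - l)))\<^sup>2"
        by (intro divide_right_mono) auto
      also have "\<dots> = 1 / \<delta> * (1 / d\<^sup>2) * h (nat \<bar>k - l\<bar>)"
        unfolding hkl by (simp add: d_def power_mult_distrib)
      finally show ?thesis using False unfolding g_def abs x_def r_def by simp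
    next
      case True
      have kl: "2 * \<bar>real_of_int (k - l)\<bar> \<ge> r"
      proof -
        have "\<bar>k\<bar> \<le> \<bar>k - l\<bar> + \<bar>l\<bar>" using abs_triangle_ineq[of "k - l" l] by simp
        moreover have "x \<le> 2 * y" if "x \<le> y + z" "2 * z < x" for x y z :: int using that by linarith
        ultimately have "\<bar>k\<bar> \<le> 2 * \<bar>k - l\<bar>" using True by blast
        then have "real_of_int \<bar>k\<bar> \<le> real_of_int (2 * \<bar>k - l\<bar>)" by (simp only: of_int_le_iff)
        then show ?thesis by (simp add: r_def)
      qed
      have "\<omega> (d * \<bar>real_of_int l\<bar>) \<le> \<omega> 0" using d2 by (intro decreasing) auto
      moreover have "d * r \<ge> 1" using mult_mono[of 1 d 1 r] d2 r1 by auto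
      then have dr: "\<omega> (d * r) \<ge> \<delta> / (d * r)" using lower[of "d * r"] by (simp add: field_simps)
      have dr0: "\<delta> / (d * r) > 0" using \<delta> d2 r1 by simp
      ultimately have 1: "\<omega> (d * \<bar>real_of_int l\<bar>) / \<omega> (d * r) \<le> \<omega> 0 / (\<delta> / (d * r))"
        using w0 dr by (intro frac_le) auto
      have "(d * r / 2)\<^sup>2 \<le> \<bar>real_of_int (D * (k - l))\<bar>\<^sup>2"
        using kl d2 r1 by (intro power_mono) (auto simp: d_def[symmetric] abs_mult)
      then have 2: "(d * r / 2)\<^sup>2 \<le> (real_of_int (D * (k - l)))\<^sup>2" by simp
      have "\<omega> (d * \<bar>real_of_int l\<bar>) / \<omega> (d * r) / (of_int (D * (k - l)))\<^sup>2 \<le> (\<omega> 0 / (\<delta> / (d * r))) / (d * r / 2)\<^sup>2"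
      proof (rule frac_le[OF _ 1 _ 2])
        show "0 \<le> \<omega> 0 / (\<delta> / (d * r))" using w0 dr0 by (intro divide_nonneg_pos) simp_all
        show "0 < (d * r / 2)\<^sup>2" using d2 r1 by simp
      qed
      also have "\<dots> = 4 * \<omega> 0 / (\<delta> * d * r)" using \<delta> d2 r1 by (simp add: field_simps power2_eq_square)
      also have "\<dots> \<le> g l" using True h(2) \<delta> d2 by (simp add: g_def)
      finally show ?thesis unfolding abs r_def by simp
    qed
    have "(\<Sum>l\<in>F. \<omega> (of_int \<bar>D * l\<bar>) / \<omega> (of_int \<bar>D * k\<bar>) / (of_int (D * (k - l)))\<^sup>2) \<le> (\<Sum>l\<in>F. g l)"
      by (rule sum_mono[OF term_le])
    also have "\<dots> = 1 / \<delta> * (1 / d\<^sup>2) * (\<Sum>l\<in>F. h (nat \<bar>k - l\<bar>)) +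
        real (card (F \<inter> {l. 2 * \<bar>l\<bar> < \<bar>k\<bar>})) * (4 * \<omega> 0 / (\<delta> * d * r))"
      unfolding g_def sum.distrib sum_distrib_left[symmetric] using F(1) by (simp add: sum.If_cases)
    also have "\<dots> \<le> 1 / \<delta> * (1 / d\<^sup>2) * S + (2 * r) * (4 * \<omega> 0 / (\<delta> * d * r))"
    proof (intro add_mono mult_left_mono mult_right_mono)
      have "(\<Sum>l\<in>F. h (nat \<bar>k - l\<bar>)) = (\<Sum>z\<in>(\<lambda>l. k - l) ` F. h (nat \<bar>z\<bar>))"
        by (subst sum.reindex) (auto simp: inj_on_def)
      also have "\<dots> \<le> S" unfolding S_def using F(1) by (intro sum_int_le_suminf h) auto
      finally show "(\<Sum>l\<in>F. h (nat \<bar>k - l\<bar>)) \<le> S" .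
      have "card (F \<inter> {l. 2 * \<bar>l\<bar> < \<bar>k\<bar>}) \<le> card {-\<bar>k\<bar><..<\<bar>k\<bar>}" by (intro card_mono) auto
      also have "\<dots> \<le> nat (2 * \<bar>k\<bar>)" by simp
      finally show "real (card (F \<inter> {l. 2 * \<bar>l\<bar> < \<bar>k\<bar>})) \<le> 2 * r" by (simp add: r_def)
    qed (use \<delta> w0 d2 r1 in auto)
    also have "\<dots> = (S / d + 8 * \<omega> 0) / \<delta> / d"
      using \<delta> d2 r1 by (simp add: field_simps power2_eq_square)
    also have "\<dots> \<le> ((S + 8 * \<omega> 0) / \<delta>) / d"
      using \<delta> d2 S0 mult_left_mono[of 1 d S] by (intro divide_right_mono add_right_mono) (auto simp: field_simps)
    also have "\<dots> \<le> 1/1000"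
    proof -
      have "t / d \<le> 1/1000" if "d \<ge> 1000 * t" for t using that d2 by (simp add: pos_divide_le_eq)
      then show ?thesis using D1000 unfolding d_def[symmetric] by blast
    qed
    finally show ?thesis .
  qed
  then show ?thesis by blast
qed

text \<open>Comparison of the series with the integral of the decreasing function \<open>\<omega>\<^sup>2\<close>.\<close>

lemma nat_square_summable:
  assumes "\<omega> \<in> L2 (lebesgue_on {0..})"
  shows "summable (\<lambda>n. (\<omega> (real n))\<^sup>2)"
proof -
  define A where "A n = {real n<..real (Suc n)}" for n
  have disj: "disjoint_family A"
    unfolding A_def disjoint_family_on_def by (auto simp: not_le)
  have "(\<Sum>n. ennreal ((\<omega> (real (Suc n)))\<^sup>2)) = (\<Sum>n. \<integral>\<^sup>+x. ennreal ((\<omega> (real (Suc n)))\<^sup>2) * indicator (A n) x \<partial>lebesgue_on {0..})"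
  proof (rule suminf_cong)
    fix n
    have "A n \<in> sets (lebesgue_on {0..})" by (auto simp: A_def sets_restrict_space_iff)
    moreover have "emeasure (lebesgue_on {0..}) (A n) = emeasure lebesgue (A n)"
      by (rule emeasure_restrict_space) (auto simp: A_def)
    moreover have "emeasure lebesgue (A n) = 1" by (simp add: A_def)
    ultimately show "ennreal ((\<omega> (real (Suc n)))\<^sup>2) = (\<integral>\<^sup>+x. ennreal ((\<omega> (real (Suc n)))\<^sup>2) * indicator (A n) x \<partial>lebesgue_on {0..})"
      by (subst nn_integral_cmult_indicator) simp_all
  qed
  also have "\<dots> \<le> (\<Sum>n. \<integral>\<^sup>+x. ennreal ((\<omega> x)\<^sup>2) * indicator (A n) x \<partial>lebesgue_on {0..})"
  proof (intro suminf_le nn_integral_mono)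
    fix n x
    show "ennreal ((\<omega> (real (Suc n)))\<^sup>2) * indicator (A n) x \<le> ennreal ((\<omega> x)\<^sup>2) * indicator (A n) x"
    proof (cases "x \<in> A n")
      case True
      then have "\<omega> (real (Suc n)) \<le> \<omega> x" "\<omega> (real (Suc n)) > 0"
        by (auto intro!: decreasing positive simp: A_def)
      then show ?thesis using True by (auto intro!: ennreal_leI power_mono)
    qed auto
  qed auto
  also have "\<dots> = (\<integral>\<^sup>+x. (\<Sum>n. ennreal ((\<omega> x)\<^sup>2) * indicator (A n) x) \<partial>lebesgue_on {0..})"
  proof (rule nn_integral_suminf[symmetric])
    fix n
    have "\<omega> \<in> borel_measurable (lebesgue_on {0..})" using assms by (simp add: L2_def)
    moreover have "A n \<in> sets (lebesgue_on {0..})" by (auto simp: A_def sets_restrict_space_iff)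
    ultimately show "(\<lambda>x. ennreal ((\<omega> x)\<^sup>2) * indicator (A n) x) \<in> borel_measurable (lebesgue_on {0..})"
      by measurable
  qed
  also have "\<dots> \<le> (\<integral>\<^sup>+x. ennreal ((\<omega> x)\<^sup>2) \<partial>lebesgue_on {0..})"
  proof (intro nn_integral_mono)
    fix x
    have "(\<Sum>n. ennreal ((\<omega> x)\<^sup>2) * indicator (A n) x) = ennreal ((\<omega> x)\<^sup>2) * indicator (\<Union>n. A n) x"
      by (simp add: ennreal_suminf_cmult suminf_indicator[OF disj])
    also have "\<dots> \<le> ennreal ((\<omega> x)\<^sup>2)" by (simp add: indicator_def)
    finally show "(\<Sum>n. ennreal ((\<omega> x)\<^sup>2) * indicator (A n) x) \<le> ennreal ((\<omega> x)\<^sup>2)" .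
  qed
  also have "\<dots> < \<infinity>"
    using assms by (subst nn_integral_eq_integral) (auto simp: L2_def)
  finally have "summable (\<lambda>n. (\<omega> (real (Suc n)))\<^sup>2)"
    by (intro summable_suminf_not_top) (auto simp: less_top)
  then show ?thesis by (subst (asm) summable_Suc_iff)
qed

end

section \<open>Frequent Gaussian events\<close>

text \<open>The density is smallest at the largest distance from the mean that occurs in the interval.\<close>

lemma gaussian_interval_prob:
  assumes "prob_space M" "distributed M lborel X (\<lambda>x. ennreal (normal_density 0 \<sigma> x))"
    and "\<sigma> > 0" "\<rho> > 0" "\<bar>c\<bar> \<le> R"
  shows "measure M (X -` {c - \<rho>..c + \<rho>} \<inter> space M) \<ge> 2 * \<rho> * normal_density 0 \<sigma> (R + \<rho>)"
proof -
  interpret prob_space M by fact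
  have "ennreal (2 * \<rho> * normal_density 0 \<sigma> (R + \<rho>)) = (\<integral>\<^sup>+x. ennreal (normal_density 0 \<sigma> (R + \<rho>)) * indicator {c - \<rho>..c + \<rho>} x \<partial>lborel)"
    using assms(4) by (simp add: nn_integral_cmult_indicator mult.commute flip: ennreal_mult)
  also have "\<dots> \<le> (\<integral>\<^sup>+x. ennreal (normal_density 0 \<sigma> x) * indicator {c - \<rho>..c + \<rho>} x \<partial>lborel)"
  proof (intro nn_integral_mono)
    fix x
    show "ennreal (normal_density 0 \<sigma> (R + \<rho>)) * indicator {c - \<rho>..c + \<rho>} x \<le> ennreal (normal_density 0 \<sigma> x) * indicator {c - \<rho>..c + \<rho>} x"
    proof (cases "x \<in> {c - \<rho>..c + \<rho>}")
      case True
      then have "\<bar>x\<bar> \<le> R + \<rho>" using assms(5) by auto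
      then have "x\<^sup>2 \<le> (R + \<rho>)\<^sup>2" using abs_le_square_iff[of x "R + \<rho>"] by linarith
      then have "normal_density 0 \<sigma> (R + \<rho>) \<le> normal_density 0 \<sigma> x"
        using assms(3) by (auto simp: normal_density_def intro!: divide_right_mono)
      then show ?thesis using True by (simp add: ennreal_leI)
    qed simp
  qed
  also have "\<dots> = emeasure M (X -` {c - \<rho>..c + \<rho>} \<inter> space M)"
    by (rule distributed_emeasure[OF assms(2), symmetric]) simp
  finally show ?thesis by (simp add: emeasure_eq_measure)
qed

text \<open>A square in place of a disc, so that the independence of real and imaginary part yields the probability.\<close>

definition square :: "complex \<Rightarrow> real \<Rightarrow> complex set"
  where "square c \<rho> = {z. Re z \<in> {Re c - \<rho>..Re c + \<rho>} \<and> Im z \<in> {Im c - \<rho>..Im c + \<rho>}}"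

lemma square_borel [measurable]: "square c \<rho> \<in> sets borel"
proof -
  have "square c \<rho> = (Re -` {Re c - \<rho>..Re c + \<rho>}) \<inter> (Im -` {Im c - \<rho>..Im c + \<rho>})"
    by (auto simp: square_def)
  moreover have "closed (Re -` {Re c - \<rho>..Re c + \<rho>})" "closed (Im -` {Im c - \<rho>..Im c + \<rho>})"
    by (intro continuous_closed_vimage closed_atLeastAtMost continuous_intros)+
  ultimately show ?thesis by (simp add: borel_closed closed_Int)
qed

lemma square_norm:
  assumes "z \<in> square c \<rho>"
  shows "cmod (z - c) \<le> 2 * \<rho>"
proof -
  have "\<bar>Re (z - c)\<bar> \<le> \<rho>" "\<bar>Im (z - c)\<bar> \<le> \<rho>" using assms by (auto simp: square_def)
  then show ?thesis using cmod_le[of "z - c"] by linarith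
qed

lemma gaussian_square_prob:
  assumes M: "prob_space M" and Z: "standard_complex_gaussian M Z" and \<rho>: "\<rho> > 0" and c: "cmod c \<le> R"
  shows "measure M (Z -` square c \<rho> \<inter> space M) \<ge> (2 * \<rho> * normal_density 0 (sqrt (1/2)) (R + \<rho>))\<^sup>2"
proof -
  interpret prob_space M by fact
  have R: "\<bar>Re c\<bar> \<le> R" "\<bar>Im c\<bar> \<le> R" using c abs_Re_le_cmod[of c] abs_Im_le_cmod[of c] by linarith+
  define q where "q = 2 * \<rho> * normal_density 0 (sqrt (1/2)) (R + \<rho>)"
  have q: "q \<ge> 0" using \<rho> by (simp add: q_def normal_density_nonneg)
  have ind: "indep_var borel (\<lambda>w. Re (Z w)) borel (\<lambda>w. Im (Z w))"
    and dre: "distributed M lborel (\<lambda>w. Re (Z w)) (\<lambda>x. ennreal (normal_density 0 (sqrt (1/2)) x))"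
    and dim: "distributed M lborel (\<lambda>w. Im (Z w)) (\<lambda>x. ennreal (normal_density 0 (sqrt (1/2)) x))"
    using Z by (auto simp: standard_complex_gaussian_def)
  have "q\<^sup>2 \<le> prob ((\<lambda>w. Re (Z w)) -` {Re c - \<rho>..Re c + \<rho>} \<inter> space M) * prob ((\<lambda>w. Im (Z w)) -` {Im c - \<rho>..Im c + \<rho>} \<inter> space M)"
    unfolding power2_eq_square q_def
    using gaussian_interval_prob[OF M dre _ \<rho> R(1)] gaussian_interval_prob[OF M dim _ \<rho> R(2)] q
    by (intro mult_mono) (auto simp: q_def)
  also have "\<dots> = prob ((\<lambda>x. (Re (Z x), Im (Z x))) -` ({Re c - \<rho>..Re c + \<rho>} \<times> {Im c - \<rho>..Im c + \<rho>}) \<inter> space M)"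
    using indep_varD[OF ind, of "{Re c - \<rho>..Re c + \<rho>}" "{Im c - \<rho>..Im c + \<rho>}"] by simp
  also have "\<dots> = prob (Z -` square c \<rho> \<inter> space M)"
    by (intro arg_cong[where f=prob]) (auto simp: square_def)
  finally show ?thesis by (simp add: q_def)
qed

text \<open>A bound for the second moment that is uniform in the variable suffices for the summability below.\<close>

lemma gaussian_second_moment:
  "\<exists>C\<ge>0. \<forall>(M :: 'a measure) Z. prob_space M \<longrightarrow> standard_complex_gaussian M Z \<longrightarrow>
     (\<integral>\<^sup>+w. ennreal ((cmod (Z w))\<^sup>2) \<partial>M) \<le> ennreal C"
proof -
  define \<sigma> where "\<sigma> = sqrt (1/2)"
  define C where "C = (LINT x|lborel. normal_density 0 \<sigma> x * x\<^sup>2)"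
  have sig: "\<sigma> > 0" by (simp add: \<sigma>_def)
  have int: "integrable lborel (\<lambda>x. normal_density 0 \<sigma> x * x\<^sup>2)"
    using integrable_normal_moment[OF sig, of 0 2] by simp
  have one: "(\<integral>\<^sup>+w. ennreal ((X w)\<^sup>2) \<partial>M) = ennreal C"
    if "distributed M lborel X (\<lambda>x. ennreal (normal_density 0 \<sigma> x))" for M :: "'a measure" and X
  proof -
    have "(\<integral>\<^sup>+w. ennreal ((X w)\<^sup>2) \<partial>M) = (\<integral>\<^sup>+x. ennreal (normal_density 0 \<sigma> x) * ennreal (x\<^sup>2) \<partial>lborel)"
      by (rule distributed_nn_integral[OF that, symmetric]) simp
    also have "\<dots> = (\<integral>\<^sup>+x. ennreal (normal_density 0 \<sigma> x * x\<^sup>2) \<partial>lborel)"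
      by (simp add: ennreal_mult)
    also have "\<dots> = ennreal C" unfolding C_def
      using int by (intro nn_integral_eq_integral) (auto simp: normal_density_nonneg)
    finally show ?thesis .
  qed
  have C0: "C \<ge> 0" unfolding C_def by (intro integral_nonneg_AE AE_I2) (simp add: normal_density_nonneg)
  have "(\<integral>\<^sup>+w. ennreal ((cmod (Z w))\<^sup>2) \<partial>M) \<le> ennreal (2 * C)"
    if M: "prob_space M" and Z: "standard_complex_gaussian M Z" for M :: "'a measure" and Z
  proof -
    have dre: "distributed M lborel (\<lambda>w. Re (Z w)) (\<lambda>x. ennreal (normal_density 0 \<sigma> x))"
      and dim: "distributed M lborel (\<lambda>w. Im (Z w)) (\<lambda>x. ennreal (normal_density 0 \<sigma> x))"
      and [measurable]: "Z \<in> borel_measurable M"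
      using Z by (auto simp: standard_complex_gaussian_def \<sigma>_def)
    have [measurable]: "(\<lambda>w. Re (Z w)) \<in> borel_measurable M" "(\<lambda>w. Im (Z w)) \<in> borel_measurable M"
      using distributed_measurable[OF dre] distributed_measurable[OF dim] by simp_all
    have "(\<integral>\<^sup>+w. ennreal ((cmod (Z w))\<^sup>2) \<partial>M) = (\<integral>\<^sup>+w. ennreal ((Re (Z w))\<^sup>2) + ennreal ((Im (Z w))\<^sup>2) \<partial>M)"
      by (simp add: cmod_power2 ennreal_plus)
    also have "\<dots> = (\<integral>\<^sup>+w. ennreal ((Re (Z w))\<^sup>2) \<partial>M) + (\<integral>\<^sup>+w. ennreal ((Im (Z w))\<^sup>2) \<partial>M)"
      by (intro nn_integral_add) measurable
    also have "\<dots> = ennreal (2 * C)" unfolding one[OF dre] one[OF dim] using C0 by (simp flip: ennreal_plus)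
    finally show ?thesis by simp
  qed
  then show ?thesis using C0 by (intro exI[of _ "2 * C"]) auto
qed

lemma gaussian_series_AE_summable:
  fixes a :: "nat \<Rightarrow> real"
  assumes M: "prob_space M" and Z: "\<And>n. standard_complex_gaussian M (\<zeta> n)"
    and a: "summable (\<lambda>n. (a n)\<^sup>2)"
  shows "AE w in M. (\<lambda>n :: int. (cmod (\<zeta> n w * complex_of_real (a (nat \<bar>n\<bar>))))\<^sup>2) summable_on UNIV"
proof -
  interpret prob_space M by fact
  obtain C where C: "C \<ge> 0" "\<And>n. (\<integral>\<^sup>+w. ennreal ((cmod (\<zeta> n w))\<^sup>2) \<partial>M) \<le> ennreal C"
    using gaussian_second_moment M Z by blast
  have [measurable]: "\<zeta> n \<in> borel_measurable M" for n using Z[of n] by (simp add: standard_complex_gaussian_def)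
  define H where "H w n = ((cmod (\<zeta> (int n) w))\<^sup>2 + (cmod (\<zeta> (- int n) w))\<^sup>2) * (a n)\<^sup>2" for w n
  have "(\<integral>\<^sup>+w. (\<Sum>n. ennreal (H w n)) \<partial>M) = (\<Sum>n. \<integral>\<^sup>+w. ennreal (H w n) \<partial>M)"
    unfolding H_def by (intro nn_integral_suminf) measurable
  also have "\<dots> \<le> (\<Sum>n. ennreal (2 * C * (a n)\<^sup>2))"
  proof (intro suminf_le)
    fix n
    have "(\<integral>\<^sup>+w. ennreal (H w n) \<partial>M) = (\<integral>\<^sup>+w. (ennreal ((cmod (\<zeta> (int n) w))\<^sup>2) + ennreal ((cmod (\<zeta> (- int n) w))\<^sup>2)) * ennreal ((a n)\<^sup>2) \<partial>M)"
      unfolding H_def by (simp add: ennreal_mult ennreal_plus)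
    also have "\<dots> = ((\<integral>\<^sup>+w. ennreal ((cmod (\<zeta> (int n) w))\<^sup>2) \<partial>M) + (\<integral>\<^sup>+w. ennreal ((cmod (\<zeta> (- int n) w))\<^sup>2) \<partial>M)) * ennreal ((a n)\<^sup>2)"
      by (subst nn_integral_multc, measurable, subst nn_integral_add, measurable)
    also have "\<dots> \<le> (ennreal C + ennreal C) * ennreal ((a n)\<^sup>2)" by (intro mult_right_mono add_mono C) auto
    also have "\<dots> = ennreal (2 * C * (a n)\<^sup>2)" using C(1) by (simp flip: ennreal_plus ennreal_mult)
    finally show "(\<integral>\<^sup>+w. ennreal (H w n) \<partial>M) \<le> ennreal (2 * C * (a n)\<^sup>2)" .
  qed auto
  also have "\<dots> < \<infinity>"
    using summable_mult[OF a, of "2 * C"] C(1) by (subst suminf_ennreal2) (auto simp: less_top)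
  finally have "AE w in M. (\<Sum>n. ennreal (H w n)) \<noteq> \<infinity>"
    unfolding H_def by (intro nn_integral_PInf_AE) (auto simp: less_top)
  then show ?thesis
  proof (rule AE_mp, intro AE_I2 impI)
    fix w assume "(\<Sum>n. ennreal (H w n)) \<noteq> \<infinity>"
    then have H: "summable (H w)" by (intro summable_suminf_not_top) (auto simp: H_def)
    have H0: "H w n \<ge> 0" for n by (simp add: H_def)
    have le: "(cmod (\<zeta> n w * complex_of_real (a (nat \<bar>n\<bar>))))\<^sup>2 \<le> H w (nat \<bar>n\<bar>)" for n
    proof (cases "n \<ge> 0")
      case True then show ?thesis by (simp add: H_def norm_mult power_mult_distrib distrib_right)
    next
      case False then show ?thesis by (simp add: H_def norm_mult power_mult_distrib distrib_right)
    qed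
    show "(\<lambda>n :: int. (cmod (\<zeta> n w * complex_of_real (a (nat \<bar>n\<bar>))))\<^sup>2) summable_on UNIV"
    proof (rule nonneg_bdd_above_summable_on)
      show "bdd_above (sum (\<lambda>n. (cmod (\<zeta> n w * complex_of_real (a (nat \<bar>n\<bar>))))\<^sup>2) ` {F. F \<subseteq> UNIV \<and> finite F})"
      proof (rule bdd_aboveI[where M="2 * suminf (H w)"], clarify)
        fix F :: "int set" assume "finite F"
        have "(\<Sum>n\<in>F. (cmod (\<zeta> n w * complex_of_real (a (nat \<bar>n\<bar>))))\<^sup>2) \<le> (\<Sum>n\<in>F. H w (nat \<bar>n\<bar>))"
          by (intro sum_mono le)
        also have "\<dots> \<le> 2 * suminf (H w)" using \<open>finite F\<close> by (intro sum_int_le_suminf H H0)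
        finally show "(\<Sum>n\<in>F. (cmod (\<zeta> n w * complex_of_real (a (nat \<bar>n\<bar>))))\<^sup>2) \<le> 2 * suminf (H w)" .
      qed
    qed simp
  qed
qed

text \<open>Any decay faster than \<open>1 / x\<^sup>3\<close> compensates for the number \<open>2 K\<^sup>2 + 1\<close> of windows of length \<open>K\<close> in the
  application of the Borel--Cantelli lemma.\<close>

lemma exp_neg_le_inverse_power:
  assumes "x > (0::real)"
  shows "exp (- x) \<le> 256 / x ^ 4"
proof -
  have "x / 4 \<le> exp (x / 4)" using exp_ge_add_one_self[of "x / 4"] by linarith
  then have "(x / 4) ^ 4 \<le> exp (x / 4) ^ 4" using assms by (intro power_mono) auto
  also have "\<dots> = exp x" by (simp flip: exp_of_nat_mult)
  finally have "x ^ 4 / 256 \<le> exp x" by (simp add: power_divide)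
  then show ?thesis using assms by (simp add: exp_minus field_simps)
qed

text \<open>Hoeffding's inequality bounds the probability of a deficient window of length \<open>K\<close> by \<open>exp (- c K)\<close>. There are
  \<open>2 K\<^sup>2 + 1\<close> windows of this length within the distance considered, so almost surely only finitely many lengths occur
  for deficient windows. The index \<open>0\<close> is left out because the weight is not controlled near the origin.\<close>

lemma (in prob_space) window_frequency:
  fixes X :: "int \<Rightarrow> 'a \<Rightarrow> real"
  assumes ind: "indep_vars (\<lambda>_. borel) X (UNIV - {0})"
    and X: "\<And>k w. X k w \<in> {0, 1}"
    and p: "p > 0" "\<And>k. k \<noteq> 0 \<Longrightarrow> expectation (X k) \<ge> p"
  shows "AE w in M. frequent (p / 4) {k. k \<noteq> 0 \<and> X k w = 1}"
proof -
  define J where "J s K = {s..<s + int K} - {0}" for s :: int and K :: nat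
  have J: "finite (J s K)" "real (card (J s K)) \<le> real K" "real (card (J s K)) \<ge> real K - 1" for s K
  proof -
    show "finite (J s K)" by (simp add: J_def)
    show "real (card (J s K)) \<le> real K" using card_mono[of "{s..<s + int K}" "J s K"] by (auto simp: J_def)
    have "card {s..<s + int K} \<le> card (J s K) + 1"
      unfolding J_def using card_Diff1_le[of "{s..<s + int K}" 0] by (simp add: card_Diff_singleton_if)
    then show "real (card (J s K)) \<ge> real K - 1" by simp
  qed
  have count: "real (card ({k. k \<noteq> 0 \<and> X k w = 1} \<inter> {s..<s + int K})) = (\<Sum>k\<in>J s K. X k w)" for s K w
  proof -
    have "(\<Sum>k\<in>J s K. X k w) = (\<Sum>k\<in>J s K. if X k w = 1 then 1 else 0)"
      using X by (intro sum.cong refl) (metis empty_iff insert_iff)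
    also have "\<dots> = real (card (J s K \<inter> {k. X k w = 1}))" using J(1) by (simp add: sum.If_cases)
    also have "J s K \<inter> {k. X k w = 1} = {k. k \<noteq> 0 \<and> X k w = 1} \<inter> {s..<s + int K}" by (auto simp: J_def)
    finally show ?thesis by simp
  qed
  have meas [measurable]: "X k \<in> borel_measurable M" if "k \<noteq> 0" for k
    using ind that by (simp add: indep_vars_def)
  \<comment> \<open>The exponent of Hoeffding's inequality for a deviation of \<open>p / 4 * K\<close> of a sum of at most \<open>K\<close> indicators.\<close>
  define c where "c = p\<^sup>2 / 8"
  have c: "c > 0" using p(1) by (simp add: c_def)
  define Bad where "Bad s K = {w \<in> space M. (\<Sum>k\<in>J s K. X k w) \<le> (\<Sum>k\<in>J s K. expectation (X k)) - p / 4 * real K}" for s K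
  have Bad_meas [measurable]: "Bad s K \<in> events" for s K
  proof -
    have "(\<lambda>w. \<Sum>k\<in>J s K. X k w) \<in> borel_measurable M"
      by (intro borel_measurable_sum meas) (auto simp: J_def)
    then show ?thesis unfolding Bad_def by measurable
  qed
  have Bad_prob: "prob (Bad s K) \<le> exp (- c * real K)" if K: "K \<ge> 2" for s K
  proof -
    have card_pos: "real (card (J s K)) > 0" using J(3)[of K s] K by linarith
    interpret H: Hoeffding_ineq M "J s K" X "\<lambda>_. 0" "\<lambda>_. 1" "\<Sum>k\<in>J s K. expectation (X k)"
    proof unfold_locales
      show "indep_vars (\<lambda>_. borel) X (J s K)" by (rule indep_vars_subset[OF ind]) (auto simp: J_def)
      show "AE x in M. X k x \<in> {0..1}" for k using X[of k] by (intro AE_I2) (metis atLeastAtMost_iff empty_iff insert_iff order_refl zero_le_one)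
    qed (simp_all add: J(1))
    have "prob (Bad s K) \<le> exp (-2 * (p / 4 * real K)\<^sup>2 / (\<Sum>k\<in>J s K. (1 - 0)\<^sup>2))"
      unfolding Bad_def using card_pos p(1) by (intro H.Hoeffding_ineq_le) auto
    also have "\<dots> \<le> exp (- c * real K)"
    proof -
      have "2 * (p / 4 * real K)\<^sup>2 / real (card (J s K)) \<ge> 2 * (p / 4 * real K)\<^sup>2 / real K"
        using J(2)[of s K] card_pos by (intro divide_left_mono) auto
      moreover have "2 * (p / 4 * real K)\<^sup>2 / real K = c * real K"
        using K by (simp add: c_def power2_eq_square field_simps)
      ultimately show ?thesis by simp
    qed
    finally show ?thesis .
  qed
  define E where "E K = (if K \<ge> 2 then \<Union>s\<in>{s. \<bar>s\<bar> \<le> int K ^ 2}. Bad s K else {})" for K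
  have fin: "{s. \<bar>s\<bar> \<le> int K ^ 2} = {- (int K ^ 2)..int K ^ 2}" for K by auto
  have E_meas [measurable]: "E K \<in> events" for K unfolding E_def fin by auto
  have E_prob: "prob (E K) \<le> 768 / c ^ 4 * (1 / (real K)\<^sup>2)" for K
  proof (cases "K \<ge> 2")
    case True
    have "prob (E K) \<le> (\<Sum>s\<in>{- (int K ^ 2)..int K ^ 2}. prob (Bad s K))"
      unfolding E_def fin using True by (simp, intro finite_measure_subadditive_finite) auto
    also have "\<dots> \<le> (\<Sum>s\<in>{- (int K ^ 2)..int K ^ 2}. exp (- c * real K))"
      by (intro sum_mono Bad_prob True)
    also have "\<dots> = (2 * real K ^ 2 + 1) * exp (- (c * real K))" by simp
    also have "\<dots> \<le> (3 * real K ^ 2) * (256 / (c * real K) ^ 4)"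
      using True c one_le_power[of "real K" 2] by (intro mult_mono exp_neg_le_inverse_power) auto
    also have "\<dots> = 768 / c ^ 4 * (1 / (real K)\<^sup>2)"
      using True by (simp add: power_mult_distrib eval_nat_numeral)
    finally show ?thesis .
  qed (use c in \<open>simp add: E_def\<close>)
  have "summable (\<lambda>K. prob (E K))"
  proof (rule summable_comparison_test')
    show "summable (\<lambda>K. 768 / c ^ 4 * (1 / (real K)\<^sup>2))"
      using inverse_power_summable[of 2, where ?'a=real] by (intro summable_mult) (simp add: inverse_eq_divide power_one_over)
    show "norm (prob (E K)) \<le> 768 / c ^ 4 * (1 / (real K)\<^sup>2)" for K using E_prob by simp
  qed
  then have "AE w in M. \<forall>\<^sub>F K in sequentially. w \<in> space M - E K"
    by (intro borel_cantelli_AE1) (auto simp: emeasure_eq_measure)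
  then show ?thesis
  proof (rule AE_mp, intro AE_I2 impI)
    fix w assume "\<forall>\<^sub>F K in sequentially. w \<in> space M - E K"
    then obtain K1 where K1: "\<And>K. K \<ge> K1 \<Longrightarrow> w \<in> space M - E K" by (auto simp: eventually_sequentially)
    show "frequent (p / 4) {k. k \<noteq> 0 \<and> X k w = 1}"
    proof (intro exI[of _ "max K1 2"] allI impI)
      fix K s assume K: "K \<ge> max K1 2" and s: "real_of_int \<bar>s\<bar> \<le> real K ^ 2"
      have "real_of_int \<bar>s\<bar> \<le> real_of_int (int K ^ 2)" using s by simp
      then have s': "\<bar>s\<bar> \<le> int K ^ 2" by linarith
      have "w \<notin> Bad s K" "w \<in> space M" using K1[of K] K s' by (auto simp: E_def)
      then have "(\<Sum>k\<in>J s K. X k w) > (\<Sum>k\<in>J s K. expectation (X k)) - p / 4 * real K"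
        by (auto simp: Bad_def)
      moreover have "(\<Sum>k\<in>J s K. expectation (X k)) \<ge> (\<Sum>k\<in>J s K. p)"
        using p(2) by (intro sum_mono) (auto simp: J_def)
      moreover have "(\<Sum>k\<in>J s K. p) \<ge> p * (real K / 2)"
      proof -
        have "real K / 2 \<le> real (card (J s K))" using J(3)[of K s] K by auto
        then show ?thesis using p(1) by (simp add: mult.commute mult_left_mono)
      qed
      ultimately show "p / 4 * real K \<le> real (card ({k. k \<noteq> 0 \<and> X k w = 1} \<inter> {s..<s + int K}))"
        unfolding count by simp
    qed
  qed
qed

text \<open>Events that concern disjoint blocks of five independent variables are independent, and their probability is a product of five
  factors bounded below.\<close>

lemma (in prob_space) block_events:
  fixes \<zeta> :: "int \<Rightarrow> 'a \<Rightarrow> complex" and U :: "int \<Rightarrow> int \<Rightarrow> complex set" and D :: int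
  assumes ind: "indep_vars (\<lambda>_. borel) \<zeta> UNIV" and D: "D \<ge> 10"
    and U: "\<And>k j. U k j \<in> sets borel"
    and q: "q > 0" "\<And>k j. k \<noteq> 0 \<Longrightarrow> \<bar>j\<bar> \<le> 2 \<Longrightarrow> prob (\<zeta> (D * k + j) -` U k j \<inter> space M) \<ge> q"
  shows "\<exists>p>0. p \<le> 1 \<and> (AE w in M. frequent p {k. k \<noteq> 0 \<and> (\<forall>j. \<bar>j\<bar> \<le> 2 \<longrightarrow> \<zeta> (D * k + j) w \<in> U k j)})"
proof -
  define B where "B k = {D * k - 2..D * k + 2}" for k
  have B_iff: "n \<in> B k \<longleftrightarrow> (\<exists>j. \<bar>j\<bar> \<le> 2 \<and> n = D * k + j)" for n k
  proof
    assume "n \<in> B k"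
    then show "\<exists>j. \<bar>j\<bar> \<le> 2 \<and> n = D * k + j" by (intro exI[of _ "n - D * k"]) (auto simp: B_def)
  qed (auto simp: B_def)
  have finB: "finite (B k)" "B k \<noteq> {}" "card (B k) = 5" for k by (auto simp: B_def)
  have disj: "disjoint_family_on B L" for L
    unfolding disjoint_family_on_def
  proof (intro ballI impI)
    fix k l :: int assume "k \<noteq> l"
    then have "\<bar>D * (k - l)\<bar> \<ge> 10 * 1" unfolding abs_mult using D by (intro mult_mono) auto
    then show "B k \<inter> B l = {}" by (auto simp: B_def algebra_simps)
  qed
  define Y where "Y k g = (\<Prod>n\<in>B k. indicator (U k (n - D * k)) (g n) :: real)" for k and g :: "int \<Rightarrow> complex"
  define X where "X k w = Y k (restrict (\<lambda>n. \<zeta> n w) (B k))" for k w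
  have indX: "indep_vars (\<lambda>_. borel) X (UNIV - {0})"
    unfolding X_def
  proof (rule indep_vars_compose2[OF indep_vars_restrict[OF ind _ disj]])
    fix k
    show "Y k \<in> borel_measurable (Pi\<^sub>M (B k) (\<lambda>_. borel))"
      unfolding Y_def
    proof (intro borel_measurable_prod)
      fix n assume n: "n \<in> B k"
      have "indicator (U k (n - D * k)) \<in> borel_measurable (borel :: complex measure)" using U by simp
      moreover have "(\<lambda>g. g n) \<in> measurable (Pi\<^sub>M (B k) (\<lambda>_. borel)) (borel :: complex measure)"
        using n by (rule measurable_component_singleton)
      ultimately show "(\<lambda>g. indicator (U k (n - D * k)) (g n) :: real) \<in> borel_measurable (Pi\<^sub>M (B k) (\<lambda>_. borel))"
        by (rule measurable_compose[rotated])
    qed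
  qed auto
  have Xval: "X k w = (if \<forall>n\<in>B k. \<zeta> n w \<in> U k (n - D * k) then 1 else 0)" for k w
  proof -
    have "X k w = (\<Prod>n\<in>B k. indicator (U k (n - D * k)) (\<zeta> n w))"
      unfolding X_def Y_def by (intro prod.cong) auto
    also have "\<dots> = (if \<forall>n\<in>B k. \<zeta> n w \<in> U k (n - D * k) then 1 else 0)"
      using finB(1)[of k] by (auto simp: indicator_def intro: prod_zero)
    finally show ?thesis .
  qed
  define p where "p = min 1 (q ^ 5)"
  have p: "p > 0" "p \<le> 1" using q(1) by (auto simp: p_def)
  have expX: "expectation (X k) \<ge> p" if k: "k \<noteq> 0" for k
  proof -
    have "(\<Prod>n\<in>B k. q) \<le> (\<Prod>n\<in>B k. prob (\<zeta> n -` U k (n - D * k) \<inter> space M))"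
      using q k by (intro prod_mono) (auto simp: B_iff)
    also have "\<dots> = prob (\<Inter>n\<in>B k. \<zeta> n -` U k (n - D * k) \<inter> space M)"
      by (rule indep_varsD_finite[symmetric, OF indep_vars_subset[OF ind]]) (use finB U in auto)
    also have "\<dots> = expectation (indicator (\<Inter>n\<in>B k. \<zeta> n -` U k (n - D * k) \<inter> space M))"
    proof -
      have "\<zeta> n -` U k (n - D * k) \<inter> space M \<in> events" for n
        using ind U by (auto simp: indep_vars_def intro: measurable_sets)
      then have "(\<Inter>n\<in>B k. \<zeta> n -` U k (n - D * k) \<inter> space M) \<in> events"
        using finB by (intro sets.finite_INT) auto
      then show ?thesis by simp
    qed
    also have "\<dots> = expectation (X k)"
    proof (rule Bochner_Integration.integral_cong[OF refl])
      fix w assume "w \<in> space M"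
      then show "indicat_real (\<Inter>n\<in>B k. \<zeta> n -` U k (n - D * k) \<inter> space M) w = X k w"
        unfolding Xval using finB(2)[of k] by (auto simp: indicator_def)
    qed
    finally show ?thesis by (simp add: finB p_def)
  qed
  have eq: "{k. k \<noteq> 0 \<and> X k w = 1} = {k. k \<noteq> 0 \<and> (\<forall>j. \<bar>j\<bar> \<le> 2 \<longrightarrow> \<zeta> (D * k + j) w \<in> U k j)}" for w
  proof -
    have "(\<forall>n\<in>B k. \<zeta> n w \<in> U k (n - D * k)) \<longleftrightarrow> (\<forall>j. \<bar>j\<bar> \<le> 2 \<longrightarrow> \<zeta> (D * k + j) w \<in> U k j)" for k
    proof (intro iffI allI ballI impI)
      fix j :: int assume all: "\<forall>n\<in>B k. \<zeta> n w \<in> U k (n - D * k)" and j: "\<bar>j\<bar> \<le> 2"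
      have "D * k + j \<in> B k" using j B_iff by blast
      then have "\<zeta> (D * k + j) w \<in> U k (D * k + j - D * k)" using all by blast
      then show "\<zeta> (D * k + j) w \<in> U k j" by simp
    next
      fix n assume all: "\<forall>j. \<bar>j\<bar> \<le> 2 \<longrightarrow> \<zeta> (D * k + j) w \<in> U k j" and "n \<in> B k"
      then obtain j where "\<bar>j\<bar> \<le> 2" "n = D * k + j" using B_iff by blast
      then show "\<zeta> n w \<in> U k (n - D * k)" using all by simp
    qed
    then show ?thesis unfolding Xval by auto
  qed
  have "AE w in M. frequent (p / 4) {k. k \<noteq> 0 \<and> X k w = 1}"
    by (rule window_frequency[OF indX _ p(1) expX]) (auto simp: Xval)
  then show ?thesis unfolding eq using p by (intro exI[of _ "p / 4"]) auto
qed

section \<open>The random function\<close>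

lemma (in admissible_weight) square_summable_on_multiples:
  assumes "summable (\<lambda>n. (\<omega> (real n))\<^sup>2)" "D > 0"
  shows "(\<lambda>k. (\<omega> (of_int \<bar>D * k\<bar>))\<^sup>2) summable_on G"
proof (rule nonneg_bdd_above_summable_on)
  show "bdd_above (sum (\<lambda>k. (\<omega> (of_int \<bar>D * k\<bar>))\<^sup>2) ` {F. F \<subseteq> G \<and> finite F})"
  proof (rule bdd_aboveI[where M="2 * (\<Sum>n. (\<omega> (real n))\<^sup>2)"], clarify)
    fix F :: "int set" assume F: "finite F"
    have "(\<Sum>k\<in>F. (\<omega> (of_int \<bar>D * k\<bar>))\<^sup>2) = (\<Sum>z\<in>(\<lambda>k. D * k) ` F. (\<omega> (real (nat \<bar>z\<bar>)))\<^sup>2)"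
      using assms(2) by (subst sum.reindex) (auto simp: inj_on_def)
    also have "\<dots> \<le> 2 * (\<Sum>n. (\<omega> (real n))\<^sup>2)"
      using F assms(1) by (intro sum_int_le_suminf) auto
    finally show "(\<Sum>k\<in>F. (\<omega> (of_int \<bar>D * k\<bar>))\<^sup>2) \<le> 2 * (\<Sum>n. (\<omega> (real n))\<^sup>2)" .
  qed
qed simp

lemma (in admissible_weight) neighbours_comparable:
  assumes "D \<ge> 10" "k \<noteq> 0" "\<bar>j\<bar> \<le> 2"
  shows "\<omega> (of_int \<bar>D * k + j\<bar>) > 0" "\<omega> (of_int \<bar>D * k\<bar>) > 0"
    and "\<omega> (of_int \<bar>D * k\<bar>) / \<omega> (of_int \<bar>D * k + j\<bar>) \<le> 1 / \<delta>"
    and "\<omega> (of_int \<bar>D * k + j\<bar>) / \<omega> (of_int \<bar>D * k\<bar>) \<le> 1 / \<delta>"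
proof -
  show pos: "\<omega> (of_int \<bar>D * k + j\<bar>) > 0" "\<omega> (of_int \<bar>D * k\<bar>) > 0" by (auto intro: positive)
  define r x where "r = real_of_int \<bar>D * k\<bar>" and "x = real_of_int \<bar>D * k + j\<bar>"
  have "\<bar>D * k\<bar> \<ge> 10 * 1" unfolding abs_mult using assms by (intro mult_mono) auto
  then have r: "r \<ge> 10" unfolding r_def by linarith
  have "\<bar>x - r\<bar> \<le> 2" using assms(3) unfolding x_def r_def by linarith
  then have x: "r / 2 \<le> x" "x \<le> 2 * r" using r by linarith+
  have c: "\<delta> * \<omega> r \<le> \<omega> x" "\<omega> x \<le> \<omega> r / \<delta>" using comparable[OF _ x] r by auto
  show "\<omega> (of_int \<bar>D * k\<bar>) / \<omega> (of_int \<bar>D * k + j\<bar>) \<le> 1 / \<delta>"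
    using c(1) pos \<delta> unfolding r_def[symmetric] x_def[symmetric] by (simp add: field_simps)
  show "\<omega> (of_int \<bar>D * k + j\<bar>) / \<omega> (of_int \<bar>D * k\<bar>) \<le> 1 / \<delta>"
    using c(2) pos \<delta> unfolding r_def[symmetric] x_def[symmetric] by (simp add: field_simps)
qed

text \<open>The set for a variable that places its normalized coefficient near the ideal value. Consecutive weights differ by a factor
  between \<open>\<delta>\<close> and \<open>1 / \<delta>\<close>, hence the centres of these squares stay in a fixed disc.\<close>

definition good_values :: "(real \<Rightarrow> real) \<Rightarrow> real \<Rightarrow> int \<Rightarrow> int \<Rightarrow> int \<Rightarrow> complex set"
  where "good_values \<omega> \<delta> D k j = square (complex_of_real (\<omega> (of_int \<bar>D * k\<bar>) / \<omega> (of_int \<bar>D * k + j\<bar>)) * (sg j * base_amp j)) (\<delta> / 2000)"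

lemma (in admissible_weight) spectral_blocks_of_good_values:
  assumes D: "D \<ge> 10" "even D"
    and coupling: "\<And>k F. k \<noteq> 0 \<Longrightarrow> finite F \<Longrightarrow> F \<subseteq> UNIV - {0, k} \<Longrightarrow>
       (\<Sum>l\<in>F. \<omega> (of_int \<bar>D * l\<bar>) / \<omega> (of_int \<bar>D * k\<bar>) / (of_int (D * (k - l)))\<^sup>2) \<le> 1/1000"
    and sq: "summable (\<lambda>n. (\<omega> (real n))\<^sup>2)"
    and f: "f \<in> L2 circ" "\<And>n. fourier_coeff f n = z n * complex_of_real (\<omega> (of_int \<bar>n\<bar>))"
    and G: "\<And>k. k \<in> G \<Longrightarrow> k \<noteq> 0" "\<And>k j. k \<in> G \<Longrightarrow> \<bar>j\<bar> \<le> 2 \<Longrightarrow> z (D * k + j) \<in> good_values \<omega> \<delta> D k j"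
  shows "spectral_blocks G D (\<lambda>k. \<omega> (of_int \<bar>D * k\<bar>))
     (\<lambda>k j. sg j * fourier_coeff f (D * k + j) / complex_of_real (\<omega> (of_int \<bar>D * k\<bar>))) f"
proof unfold_locales
  show "0 < \<omega> (of_int \<bar>D * k\<bar>)" for k by (auto intro: positive)
  show "(\<Sum>l\<in>F. \<omega> (of_int \<bar>D * l\<bar>) / \<omega> (of_int \<bar>D * k\<bar>) / (of_int (D * (k - l)))\<^sup>2) \<le> 1/1000"
    if "k \<in> G" "finite F" "F \<subseteq> G - {k}" for k F
    using that G(1) by (intro coupling) auto
  show "(\<lambda>k. (\<omega> (of_int \<bar>D * k\<bar>))\<^sup>2) summable_on G"
    using D by (intro square_summable_on_multiples sq) auto
  fix k j assume k: "k \<in> G" and j: "\<bar>j :: int\<bar> \<le> 2"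
  define r x where "r = \<omega> (of_int \<bar>D * k\<bar>)" and "x = \<omega> (of_int \<bar>D * k + j\<bar>)"
  have rx: "x > 0" "r > 0" "x / r \<le> 1 / \<delta>"
    using neighbours_comparable[OF D(1) G(1)[OF k] j] by (auto simp: r_def x_def)
  show "complex_of_real (\<omega> (of_int \<bar>D * k\<bar>)) * (sg j * fourier_coeff f (D * k + j) / complex_of_real (\<omega> (of_int \<bar>D * k\<bar>))) =
      sg j * fourier_coeff f (D * k + j)"
    using rx(2) by (simp add: r_def)
  define u where "u = complex_of_real (r / x) * (sg j * base_amp j)"
  have "cmod (z (D * k + j) - u) \<le> 2 * (\<delta> / 2000)"
    using G(2)[OF k j] unfolding good_values_def r_def[symmetric] x_def[symmetric] u_def[symmetric] by (rule square_norm)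
  then have zu: "cmod (z (D * k + j) - u) \<le> \<delta> / 1000" by simp
  have "sg j * fourier_coeff f (D * k + j) / complex_of_real r - base_amp j = sg j * complex_of_real (x / r) * (z (D * k + j) - u)"
  proof -
    have fz: "fourier_coeff f (D * k + j) = z (D * k + j) * complex_of_real x" by (simp only: f(2) x_def)
    have "sg j * complex_of_real (x / r) * (z (D * k + j) - u) =
        sg j * complex_of_real (x / r) * z (D * k + j) - (sg j * sg j) * complex_of_real ((x / r) * (r / x)) * base_amp j"
      unfolding u_def of_real_mult by (simp only: right_diff_distrib mult_ac)
    also have "\<dots> = sg j * complex_of_real (x / r) * z (D * k + j) - base_amp j" using rx by simp
    finally show ?thesis by (simp add: fz)
  qed
  then have "cmod (sg j * fourier_coeff f (D * k + j) / complex_of_real r - base_amp j) = x / r * cmod (z (D * k + j) - u)"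
    using rx by (simp add: norm_mult norm_divide)
  also have "\<dots> \<le> (1 / \<delta>) * (\<delta> / 1000)" using rx zu \<delta> by (intro mult_mono) auto
  also have "\<dots> = 1/1000" using \<delta> by simp
  finally show "cmod (sg j * fourier_coeff f (D * k + j) / complex_of_real (\<omega> (of_int \<bar>D * k\<bar>)) - base_amp j) \<le> 1/1000"
    by (simp add: r_def)
qed (use D f in auto)

theorem theorem1:
  fixes M :: "'a measure" and \<omega> :: "real \<Rightarrow> real" and \<delta> :: real and \<zeta> :: "int \<Rightarrow> 'a \<Rightarrow> complex"
  assumes "\<omega> \<in> L2 (lebesgue_on {0..})"
    and "antimono_on {0..} \<omega>"
    and "\<delta> > 0"
    and "\<And>x. x \<ge> 1 \<Longrightarrow> x * \<omega> x \<ge> \<delta>"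
    and "\<And>x. x \<ge> 1 \<Longrightarrow> \<omega> (2 * x) \<ge> \<delta> * \<omega> x"
    and "prob_space M"
    and "prob_space.indep_vars M (\<lambda>_. borel) \<zeta> UNIV"
    and "\<And>m. standard_complex_gaussian M (\<zeta> m)"
  shows "(AE w in M. \<exists>f\<in>L2 circ. \<forall>n. fourier_coeff f n = \<zeta> n w * complex_of_real (\<omega> (real_of_int \<bar>n\<bar>)))
    \<and> (\<exists>\<epsilon>>0. AE w in M. \<forall>f\<in>L2 circ.
        (\<forall>n. fourier_coeff f n = \<zeta> n w * complex_of_real (\<omega> (real_of_int \<bar>n\<bar>))) \<longrightarrow>
        (\<exists>\<Lambda> :: real set.
           BM_density \<Lambda> < ereal (1 - \<epsilon>) \<and>
           f \<in> L2_closed_span circ expo \<Lambda> \<and>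
           riesz_basis circ expo \<Lambda> (L2_closed_span circ expo \<Lambda>) \<and>
           (\<exists>a :: real \<Rightarrow> complex.
              (\<lambda>l. (cmod (a l))\<^sup>2) summable_on \<Lambda> \<and>
              has_L2_sum circ (\<lambda>l t. a l * expo l t) \<Lambda> f)))"
proof (intro conjI)
  interpret M: prob_space M by fact
  interpret W: admissible_weight \<omega> \<delta> by unfold_locales (use assms(2-5) in auto)
  have sq: "summable (\<lambda>n. (\<omega> (real n))\<^sup>2)" by (rule W.nat_square_summable[OF assms(1)])
  have "AE w in M. (\<lambda>n. (cmod (\<zeta> n w * complex_of_real (\<omega> (real (nat \<bar>n\<bar>)))))\<^sup>2) summable_on UNIV"
    by (rule gaussian_series_AE_summable[OF assms(6) assms(8) sq])
  then show "AE w in M. \<exists>f\<in>L2 circ. \<forall>n. fourier_coeff f n = \<zeta> n w * complex_of_real (\<omega> (real_of_int \<bar>n\<bar>))"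
  proof (rule AE_mp, intro AE_I2 impI)
    fix w assume "(\<lambda>n. (cmod (\<zeta> n w * complex_of_real (\<omega> (real (nat \<bar>n\<bar>)))))\<^sup>2) summable_on UNIV"
    then show "\<exists>f\<in>L2 circ. \<forall>n. fourier_coeff f n = \<zeta> n w * complex_of_real (\<omega> (real_of_int \<bar>n\<bar>))"
      using trig_series_exists[of "\<lambda>n. \<zeta> n w * complex_of_real (\<omega> (real_of_int \<bar>n\<bar>))" UNIV] by auto
  qed
  obtain D0 where D0_all: "\<forall>D\<ge>D0. \<forall>k F. k \<noteq> 0 \<longrightarrow> finite F \<longrightarrow> F \<subseteq> UNIV - {0, k} \<longrightarrow>
       (\<Sum>l\<in>F. \<omega> (of_int \<bar>D * l\<bar>) / \<omega> (of_int \<bar>D * k\<bar>) / (of_int (D * (k - l)))\<^sup>2) \<le> 1/1000"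
    using W.weak_coupling by (elim exE)
  note D0 = D0_all[rule_format]
  \<comment> \<open>Even, at least \<open>10\<close>, and large enough for weak coupling.\<close>
  define D where "D = 2 * max 5 D0"
  have D: "D \<ge> 10" "even D" "D \<ge> D0" by (auto simp: D_def)
  define \<rho> where "\<rho> = \<delta> / 2000"
  define q where "q = (2 * \<rho> * normal_density 0 (sqrt (1/2)) (1 / \<delta> + \<rho>))\<^sup>2"
  have "normal_density 0 (sqrt (1/2)) (1 / \<delta> + \<rho>) > 0" by (rule normal_density_pos) simp
  moreover have "\<rho> > 0" using assms(3) by (simp add: \<rho>_def)
  ultimately have q: "q > 0" unfolding q_def by (intro zero_less_power mult_pos_pos) simp_all
  have prob: "M.prob (\<zeta> (D * k + j) -` good_values \<omega> \<delta> D k j \<inter> space M) \<ge> q" if "k \<noteq> 0" "\<bar>j\<bar> \<le> 2" for k j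
    unfolding good_values_def q_def \<rho>_def
  proof (rule gaussian_square_prob[OF assms(6,8)])
    have "cmod (complex_of_real (\<omega> (of_int \<bar>D * k\<bar>) / \<omega> (of_int \<bar>D * k + j\<bar>)) * (sg j * base_amp j)) =
        \<omega> (of_int \<bar>D * k\<bar>) / \<omega> (of_int \<bar>D * k + j\<bar>) * cmod (base_amp j)"
      using W.neighbours_comparable(1,2)[OF D(1) that] by (simp add: norm_mult norm_divide)
    also have "\<dots> \<le> (1 / \<delta>) * 1"
      using W.neighbours_comparable[OF D(1) that] assms(3) by (intro mult_mono norm_base_amp) auto
    finally show "cmod (complex_of_real (\<omega> (of_int \<bar>D * k\<bar>) / \<omega> (of_int \<bar>D * k + j\<bar>)) * (sg j * base_amp j)) \<le> 1 / \<delta>"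
      by simp
  qed (use assms(3) in simp)
  have "\<exists>p>0. p \<le> 1 \<and> (AE w in M. frequent p {k. k \<noteq> 0 \<and> (\<forall>j. \<bar>j\<bar> \<le> 2 \<longrightarrow> \<zeta> (D * k + j) w \<in> good_values \<omega> \<delta> D k j)})"
    by (rule M.block_events[OF assms(7) D(1) _ q prob]) (auto simp: good_values_def square_borel)
  then obtain p where p: "p > 0" "p \<le> 1" and freq: "AE w in M. frequent p {k. k \<noteq> 0 \<and> (\<forall>j. \<bar>j\<bar> \<le> 2 \<longrightarrow> \<zeta> (D * k + j) w \<in> good_values \<omega> \<delta> D k j)}"
    by blast
  \<comment> \<open>Half of the gain in density, which leaves room for the strict inequality.\<close>
  define \<epsilon> where "\<epsilon> = p / (4 * of_int D)"
  have eps: "\<epsilon> > 0" "1 - p / (2 * of_int D) < 1 - \<epsilon>" using p D(1) by (auto simp: \<epsilon>_def field_simps)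
  show "\<exists>\<epsilon>>0. AE w in M. \<forall>f\<in>L2 circ.
        (\<forall>n. fourier_coeff f n = \<zeta> n w * complex_of_real (\<omega> (real_of_int \<bar>n\<bar>))) \<longrightarrow>
        (\<exists>\<Lambda> :: real set.
           BM_density \<Lambda> < ereal (1 - \<epsilon>) \<and>
           f \<in> L2_closed_span circ expo \<Lambda> \<and>
           riesz_basis circ expo \<Lambda> (L2_closed_span circ expo \<Lambda>) \<and>
           (\<exists>a :: real \<Rightarrow> complex.
              (\<lambda>l. (cmod (a l))\<^sup>2) summable_on \<Lambda> \<and>
              has_L2_sum circ (\<lambda>l t. a l * expo l t) \<Lambda> f))"
  proof (intro exI[of _ \<epsilon>] conjI eps(1), rule AE_mp[OF freq], intro AE_I2 impI ballI)
    fix w f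
    define G where "G = {k. k \<noteq> 0 \<and> (\<forall>j. \<bar>j\<bar> \<le> 2 \<longrightarrow> \<zeta> (D * k + j) w \<in> good_values \<omega> \<delta> D k j)}"
    assume win: "frequent p {k. k \<noteq> 0 \<and> (\<forall>j. \<bar>j\<bar> \<le> 2 \<longrightarrow> \<zeta> (D * k + j) w \<in> good_values \<omega> \<delta> D k j)}"
      and f: "f \<in> L2 circ" "\<forall>n. fourier_coeff f n = \<zeta> n w * complex_of_real (\<omega> (real_of_int \<bar>n\<bar>))"
    interpret B: spectral_blocks G D "\<lambda>k. \<omega> (of_int \<bar>D * k\<bar>)"
      "\<lambda>k j. sg j * fourier_coeff f (D * k + j) / complex_of_real (\<omega> (of_int \<bar>D * k\<bar>))" f
      by (rule W.spectral_blocks_of_good_values[where z="\<lambda>n. \<zeta> n w"])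
        (use D(1,2) D0[OF D(3)] sq f in \<open>auto simp: G_def\<close>)
    obtain \<theta> A where repr: "\<forall>n. \<bar>\<theta> n\<bar> \<le> 1/500"
      "(\<lambda>n. (cmod (A n))\<^sup>2) summable_on (UNIV - (\<lambda>k. D * k) ` G)"
      "has_L2_sum circ (\<lambda>n t. A n * expo (of_int n + \<theta> n) t) (UNIV - (\<lambda>k. D * k) ` G) f"
      using B.spectral_representation by (elim exE conjE)
    define \<Lambda> where "\<Lambda> = (\<lambda>n. of_int n + \<theta> n) ` (UNIV - (\<lambda>k. D * k) ` G)"
    note concl = perturbed_frequencies_conclusion[OF repr(1)[rule_format] repr(2) f(1) repr(3), folded \<Lambda>_def]
    have "BM_density \<Lambda> \<le> ereal (1 - p / (2 * of_int D))"
      unfolding \<Lambda>_def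
    proof (rule BM_density_le)
      show "\<bar>\<theta> n\<bar> \<le> 1" for n using repr(1)[rule_format, of n] by simp
      show "frequent p G" using win unfolding G_def .
    qed (use p D in auto)
    also have "\<dots> < ereal (1 - \<epsilon>)" using eps(2) by simp
    finally show "\<exists>\<Lambda> :: real set.
           BM_density \<Lambda> < ereal (1 - \<epsilon>) \<and>
           f \<in> L2_closed_span circ expo \<Lambda> \<and>
           riesz_basis circ expo \<Lambda> (L2_closed_span circ expo \<Lambda>) \<and>
           (\<exists>a :: real \<Rightarrow> complex.
              (\<lambda>l. (cmod (a l))\<^sup>2) summable_on \<Lambda> \<and>
              has_L2_sum circ (\<lambda>l t. a l * expo l t) \<Lambda> f)"
      using concl by blast
  qed
qed

end
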